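(* The functors $\mathrm{Sym}_R:R\text{-}\mathbf{Mod}\to\mathbf{CAlg}_R$, for all commutative rings $R$, together with the natural isomorphisms $$\mathrm{Sym}_f:\;(-)\otimes_RS\circ\mathrm{Sym}_R\;\cong\;\mathrm{Sym}_S\circ\big((-)\otimes_RS\big):R\text{-}\mathbf{Mod}\to\mathbf{CAlg}_S$$ for all ring maps $f:R\to S$, form a pseudonatural transformation between the pseudofunctors $\mathbf{Cring}\to\mathfrak{Cat}$ given by $R\mapsto R\text{-}\mathbf{Mod}$ and $R\mapsto\mathbf{CAlg}_R$, both with action $f\mapsto(-)\otimes_RS$ on ring maps $f:R\to S$.
   Context: $\mathbf{Cring}$ is the category of commutative rings (viewed as a locally discrete $2$-category), $\mathfrak{Cat}$ the $2$-category of categories, $\mathbf{CAlg}_R$ the category of commutative $R$-algebras, and $\mathrm{Sym}_R$ the symmetric algebra functor, left adjoint to the functor $\mathrm{Und}_R:\mathbf{CAlg}_R\to R\text{-}\mathbf{Mod}$ taking the underlying module. The compositors of both pseudofunctors are the canonical isomorphisms $((-)\otimes_RS)\otimes_ST\cong(-)\otimes_RT$. The isomorphism $\mathrm{Sym}_f$ is the canonical one between two left adjoints of the same functor: both composites are left adjoint to $\mathrm{res}_f\circ\mathrm{Und}_S=\mathrm{Und}_R\circ W_f:\mathbf{CAlg}_S\to R\text{-}\mathbf{Mod}$, where $\mathrm{res}_f$ is restriction of scalars for modules and $W_f:\mathbf{CAlg}_S\to\mathbf{CAlg}_R$ sends $S\to B$ to $R\xrightarrow{f}S\to B$. *)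

theory Defs
  imports "HOL-Algebra.Module"
begin

section \<open>Categories, functors, natural transformations\<close>

record ('o, 'a) category =
  Obj :: "'o set"
  Arr :: "'a set"
  Dom :: "'a \<Rightarrow> 'o"
  Cod :: "'a \<Rightarrow> 'o"
  Idt :: "'o \<Rightarrow> 'a"
  Cmp :: "'a \<Rightarrow> 'a \<Rightarrow> 'a"  (infixl \<open>\<cdot>\<index>\<close> 70)

definition Hom :: "('o, 'a, 'm) category_scheme \<Rightarrow> 'o \<Rightarrow> 'o \<Rightarrow> 'a set"
  where "Hom C a b = {f \<in> Arr C. Dom C f = a \<and> Cod C f = b}"

locale category =
  fixes C (structure)
  assumes Dom_in_Obj: "f \<in> Arr C \<Longrightarrow> Dom C f \<in> Obj C"
    and Cod_in_Obj: "f \<in> Arr C \<Longrightarrow> Cod C f \<in> Obj C"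
    and Idt_in_Hom: "a \<in> Obj C \<Longrightarrow> Idt C a \<in> Hom C a a"
    and Cmp_in_Hom: "\<lbrakk>f \<in> Hom C a b; g \<in> Hom C b c\<rbrakk> \<Longrightarrow> g \<cdot> f \<in> Hom C a c"
    and Cmp_Idt_left: "f \<in> Hom C a b \<Longrightarrow> Idt C b \<cdot> f = f"
    and Cmp_Idt_right: "f \<in> Hom C a b \<Longrightarrow> f \<cdot> Idt C a = f"
    and Cmp_assoc: "\<lbrakk>f \<in> Hom C a b; g \<in> Hom C b c; h \<in> Hom C c d\<rbrakk>
      \<Longrightarrow> h \<cdot> g \<cdot> f = h \<cdot> (g \<cdot> f)"

definition iso_in :: "('o, 'a, 'm) category_scheme \<Rightarrow> 'a \<Rightarrow> bool"
  where "iso_in C f \<longleftrightarrow> f \<in> Arr C \<and>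
    (\<exists>g \<in> Hom C (Cod C f) (Dom C f).
       g \<cdot>\<^bsub>C\<^esub> f = Idt C (Dom C f) \<and> f \<cdot>\<^bsub>C\<^esub> g = Idt C (Cod C f))"

record ('o, 'a, 'p, 'b) fctr =
  Fo :: "'o \<Rightarrow> 'p"
  Fa :: "'a \<Rightarrow> 'b"

locale cat_functor = C: category C + D: category D for C D +
  fixes F :: "('o, 'a, 'p, 'b) fctr"
  assumes Fo_in_Obj: "a \<in> Obj C \<Longrightarrow> Fo F a \<in> Obj D"
    and Fa_in_Hom: "f \<in> Hom C a b \<Longrightarrow> Fa F f \<in> Hom D (Fo F a) (Fo F b)"
    and Fa_Idt: "a \<in> Obj C \<Longrightarrow> Fa F (Idt C a) = Idt D (Fo F a)"
    and Fa_Cmp: "\<lbrakk>f \<in> Hom C a b; g \<in> Hom C b c\<rbrakk>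
      \<Longrightarrow> Fa F (g \<cdot>\<^bsub>C\<^esub> f) = Fa F g \<cdot>\<^bsub>D\<^esub> Fa F f"

definition id_fctr :: "('o, 'a, 'o, 'a) fctr"
  where "id_fctr = \<lparr>Fo = (\<lambda>a. a), Fa = (\<lambda>f. f)\<rparr>"

definition comp_fctr ::
    "('p, 'b, 'q, 'c) fctr \<Rightarrow> ('o, 'a, 'p, 'b) fctr \<Rightarrow> ('o, 'a, 'q, 'c) fctr"  (infixl \<open>\<circ>\<^sub>F\<close> 70)
  where "G \<circ>\<^sub>F F = \<lparr>Fo = (\<lambda>a. Fo G (Fo F a)), Fa = (\<lambda>f. Fa G (Fa F f))\<rparr>"

locale nat_trans = F: cat_functor C D F + G: cat_functor C D G for C D F G +
  fixes \<tau>
  assumes component_in_Hom: "a \<in> Obj C \<Longrightarrow> \<tau> a \<in> Hom D (Fo F a) (Fo G a)"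
    and naturality: "f \<in> Hom C a b \<Longrightarrow> Fa G f \<cdot>\<^bsub>D\<^esub> \<tau> a = \<tau> b \<cdot>\<^bsub>D\<^esub> Fa F f"

locale nat_iso = nat_trans +
  assumes component_iso: "a \<in> Obj C \<Longrightarrow> iso_in D (\<tau> a)"

section \<open>Left adjoints and their canonical comparison\<close>

locale left_adjoint = F: cat_functor C D F + U: cat_functor D C U
    + unit: nat_trans C C id_fctr "U \<circ>\<^sub>F F" \<eta> for C D F U \<eta> +
  assumes universal: "\<lbrakk>c \<in> Obj C; d \<in> Obj D; h \<in> Hom C c (Fo U d)\<rbrakk>
    \<Longrightarrow> \<exists>!k. k \<in> Hom D (Fo F c) d \<and> Fa U k \<cdot>\<^bsub>C\<^esub> \<eta> c = h"

text \<open>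
  If \<open>F\<close> and \<open>G\<close> are left adjoint to the same \<open>U : D \<rightarrow> C\<close>, with units \<open>\<eta>\<close> and \<open>\<theta>\<close>, the
  canonical isomorphism \<open>F \<cong> G\<close> has as component at \<open>c\<close> the arrow that carries \<open>\<eta> c\<close> to \<open>\<theta> c\<close>.
\<close>

definition left_adjoint_comparison where
  "left_adjoint_comparison C D U F \<eta> G \<theta> c =
     (THE k. k \<in> Hom D (Fo F c) (Fo G c) \<and> Fa U k \<cdot>\<^bsub>C\<^esub> \<eta> c = \<theta> c)"

text \<open>
  The unit of a composite adjunction: \<open>\<eta>\<close> is the unit of \<open>F \<stileturn> U\<close> and \<open>\<theta>\<close> that of an
  adjunction whose left adjoint is applied after \<open>F\<close>.
\<close>

definition comp_unit where
  "comp_unit C U F \<eta> \<theta> c = Fa U (\<theta> (Fo F c)) \<cdot>\<^bsub>C\<^esub> \<eta> c"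

section \<open>Pseudofunctors into the 2-category of categories\<close>

text \<open>
  A pseudofunctor \<open>P : B \<rightarrow> Cat\<close>, where the category \<open>B\<close> is regarded as a locally discrete
  2-category, so that there is no action on 2-cells beyond identities. Its structure isomorphisms
  are \<open>compositor P f g : P(g) \<circ> P(f) \<cong> P(g \<cdot> f)\<close> and \<open>unitor P a : 1 \<cong> P(1\<^sub>a)\<close>. As the 2-category of
  categories is strict, its associators and unitors are omitted from the coherence laws.
\<close>

record ('c, 'd, 'o, 'a) psfunctor =
  fibre :: "'c \<Rightarrow> ('o, 'a) category"
  push :: "'d \<Rightarrow> ('o, 'a, 'o, 'a) fctr"
  compositor :: "'d \<Rightarrow> 'd \<Rightarrow> 'o \<Rightarrow> 'a"
  unitor :: "'c \<Rightarrow> 'o \<Rightarrow> 'a"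

locale pseudofunctor = B: category B for B +
  fixes P :: "('c, 'd, 'o, 'a) psfunctor"
  assumes fibre_category: "a \<in> Obj B \<Longrightarrow> category (fibre P a)"
    and push_functor: "f \<in> Hom B a b \<Longrightarrow> cat_functor (fibre P a) (fibre P b) (push P f)"
    and compositor_iso: "\<lbrakk>f \<in> Hom B a b; g \<in> Hom B b c\<rbrakk> \<Longrightarrow>
      nat_iso (fibre P a) (fibre P c) (push P g \<circ>\<^sub>F push P f) (push P (g \<cdot>\<^bsub>B\<^esub> f)) (compositor P f g)"
    and unitor_iso: "a \<in> Obj B \<Longrightarrow>
      nat_iso (fibre P a) (fibre P a) id_fctr (push P (Idt B a)) (unitor P a)"
    and compositor_assoc:
      "\<lbrakk>f \<in> Hom B a b; g \<in> Hom B b c; h \<in> Hom B c d; x \<in> Obj (fibre P a)\<rbrakk> \<Longrightarrow>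
       compositor P (g \<cdot>\<^bsub>B\<^esub> f) h x \<cdot>\<^bsub>fibre P d\<^esub> Fa (push P h) (compositor P f g x)
       = compositor P f (h \<cdot>\<^bsub>B\<^esub> g) x \<cdot>\<^bsub>fibre P d\<^esub> compositor P g h (Fo (push P f) x)"
    and compositor_unit_right:
      "\<lbrakk>f \<in> Hom B a b; x \<in> Obj (fibre P a)\<rbrakk> \<Longrightarrow>
       compositor P (Idt B a) f x \<cdot>\<^bsub>fibre P b\<^esub> Fa (push P f) (unitor P a x)
       = Idt (fibre P b) (Fo (push P f) x)"
    and compositor_unit_left:
      "\<lbrakk>f \<in> Hom B a b; x \<in> Obj (fibre P a)\<rbrakk> \<Longrightarrow>
       compositor P f (Idt B b) x \<cdot>\<^bsub>fibre P b\<^esub> unitor P b (Fo (push P f) x)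
       = Idt (fibre P b) (Fo (push P f) x)"

text \<open>
  A pseudonatural transformation \<open>P \<rightarrow> Q\<close> with components \<open>\<alpha> a : P(a) \<rightarrow> Q(a)\<close> and invertible
  2-cells \<open>\<phi> f : Q(f) \<circ> \<alpha> a \<cong> \<alpha> b \<circ> P(f)\<close> for \<open>f : a \<rightarrow> b\<close>.
\<close>

locale pseudonatural_transformation = P: pseudofunctor B P + Q: pseudofunctor B Q for B P Q +
  fixes \<alpha> and \<phi>
  assumes component_functor: "a \<in> Obj B \<Longrightarrow> cat_functor (fibre P a) (fibre Q a) (\<alpha> a)"
    and square_iso: "f \<in> Hom B a b \<Longrightarrow>
      nat_iso (fibre P a) (fibre Q b) (push Q f \<circ>\<^sub>F \<alpha> a) (\<alpha> b \<circ>\<^sub>F push P f) (\<phi> f)"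
    and square_comp: "\<lbrakk>f \<in> Hom B a b; g \<in> Hom B b c; x \<in> Obj (fibre P a)\<rbrakk> \<Longrightarrow>
      \<phi> (g \<cdot>\<^bsub>B\<^esub> f) x \<cdot>\<^bsub>fibre Q c\<^esub> compositor Q f g (Fo (\<alpha> a) x)
      = Fa (\<alpha> c) (compositor P f g x) \<cdot>\<^bsub>fibre Q c\<^esub>
        \<phi> g (Fo (push P f) x) \<cdot>\<^bsub>fibre Q c\<^esub> Fa (push Q g) (\<phi> f x)"
    and square_unit: "\<lbrakk>a \<in> Obj B; x \<in> Obj (fibre P a)\<rbrakk> \<Longrightarrow>
      \<phi> (Idt B a) x \<cdot>\<^bsub>fibre Q a\<^esub> unitor Q a (Fo (\<alpha> a) x) = Fa (\<alpha> a) (unitor P a x)"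

section \<open>The categories of commutative rings, modules and commutative algebras\<close>

text \<open>
  An arrow records its source, its target and its underlying map. The latter is required to be
  \<open>extensional\<close> on the carrier of the source, so that equality of arrows is equality of
  homomorphisms. All carriers are subsets of one type \<open>'u\<close>, which bounds the size of the objects.
\<close>

datatype ('o, 'u) arrow = Arrow (src: 'o) (tgt: 'o) (fn: "'u \<Rightarrow> 'u")

definition concrete_category ::
    "'o set \<Rightarrow> ('o \<Rightarrow> 'u set) \<Rightarrow> ('o \<Rightarrow> 'o \<Rightarrow> ('u \<Rightarrow> 'u) set) \<Rightarrow> ('o, ('o, 'u) arrow) category"
  where "concrete_category X V H =
    \<lparr>Obj = X,
     Arr = {Arrow A B h | A B h. A \<in> X \<and> B \<in> X \<and> h \<in> H A B \<inter> extensional (V A)},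
     Dom = src,
     Cod = tgt,
     Idt = (\<lambda>A. Arrow A A (\<lambda>x\<in>V A. x)),
     Cmp = (\<lambda>g f. Arrow (src f) (tgt g) (compose (V (src f)) (fn g) (fn f)))\<rparr>"

definition module_hom ::
    "('r, 'n) ring_scheme \<Rightarrow> ('r, 'a, 'm) module_scheme \<Rightarrow> ('r, 'b, 'k) module_scheme \<Rightarrow> ('a \<Rightarrow> 'b) set"
  where "module_hom R M N =
    {h \<in> carrier M \<rightarrow> carrier N.
       (\<forall>x \<in> carrier M. \<forall>y \<in> carrier M. h (x \<oplus>\<^bsub>M\<^esub> y) = h x \<oplus>\<^bsub>N\<^esub> h y) \<and>
       (\<forall>r \<in> carrier R. \<forall>x \<in> carrier M. h (r \<odot>\<^bsub>M\<^esub> x) = r \<odot>\<^bsub>N\<^esub> h x)}"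

type_synonym 'u ring_arrow = "('u ring, 'u) arrow"
type_synonym 'u mod_obj = "('u, 'u) module"
type_synonym 'u mod_arrow = "('u mod_obj, 'u) arrow"
type_synonym 'u mod_fctr = "('u mod_obj, 'u mod_arrow, 'u mod_obj, 'u mod_arrow) fctr"

definition Cring :: "('u ring, 'u ring_arrow) category"
  where "Cring = concrete_category {R. cring R} carrier ring_hom"

text \<open>
  The record type of modules extends that of rings; the fields \<open>mult\<close> and \<open>one\<close> are ignored by
  \<^const>\<open>module\<close> and \<^const>\<open>module_hom\<close>.
\<close>

definition RMod :: "'u ring \<Rightarrow> ('u mod_obj, 'u mod_arrow) category"
  where "RMod R = concrete_category {M. module R M} carrier (module_hom R)"

definition CAlg :: "'u ring \<Rightarrow> ('u mod_obj, 'u mod_arrow) category"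
  where "CAlg R = concrete_category {A. algebra R A} carrier (\<lambda>A B. ring_hom A B \<inter> module_hom R A B)"

text \<open>
  The underlying module of an algebra is the same record, whose multiplication is now ignored.
\<close>

definition Und :: "'u mod_fctr"
  where "Und = \<lparr>Fo = (\<lambda>A. A), Fa = (\<lambda>k. k)\<rparr>"

text \<open>
  Restriction of scalars along \<open>f : R \<rightarrow> S\<close>. The functor \<open>Res f\<close> serves for modules as well as for
  algebras: if \<open>B\<close> is an \<open>S\<close>-algebra with structure map \<open>S \<rightarrow> B\<close>, then the structure map
  \<open>R \<rightarrow> S \<rightarrow> B\<close> corresponds to the scalar action \<open>r \<odot> b = f r \<odot> b\<close>.
\<close>

definition restrict_scalars :: "'u ring_arrow \<Rightarrow> 'u mod_obj \<Rightarrow> 'u mod_obj"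
  where "restrict_scalars f N = N\<lparr>smult := \<lambda>r x. fn f r \<odot>\<^bsub>N\<^esub> x\<rparr>"

definition Res :: "'u ring_arrow \<Rightarrow> 'u mod_fctr"
  where "Res f = \<lparr>Fo = restrict_scalars f,
    Fa = (\<lambda>k. Arrow (restrict_scalars f (src k)) (restrict_scalars f (tgt k)) (fn k))\<rparr>"

section \<open>Tensor products and extension of scalars\<close>

definition bilinear ::
    "'u ring \<Rightarrow> 'u mod_obj \<Rightarrow> 'u mod_obj \<Rightarrow> 'u mod_obj \<Rightarrow> ('u \<Rightarrow> 'u \<Rightarrow> 'u) \<Rightarrow> bool"
  where "bilinear R M N P \<beta> \<longleftrightarrow>
    (\<forall>n \<in> carrier N. (\<lambda>m. \<beta> m n) \<in> module_hom R M P) \<and>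
    (\<forall>m \<in> carrier M. (\<lambda>n. \<beta> m n) \<in> module_hom R N P)"

definition is_tensor_product ::
    "'u ring \<Rightarrow> 'u mod_obj \<Rightarrow> 'u mod_obj \<Rightarrow> 'u mod_obj \<Rightarrow> ('u \<Rightarrow> 'u \<Rightarrow> 'u) \<Rightarrow> bool"
  where "is_tensor_product R M N T \<tau> \<longleftrightarrow>
    module R T \<and> bilinear R M N T \<tau> \<and>
    (\<forall>P \<beta>. module R P \<and> bilinear R M N P \<beta> \<longrightarrow>
       (\<exists>!h. h \<in> module_hom R T P \<inter> extensional (carrier T) \<and>
             (\<forall>m \<in> carrier M. \<forall>n \<in> carrier N. h (\<tau> m n) = \<beta> m n)))"

text \<open>
  A fixed tensor product of each pair of modules. It exists in \<open>'u\<close> if \<open>'u\<close> is infinite: the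
  cardinality of \<open>M \<otimes> N\<close> is at most that of the set of finite sequences over \<open>M \<times> N\<close>.
\<close>

definition tensor_choice :: "'u ring \<Rightarrow> 'u mod_obj \<Rightarrow> 'u mod_obj \<Rightarrow> 'u mod_obj \<times> ('u \<Rightarrow> 'u \<Rightarrow> 'u)"
  where "tensor_choice R M N = (SOME (T, \<tau>). is_tensor_product R M N T \<tau>)"

definition tensor :: "'u ring \<Rightarrow> 'u mod_obj \<Rightarrow> 'u mod_obj \<Rightarrow> 'u mod_obj"
  where "tensor R M N = fst (tensor_choice R M N)"

definition pure :: "'u ring \<Rightarrow> 'u mod_obj \<Rightarrow> 'u mod_obj \<Rightarrow> 'u \<Rightarrow> 'u \<Rightarrow> 'u"
  where "pure R M N = snd (tensor_choice R M N)"

text \<open>The linear map \<open>M \<otimes> N \<rightarrow> P\<close> with \<open>m \<otimes> n \<mapsto> \<beta> m n\<close>.\<close>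

definition tensor_lift ::
    "'u ring \<Rightarrow> 'u mod_obj \<Rightarrow> 'u mod_obj \<Rightarrow> 'u mod_obj \<Rightarrow> ('u \<Rightarrow> 'u \<Rightarrow> 'u) \<Rightarrow> 'u \<Rightarrow> 'u"
  where "tensor_lift R M N P \<beta> =
    (THE h. h \<in> module_hom R (tensor R M N) P \<inter> extensional (carrier (tensor R M N)) \<and>
            (\<forall>m \<in> carrier M. \<forall>n \<in> carrier N. h (pure R M N m n) = \<beta> m n))"

text \<open>The target \<open>S\<close> of \<open>f : R \<rightarrow> S\<close> as an \<open>R\<close>-module.\<close>

definition target_module :: "'u ring_arrow \<Rightarrow> 'u mod_obj"
  where "target_module f = (let S = tgt f in
    \<lparr>carrier = carrier S, mult = mult S, one = one S, zero = zero S, add = add S,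
     smult = (\<lambda>r s. fn f r \<otimes>\<^bsub>S\<^esub> s)\<rparr>)"

abbreviation ext_pure :: "'u ring_arrow \<Rightarrow> 'u mod_obj \<Rightarrow> 'u \<Rightarrow> 'u \<Rightarrow> 'u"
  where "ext_pure f M \<equiv> pure (src f) M (target_module f)"

abbreviation ext_tensor :: "'u ring_arrow \<Rightarrow> 'u mod_obj \<Rightarrow> 'u mod_obj"
  where "ext_tensor f M \<equiv> tensor (src f) M (target_module f)"

abbreviation ext_lift :: "'u ring_arrow \<Rightarrow> 'u mod_obj \<Rightarrow> 'u mod_obj \<Rightarrow> ('u \<Rightarrow> 'u \<Rightarrow> 'u) \<Rightarrow> 'u \<Rightarrow> 'u"
  where "ext_lift f M \<equiv> tensor_lift (src f) M (target_module f)"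

text \<open>\<open>M \<otimes>\<^sub>R S\<close> as an \<open>S\<close>-module: \<open>s' \<odot> (m \<otimes> s) = m \<otimes> s' s\<close>.\<close>

definition ext_module :: "'u ring_arrow \<Rightarrow> 'u mod_obj \<Rightarrow> 'u mod_obj"
  where "ext_module f M = (ext_tensor f M)
    \<lparr>smult := \<lambda>s'. ext_lift f M (ext_tensor f M) (\<lambda>m s. ext_pure f M m (s' \<otimes>\<^bsub>tgt f\<^esub> s))\<rparr>"

text \<open>\<open>A \<otimes>\<^sub>R S\<close> as an \<open>S\<close>-algebra: \<open>(a \<otimes> s)(a' \<otimes> s') = a a' \<otimes> s s'\<close>.\<close>

definition ext_algebra :: "'u ring_arrow \<Rightarrow> 'u mod_obj \<Rightarrow> 'u mod_obj"
  where "ext_algebra f A = (ext_module f A)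
    \<lparr>mult := \<lambda>x y. ext_lift f A (ext_tensor f A) (\<lambda>a s.
       ext_lift f A (ext_tensor f A) (\<lambda>a' s'.
         ext_pure f A (a \<otimes>\<^bsub>A\<^esub> a') (s \<otimes>\<^bsub>tgt f\<^esub> s')) y) x,
     one := ext_pure f A \<one>\<^bsub>A\<^esub> \<one>\<^bsub>tgt f\<^esub>\<rparr>"

text \<open>\<open>h \<otimes> S\<close>, the canonical maps \<open>(M \<otimes>\<^sub>R S) \<otimes>\<^sub>S T \<rightarrow> M \<otimes>\<^sub>R T\<close>, \<open>(m \<otimes> s) \<otimes> t \<mapsto> m \<otimes> g s t\<close>, and
  \<open>M \<rightarrow> M \<otimes>\<^sub>R S\<close>, \<open>m \<mapsto> m \<otimes> 1\<close>. As \<^const>\<open>tensor_choice\<close> depends only on the module structure of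
  its arguments, they serve for modules and for algebras alike.\<close>

definition ext_map :: "'u ring_arrow \<Rightarrow> 'u mod_arrow \<Rightarrow> 'u \<Rightarrow> 'u"
  where "ext_map f k = ext_lift f (src k) (ext_tensor f (tgt k)) (\<lambda>m s. ext_pure f (tgt k) (fn k m) s)"

definition ext_compositor_map :: "'u ring_arrow \<Rightarrow> 'u ring_arrow \<Rightarrow> 'u mod_obj \<Rightarrow> 'u \<Rightarrow> 'u"
  where "ext_compositor_map f g M = (let gf = g \<cdot>\<^bsub>Cring\<^esub> f in
    ext_lift g (ext_module f M) (restrict_scalars g (ext_module gf M)) (\<lambda>x t.
      ext_lift f M (ext_tensor gf M) (\<lambda>m s. ext_pure gf M m (fn g s \<otimes>\<^bsub>tgt g\<^esub> t)) x))"

definition ext_unit_map :: "'u ring_arrow \<Rightarrow> 'u mod_obj \<Rightarrow> 'u \<Rightarrow> 'u"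
  where "ext_unit_map f M = (\<lambda>m \<in> carrier M. ext_pure f M m \<one>\<^bsub>tgt f\<^esub>)"

text \<open>
  Each of the two pseudofunctors is determined by its action on objects, \<open>X = ext_module\<close> for
  modules and \<open>X = ext_algebra\<close> for algebras. \<open>ext_unit\<close> is the unit of the adjunction between
  extension and restriction of scalars.
\<close>

type_synonym 'u extension = "'u ring_arrow \<Rightarrow> 'u mod_obj \<Rightarrow> 'u mod_obj"

definition ext_fctr :: "'u extension \<Rightarrow> 'u ring_arrow \<Rightarrow> 'u mod_fctr"
  where "ext_fctr X f =
    \<lparr>Fo = X f, Fa = (\<lambda>k. Arrow (X f (src k)) (X f (tgt k)) (ext_map f k))\<rparr>"

definition ext_unit :: "'u extension \<Rightarrow> 'u ring_arrow \<Rightarrow> 'u mod_obj \<Rightarrow> 'u mod_arrow"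
  where "ext_unit X f M = Arrow M (restrict_scalars f (X f M)) (ext_unit_map f M)"

definition ext_psfunctor ::
    "('u ring \<Rightarrow> ('u mod_obj, 'u mod_arrow) category) \<Rightarrow> 'u extension
     \<Rightarrow> ('u ring, 'u ring_arrow, 'u mod_obj, 'u mod_arrow) psfunctor"
  where "ext_psfunctor E X =
    \<lparr>fibre = E,
     push = ext_fctr X,
     compositor = (\<lambda>f g M. Arrow (X g (X f M)) (X (g \<cdot>\<^bsub>Cring\<^esub> f) M) (ext_compositor_map f g M)),
     unitor = (\<lambda>R M. Arrow M (X (Idt Cring R) M) (ext_unit_map (Idt Cring R) M))\<rparr>"

definition RMod_psfunctor :: "('u ring, 'u ring_arrow, 'u mod_obj, 'u mod_arrow) psfunctor"
  where "RMod_psfunctor = ext_psfunctor RMod ext_module"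

definition CAlg_psfunctor :: "('u ring, 'u ring_arrow, 'u mod_obj, 'u mod_arrow) psfunctor"
  where "CAlg_psfunctor = ext_psfunctor CAlg ext_algebra"

section \<open>The symmetric algebra\<close>

text \<open>
  A fixed left adjoint of \<^const>\<open>Und\<close> together with its unit; a symmetric algebra of \<open>M\<close> exists
  in \<open>'u\<close> if \<open>'u\<close> is infinite.
\<close>

definition Sym_choice :: "'u ring \<Rightarrow> 'u mod_fctr \<times> ('u mod_obj \<Rightarrow> 'u mod_arrow)"
  where "Sym_choice R = (SOME (F, \<eta>). left_adjoint (RMod R) (CAlg R) F Und \<eta>)"

definition Sym :: "'u ring \<Rightarrow> 'u mod_fctr"
  where "Sym R = fst (Sym_choice R)"

definition Sym_unit :: "'u ring \<Rightarrow> 'u mod_obj \<Rightarrow> 'u mod_arrow"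
  where "Sym_unit R = snd (Sym_choice R)"

text \<open>
  For \<open>f : R \<rightarrow> S\<close>, the comparison \<open>(-) \<otimes>\<^sub>R S \<circ> Sym\<^sub>R \<rightarrow> Sym\<^sub>S \<circ> ((-) \<otimes>\<^sub>R S)\<close> of the two left adjoints of
  \<open>Res f \<circ> Und = Und \<circ> Res f\<close>; their units are
  \<open>M \<rightarrow> Sym\<^sub>R M \<rightarrow> Sym\<^sub>R M \<otimes>\<^sub>R S\<close> and \<open>M \<rightarrow> M \<otimes>\<^sub>R S \<rightarrow> Sym\<^sub>S (M \<otimes>\<^sub>R S)\<close>.
\<close>

definition Sym_iso :: "'u ring_arrow \<Rightarrow> 'u mod_obj \<Rightarrow> 'u mod_arrow"
  where "Sym_iso f = (let R = src f; S = tgt f in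
    left_adjoint_comparison (RMod R) (CAlg S) (Res f \<circ>\<^sub>F Und)
      (ext_fctr ext_algebra f \<circ>\<^sub>F Sym R)
      (comp_unit (RMod R) Und (Sym R) (Sym_unit R) (ext_unit ext_algebra f))
      (Sym S \<circ>\<^sub>F ext_fctr ext_module f)
      (comp_unit (RMod R) (Res f) (ext_fctr ext_module f) (ext_unit ext_module f) (Sym_unit S)))"

end

theory Submission
  imports Defs
begin

text \<open>
  Every object that occurs in the coherence laws is reached from a module \<open>M\<close> by a chain of
  universal maps: the unit \<open>m \<mapsto> m \<otimes> 1\<close> of extension of scalars, for modules or for algebras, and the
  unit \<open>\<eta> : M \<rightarrow> Sym M\<close>. A linear map, respectively an algebra map, out of such an object is
  determined by its values on the image of \<open>M\<close>, and on this image all structure maps are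
  tautological:

  \<^item> \<open>h \<otimes> S\<close> sends \<open>m \<otimes> 1\<close> to \<open>h m \<otimes> 1\<close>,
  \<^item> the compositor sends \<open>(m \<otimes> 1) \<otimes> 1\<close> to \<open>m \<otimes> 1\<close>, and the unitor sends \<open>m\<close> to \<open>m \<otimes> 1\<close>,
  \<^item> \<open>Sym h\<close> sends \<open>\<eta> m\<close> to \<open>\<eta> (h m)\<close>,
  \<^item> \<open>Sym_iso f\<close> sends \<open>\<eta> m \<otimes> 1\<close> to \<open>\<eta> (m \<otimes> 1)\<close>.

  So each law is an equation between two maps with the same source, and both sides visibly do the
  same to the generators. For instance, both sides of the compatibility of \<open>Sym_iso\<close> with
  compositors send \<open>(\<eta> m \<otimes> 1) \<otimes> 1\<close> to \<open>\<eta> (m \<otimes> 1)\<close>. Invertibility is proved in the same way: the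
  universal properties supply a map backwards, and both composites fix the generators.

  What has to be built are therefore the universal properties themselves. Tensor products and
  free commutative algebras must exist with carriers inside the given type \<open>'u\<close>. Both are
  quotients of a set of formal terms, and for infinite \<open>'u\<close> the terms embed into \<open>'u\<close>
  (\<open>expr_encoding\<close>, \<open>tensor_product_exists\<close>, \<open>free_algebra_exists\<close>). From a tensor product come the
  \<open>S\<close>-module and the \<open>S\<close>-algebra structure of \<open>M \<otimes> S\<close> and their universal properties
  (\<open>universal_lift_hom\<close>, \<open>universal_lift_ring_hom\<close>). The locale \<open>scalar_extension\<close> axiomatises what
  modules and algebras have in common at this point and derives the pseudofunctor laws once for
  both.
\<close>

section \<open>Presenting modules and algebras inside an infinite type\<close>

text \<open>
  Terms over generators \<open>'g\<close> and scalars \<open>'r\<close>. Additive inverses are omitted: they are the multiples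
  by the scalar \<open>-1\<close>.
\<close>

datatype ('r, 'g) expr =
  Gen 'g | Zero | One
  | Plus "('r, 'g) expr" "('r, 'g) expr"
  | Times "('r, 'g) expr" "('r, 'g) expr"
  | Scal 'r "('r, 'g) expr"

primrec eval :: "('r, 'a, 'm) module_scheme \<Rightarrow> ('g \<Rightarrow> 'a) \<Rightarrow> ('r, 'g) expr \<Rightarrow> 'a" where
  "eval A e (Gen g) = e g"
| "eval A e Zero = \<zero>\<^bsub>A\<^esub>"
| "eval A e One = \<one>\<^bsub>A\<^esub>"
| "eval A e (Plus s t) = eval A e s \<oplus>\<^bsub>A\<^esub> eval A e t"
| "eval A e (Times s t) = eval A e s \<otimes>\<^bsub>A\<^esub> eval A e t"
| "eval A e (Scal r t) = r \<odot>\<^bsub>A\<^esub> eval A e t"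

text \<open>
  A term is stored by iterated pairing, with a distinct tag for each constructor. A constant has no
  arguments, so an arbitrary second component fills its pair.
\<close>

primrec encode ::
    "('u \<times> 'u \<Rightarrow> 'u) \<Rightarrow> (nat \<Rightarrow> 'u) \<Rightarrow> ('g \<Rightarrow> 'u) \<Rightarrow> ('u, 'g) expr \<Rightarrow> 'u" where
  "encode p tag \<gamma> (Gen g) = p (tag 0, \<gamma> g)"
| "encode p tag \<gamma> Zero = p (tag 1, tag 0)"
| "encode p tag \<gamma> One = p (tag 2, tag 0)"
| "encode p tag \<gamma> (Plus s t) = p (tag 3, p (encode p tag \<gamma> s, encode p tag \<gamma> t))"
| "encode p tag \<gamma> (Times s t) = p (tag 4, p (encode p tag \<gamma> s, encode p tag \<gamma> t))"
| "encode p tag \<gamma> (Scal r t) = p (tag 5, p (r, encode p tag \<gamma> t))"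

lemma inj_encode:
  assumes "inj p" "inj tag" "inj \<gamma>"
  shows "inj (encode p tag \<gamma>)"
proof (rule injI)
  fix s t
  show "encode p tag \<gamma> s = encode p tag \<gamma> t \<Longrightarrow> s = t"
    by (induction s arbitrary: t; case_tac t)
       (auto dest!: injD[OF assms(1)] injD[OF assms(2)] injD[OF assms(3)])
qed

text \<open>
  For an infinite cardinal \<open>\<kappa>\<close> one has \<open>\<kappa> * \<kappa> = \<kappa>\<close>.
\<close>

lemma infinite_pairing:
  assumes "infinite (UNIV :: 'u set)"
  obtains p :: "'u \<times> 'u \<Rightarrow> 'u" where "inj p"
  using card_of_Times_same_infinite[OF assms]
  by (auto simp flip: card_of_ordIso simp: bij_betw_def)

lemma expr_encoding:
  assumes inf: "infinite (UNIV :: 'u set)" and \<gamma>: "inj (\<gamma> :: 'g \<Rightarrow> 'u)"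
  obtains code :: "('u, 'g) expr \<Rightarrow> 'u" where "inj code"
proof -
  obtain p :: "'u \<times> 'u \<Rightarrow> 'u" where "inj p"
    using infinite_pairing[OF inf] .
  moreover obtain tag :: "nat \<Rightarrow> 'u" where "inj tag"
    using infinite_countable_subset[OF inf] by blast
  ultimately show thesis
    using inj_encode \<gamma> that by blast
qed

primrec wf_expr :: "bool \<Rightarrow> 'r set \<Rightarrow> 'g set \<Rightarrow> ('r, 'g) expr \<Rightarrow> bool" where
  "wf_expr ring_ops S G (Gen g) \<longleftrightarrow> g \<in> G"
| "wf_expr ring_ops S G Zero \<longleftrightarrow> True"
| "wf_expr ring_ops S G One \<longleftrightarrow> ring_ops"
| "wf_expr ring_ops S G (Plus s t) \<longleftrightarrow> wf_expr ring_ops S G s \<and> wf_expr ring_ops S G t"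
| "wf_expr ring_ops S G (Times s t) \<longleftrightarrow> ring_ops \<and> wf_expr ring_ops S G s \<and> wf_expr ring_ops S G t"
| "wf_expr ring_ops S G (Scal r t) \<longleftrightarrow> r \<in> S \<and> wf_expr ring_ops S G t"

text \<open>
  A universal structure is obtained from its models without any calculus of derivations. A model is
  a module or algebra \<open>A\<close> together with values \<open>e\<close> of the generators in \<open>A\<close>, and two terms are identified
  if they have equal values in all models of a given class \<open>K\<close>. The class \<open>K\<close> encodes the relations
  among the generators: for a tensor product it consists of the bilinear maps. Multiplicative terms
  are admitted according to \<open>wf One\<close>, which covers modules and algebras together.
\<close>

locale presentation =
  fixes R :: "'u ring" and wf :: "('u, 'g) expr \<Rightarrow> bool"
    and K :: "('u mod_obj \<times> ('g \<Rightarrow> 'u)) set" and code :: "('u, 'g) expr \<Rightarrow> 'u"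
  assumes R: "cring R"
    and inj_code: "inj code"
    and wf_Zero [simp]: "wf Zero"
    and wf_Plus [simp]: "wf (Plus s t) \<longleftrightarrow> wf s \<and> wf t"
    and wf_Scal [simp]: "wf (Scal r t) \<longleftrightarrow> r \<in> carrier R \<and> wf t"
    and wf_Times [simp]: "wf (Times s t) \<longleftrightarrow> wf One \<and> wf s \<and> wf t"
    and model_module: "(A, e) \<in> K \<Longrightarrow> module R A"
    and model_algebra: "(A, e) \<in> K \<Longrightarrow> wf One \<Longrightarrow> algebra R A"
    and model_gen: "(A, e) \<in> K \<Longrightarrow> wf (Gen g) \<Longrightarrow> e g \<in> carrier A"
begin

definition equiv :: "('u, 'g) expr \<Rightarrow> ('u, 'g) expr \<Rightarrow> bool" where
  "equiv s t \<longleftrightarrow> (\<forall>A e. (A, e) \<in> K \<longrightarrow> eval A e s = eval A e t)"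

text \<open>
  The class of a term is represented by the code of a chosen member, an element of \<open>'u\<close>.
\<close>

definition rep :: "('u, 'g) expr \<Rightarrow> 'u" where
  "rep t = code (SOME s. wf s \<and> equiv s t)"

definition dec :: "'u \<Rightarrow> ('u, 'g) expr" where
  "dec = inv_into (Collect wf) rep"

definition quot :: "'u mod_obj" where
  "quot = \<lparr>carrier = rep ` Collect wf,
     mult = (\<lambda>x y. rep (Times (dec x) (dec y))), one = rep One,
     zero = rep Zero, add = (\<lambda>x y. rep (Plus (dec x) (dec y))),
     smult = (\<lambda>r x. rep (Scal r (dec x)))\<rparr>"

definition ev :: "'u mod_obj \<Rightarrow> ('g \<Rightarrow> 'u) \<Rightarrow> 'u \<Rightarrow> 'u" where
  "ev A e x = eval A e (dec x)"

lemma rep_eq_iff: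
  assumes "wf s" "wf t"
  shows "rep s = rep t \<longleftrightarrow> equiv s t"
proof
  have rep: "wf (SOME s. wf s \<and> equiv s t) \<and> equiv (SOME s. wf s \<and> equiv s t) t" if "wf t" for t
    by (rule someI[where x = t]) (use that in \<open>auto simp: equiv_def\<close>)
  assume "rep s = rep t"
  then have "(SOME s'. wf s' \<and> equiv s' s) = (SOME s'. wf s' \<and> equiv s' t)"
    unfolding rep_def by (rule injD[OF inj_code])
  then show "equiv s t"
    using rep[OF assms(1)] rep[OF assms(2)] by (auto simp: equiv_def)
next
  assume "equiv s t"
  then have "equiv s' s \<longleftrightarrow> equiv s' t" for s'
    by (auto simp: equiv_def)
  then show "rep s = rep t"
    by (simp add: rep_def)
qed

lemma carrier_dec:
  assumes "x \<in> carrier quot"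
  shows "wf (dec x) \<and> rep (dec x) = x"
proof -
  have x: "x \<in> rep ` Collect wf"
    using assms by (simp add: quot_def)
  show ?thesis
    using inv_into_into[OF x] f_inv_into_f[OF x] by (simp add: dec_def)
qed

lemma rep_in_quot [simp]: "wf t \<Longrightarrow> rep t \<in> carrier quot"
  by (simp add: quot_def)

lemma ev_rep [simp]:
  assumes "wf t" "(A, e) \<in> K"
  shows "ev A e (rep t) = eval A e t"
proof -
  have "wf (dec (rep t))" "rep (dec (rep t)) = rep t"
    using carrier_dec assms(1) by auto
  then show ?thesis
    using assms by (auto simp: rep_eq_iff equiv_def ev_def)
qed

text \<open>
  The evaluations in the models of \<open>K\<close> are homomorphisms that jointly separate the points of the
  quotient, so every identity that is valid in all models is valid in the quotient. All module and
  algebra laws below are transferred by this principle.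
\<close>

lemma quot_eqI:
  assumes "x \<in> carrier quot" "y \<in> carrier quot" "\<And>A e. (A, e) \<in> K \<Longrightarrow> ev A e x = ev A e y"
  shows "x = y"
proof -
  have "rep (dec x) = rep (dec y)"
    using assms carrier_dec by (subst rep_eq_iff) (auto simp: equiv_def ev_def)
  then show ?thesis
    using assms carrier_dec by simp
qed

lemma quot_closed [simp]:
  "\<zero>\<^bsub>quot\<^esub> \<in> carrier quot"
  "\<lbrakk>x \<in> carrier quot; y \<in> carrier quot\<rbrakk> \<Longrightarrow> x \<oplus>\<^bsub>quot\<^esub> y \<in> carrier quot"
  "\<lbrakk>r \<in> carrier R; x \<in> carrier quot\<rbrakk> \<Longrightarrow> r \<odot>\<^bsub>quot\<^esub> x \<in> carrier quot"
  "wf One \<Longrightarrow> \<one>\<^bsub>quot\<^esub> \<in> carrier quot"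
  "\<lbrakk>wf One; x \<in> carrier quot; y \<in> carrier quot\<rbrakk> \<Longrightarrow> x \<otimes>\<^bsub>quot\<^esub> y \<in> carrier quot"
  using carrier_dec by (auto simp: quot_def)

lemma ev_ops [simp]:
  assumes "(A, e) \<in> K"
  shows "ev A e \<zero>\<^bsub>quot\<^esub> = \<zero>\<^bsub>A\<^esub>"
    and "\<lbrakk>x \<in> carrier quot; y \<in> carrier quot\<rbrakk> \<Longrightarrow> ev A e (x \<oplus>\<^bsub>quot\<^esub> y) = ev A e x \<oplus>\<^bsub>A\<^esub> ev A e y"
    and "\<lbrakk>r \<in> carrier R; x \<in> carrier quot\<rbrakk> \<Longrightarrow> ev A e (r \<odot>\<^bsub>quot\<^esub> x) = r \<odot>\<^bsub>A\<^esub> ev A e x"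
    and "wf One \<Longrightarrow> ev A e \<one>\<^bsub>quot\<^esub> = \<one>\<^bsub>A\<^esub>"
    and "\<lbrakk>wf One; x \<in> carrier quot; y \<in> carrier quot\<rbrakk>
      \<Longrightarrow> ev A e (x \<otimes>\<^bsub>quot\<^esub> y) = ev A e x \<otimes>\<^bsub>A\<^esub> ev A e y"
proof -
  have wf [simp]: "wf (dec x)" if "x \<in> carrier quot" for x
    using carrier_dec that by blast
  show "ev A e \<zero>\<^bsub>quot\<^esub> = \<zero>\<^bsub>A\<^esub>" "wf One \<Longrightarrow> ev A e \<one>\<^bsub>quot\<^esub> = \<one>\<^bsub>A\<^esub>"
    using assms by (simp_all add: quot_def)
  assume x: "x \<in> carrier quot"
  note [simp] = wf[OF x]
  show "ev A e (r \<odot>\<^bsub>quot\<^esub> x) = r \<odot>\<^bsub>A\<^esub> ev A e x" if "r \<in> carrier R"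
    using assms that by (simp add: quot_def) (simp add: ev_def)
  assume y: "y \<in> carrier quot"
  note [simp] = wf[OF y]
  show "ev A e (x \<oplus>\<^bsub>quot\<^esub> y) = ev A e x \<oplus>\<^bsub>A\<^esub> ev A e y"
    using assms by (simp add: quot_def) (simp add: ev_def)
  show "ev A e (x \<otimes>\<^bsub>quot\<^esub> y) = ev A e x \<otimes>\<^bsub>A\<^esub> ev A e y" if "wf One"
    using assms that by (simp add: quot_def) (simp add: ev_def)
qed

lemma eval_closed:
  assumes K: "(A, e) \<in> K"
  shows "wf t \<Longrightarrow> eval A e t \<in> carrier A"
proof (induction t)
  case (Gen g)
  then show ?case using model_gen[OF K] by simp
next
  case One
  then interpret algebra R A using model_algebra[OF K] by simp
  show ?case by simp
next
  case (Times s t)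
  then interpret algebra R A using model_algebra[OF K] by simp
  show ?case using Times by simp
qed (use module.axioms(2)[OF model_module[OF K]] module.smult_closed[OF model_module[OF K]]
     in \<open>auto intro: abelian_monoid.zero_closed abelian_monoid.a_closed abelian_group.axioms\<close>)

lemma ev_closed [simp]: "\<lbrakk>(A, e) \<in> K; x \<in> carrier quot\<rbrakk> \<Longrightarrow> ev A e x \<in> carrier A"
  unfolding ev_def using carrier_dec eval_closed by blast

lemma module_quot: "module R quot"
proof (rule moduleI)
  interpret R: cring R by (rule R)
  have add: "abelian_monoid A" if "(A, e) \<in> K" for A e
    using model_module[OF that] by (intro abelian_group.axioms module.axioms)
  show "cring R" by (rule R)
  show "abelian_group quot"
  proof (rule abelian_groupI)
    fix x y z assume *: "x \<in> carrier quot" "y \<in> carrier quot" "z \<in> carrier quot"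
    show "x \<oplus>\<^bsub>quot\<^esub> y \<oplus>\<^bsub>quot\<^esub> z = x \<oplus>\<^bsub>quot\<^esub> (y \<oplus>\<^bsub>quot\<^esub> z)"
      by (rule quot_eqI)
         (use * in \<open>auto intro: abelian_monoid.a_assoc add\<close>)
  next
    fix x y assume *: "x \<in> carrier quot" "y \<in> carrier quot"
    show "x \<oplus>\<^bsub>quot\<^esub> y = y \<oplus>\<^bsub>quot\<^esub> x"
      by (rule quot_eqI)
         (use * in \<open>auto intro: abelian_monoid.a_comm add\<close>)
  next
    fix x assume *: "x \<in> carrier quot"
    show "\<zero>\<^bsub>quot\<^esub> \<oplus>\<^bsub>quot\<^esub> x = x"
      by (rule quot_eqI)
         (use * in \<open>auto intro: abelian_monoid.l_zero add\<close>)
    \<comment> \<open>The terms have no negation; \<open>(-1) x\<close> takes its place.\<close>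
    have "(\<ominus>\<^bsub>R\<^esub> \<one>\<^bsub>R\<^esub>) \<odot>\<^bsub>quot\<^esub> x \<oplus>\<^bsub>quot\<^esub> x = \<zero>\<^bsub>quot\<^esub>"
    proof (rule quot_eqI)
      fix A e assume K: "(A, e) \<in> K"
      interpret A: module R A by (rule model_module[OF K])
      show "ev A e ((\<ominus>\<^bsub>R\<^esub> \<one>\<^bsub>R\<^esub>) \<odot>\<^bsub>quot\<^esub> x \<oplus>\<^bsub>quot\<^esub> x) = ev A e \<zero>\<^bsub>quot\<^esub>"
        using * K by (simp add: A.smult_l_minus A.M.l_neg)
    qed (use * in auto)
    then show "\<exists>y\<in>carrier quot. y \<oplus>\<^bsub>quot\<^esub> x = \<zero>\<^bsub>quot\<^esub>"
      using * by (meson R.add.inv_closed R.one_closed quot_closed(3))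
  qed auto
  show "\<one>\<^bsub>R\<^esub> \<odot>\<^bsub>quot\<^esub> x = x" if "x \<in> carrier quot" for x
    by (rule quot_eqI) (use that in \<open>auto intro!: module.smult_one model_module\<close>)
  fix a b x y assume *: "a \<in> carrier R" "b \<in> carrier R" "x \<in> carrier quot" "y \<in> carrier quot"
  show "a \<odot>\<^bsub>quot\<^esub> x \<in> carrier quot" using * by simp
  show "(a \<oplus>\<^bsub>R\<^esub> b) \<odot>\<^bsub>quot\<^esub> x = a \<odot>\<^bsub>quot\<^esub> x \<oplus>\<^bsub>quot\<^esub> b \<odot>\<^bsub>quot\<^esub> x"
    by (rule quot_eqI) (use * in \<open>auto dest: model_module intro: module.smult_l_distr\<close>)
  show "a \<odot>\<^bsub>quot\<^esub> (x \<oplus>\<^bsub>quot\<^esub> y) = a \<odot>\<^bsub>quot\<^esub> x \<oplus>\<^bsub>quot\<^esub> a \<odot>\<^bsub>quot\<^esub> y"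
    by (rule quot_eqI) (use * in \<open>auto dest: model_module intro: module.smult_r_distr\<close>)
  show "(a \<otimes>\<^bsub>R\<^esub> b) \<odot>\<^bsub>quot\<^esub> x = a \<odot>\<^bsub>quot\<^esub> (b \<odot>\<^bsub>quot\<^esub> x)"
    by (rule quot_eqI) (use * in \<open>auto dest: model_module intro: module.smult_assoc1\<close>)
qed

lemma algebra_quot:
  assumes [simp]: "wf One"
  shows "algebra R quot"
proof -
  interpret Q: module R quot by (rule module_quot)
  have cring: "cring A" if "(A, e) \<in> K" for A e
    using model_algebra[OF that] by (auto intro: algebra.M_cring)
  then have mult: "Group.comm_monoid A" and ring: "ring A" if "(A, e) \<in> K" for A e
    using that by (metis cring.axioms)+
  then have monoid: "Group.monoid A" if "(A, e) \<in> K" for A e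
    using that by (blast intro: comm_monoid.axioms)
  have "cring quot"
  proof (rule cringI[OF Q.abelian_group_axioms])
    show "Group.comm_monoid quot"
    proof (rule comm_monoidI)
      fix x y z assume *: "x \<in> carrier quot" "y \<in> carrier quot" "z \<in> carrier quot"
      show "x \<otimes>\<^bsub>quot\<^esub> y \<otimes>\<^bsub>quot\<^esub> z = x \<otimes>\<^bsub>quot\<^esub> (y \<otimes>\<^bsub>quot\<^esub> z)"
        by (rule quot_eqI)
           (use * in \<open>auto intro: monoid.m_assoc monoid\<close>)
    next
      fix x y assume *: "x \<in> carrier quot" "y \<in> carrier quot"
      show "x \<otimes>\<^bsub>quot\<^esub> y = y \<otimes>\<^bsub>quot\<^esub> x"
        by (rule quot_eqI)
           (use * in \<open>auto intro: comm_monoid.m_comm mult\<close>)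
    next
      fix x assume *: "x \<in> carrier quot"
      show "\<one>\<^bsub>quot\<^esub> \<otimes>\<^bsub>quot\<^esub> x = x"
        by (rule quot_eqI)
           (use * in \<open>auto intro: monoid.l_one monoid\<close>)
    qed auto
    fix x y z assume *: "x \<in> carrier quot" "y \<in> carrier quot" "z \<in> carrier quot"
    show "(x \<oplus>\<^bsub>quot\<^esub> y) \<otimes>\<^bsub>quot\<^esub> z = x \<otimes>\<^bsub>quot\<^esub> z \<oplus>\<^bsub>quot\<^esub> y \<otimes>\<^bsub>quot\<^esub> z"
      by (rule quot_eqI)
         (use * in \<open>auto intro: ring.ring_simprules(13) ring\<close>)
  qed
  then show ?thesis
  proof (rule algebra.intro[OF module_quot _ algebra_axioms.intro])
    fix a x y assume *: "a \<in> carrier R" "x \<in> carrier quot" "y \<in> carrier quot"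
    show "a \<odot>\<^bsub>quot\<^esub> x \<otimes>\<^bsub>quot\<^esub> y = a \<odot>\<^bsub>quot\<^esub> (x \<otimes>\<^bsub>quot\<^esub> y)"
      by (rule quot_eqI) (use * in \<open>auto intro!: algebra.smult_assoc2 model_algebra\<close>)
  qed
qed

text \<open>
  The quotient is generated by the classes of the generators. This gives the uniqueness part of its
  universal property.
\<close>

lemma quot_induct [consumes 1, case_names gen zero add smult one mult]:
  assumes x: "x \<in> carrier quot"
    and gen: "\<And>g. wf (Gen g) \<Longrightarrow> P (rep (Gen g))"
    and zero: "P \<zero>\<^bsub>quot\<^esub>"
    and add: "\<And>x y. \<lbrakk>x \<in> carrier quot; y \<in> carrier quot; P x; P y\<rbrakk> \<Longrightarrow> P (x \<oplus>\<^bsub>quot\<^esub> y)"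
    and smult: "\<And>r x. \<lbrakk>r \<in> carrier R; x \<in> carrier quot; P x\<rbrakk> \<Longrightarrow> P (r \<odot>\<^bsub>quot\<^esub> x)"
    and one: "wf One \<Longrightarrow> P \<one>\<^bsub>quot\<^esub>"
    and mult: "\<And>x y. \<lbrakk>wf One; x \<in> carrier quot; y \<in> carrier quot; P x; P y\<rbrakk> \<Longrightarrow> P (x \<otimes>\<^bsub>quot\<^esub> y)"
  shows "P x"
proof -
  have "P (rep t)" if "wf t" for t
    using that
  proof (induction t)
    case (Plus s t)
    have "rep (Plus s t) = rep s \<oplus>\<^bsub>quot\<^esub> rep t"
      by (rule quot_eqI) (use Plus in auto)
    then show ?case using Plus by (auto intro: add)
  next
    case (Times s t)
    have "rep (Times s t) = rep s \<otimes>\<^bsub>quot\<^esub> rep t"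
      by (rule quot_eqI) (use Times in auto)
    then show ?case using Times by (auto intro: mult)
  next
    case (Scal r t)
    have "rep (Scal r t) = r \<odot>\<^bsub>quot\<^esub> rep t"
      by (rule quot_eqI) (use Scal in auto)
    then show ?case using Scal by (auto intro: smult)
  qed (use gen zero one in \<open>auto simp: quot_def\<close>)
  then show ?thesis
    using carrier_dec[OF x] by metis
qed

end

section \<open>Tensor products\<close>

lemma module_homD:
  assumes "h \<in> module_hom R M N"
  shows "x \<in> carrier M \<Longrightarrow> h x \<in> carrier N"
    and "\<lbrakk>x \<in> carrier M; y \<in> carrier M\<rbrakk> \<Longrightarrow> h (x \<oplus>\<^bsub>M\<^esub> y) = h x \<oplus>\<^bsub>N\<^esub> h y"
    and "\<lbrakk>r \<in> carrier R; x \<in> carrier M\<rbrakk> \<Longrightarrow> h (r \<odot>\<^bsub>M\<^esub> x) = r \<odot>\<^bsub>N\<^esub> h x"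
  using assms by (auto simp: module_hom_def)

lemma module_homI:
  assumes "\<And>x. x \<in> carrier M \<Longrightarrow> h x \<in> carrier N"
    and "\<And>x y. \<lbrakk>x \<in> carrier M; y \<in> carrier M\<rbrakk> \<Longrightarrow> h (x \<oplus>\<^bsub>M\<^esub> y) = h x \<oplus>\<^bsub>N\<^esub> h y"
    and "\<And>r x. \<lbrakk>r \<in> carrier R; x \<in> carrier M\<rbrakk> \<Longrightarrow> h (r \<odot>\<^bsub>M\<^esub> x) = r \<odot>\<^bsub>N\<^esub> h x"
  shows "h \<in> module_hom R M N"
  using assms by (auto simp: module_hom_def)

lemma module_hom_zero:
  assumes "module R M" "module R N" "h \<in> module_hom R M N"
  shows "h \<zero>\<^bsub>M\<^esub> = \<zero>\<^bsub>N\<^esub>"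
proof -
  interpret M: module R M by fact
  interpret N: module R N by fact
  have "h (\<zero>\<^bsub>R\<^esub> \<odot>\<^bsub>M\<^esub> \<zero>\<^bsub>M\<^esub>) = \<zero>\<^bsub>R\<^esub> \<odot>\<^bsub>N\<^esub> h \<zero>\<^bsub>M\<^esub>"
    by (rule module_homD[OF assms(3)]) auto
  then show ?thesis
    using module_homD(1)[OF assms(3), of "\<zero>\<^bsub>M\<^esub>"] by simp
qed

lemma bilinearD:
  assumes "bilinear R M N P \<beta>"
  shows "\<lbrakk>m \<in> carrier M; n \<in> carrier N\<rbrakk> \<Longrightarrow> \<beta> m n \<in> carrier P"
    and "\<lbrakk>m \<in> carrier M; m' \<in> carrier M; n \<in> carrier N\<rbrakk> \<Longrightarrow> \<beta> (m \<oplus>\<^bsub>M\<^esub> m') n = \<beta> m n \<oplus>\<^bsub>P\<^esub> \<beta> m' n"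
    and "\<lbrakk>r \<in> carrier R; m \<in> carrier M; n \<in> carrier N\<rbrakk> \<Longrightarrow> \<beta> (r \<odot>\<^bsub>M\<^esub> m) n = r \<odot>\<^bsub>P\<^esub> \<beta> m n"
    and "\<lbrakk>m \<in> carrier M; n \<in> carrier N; n' \<in> carrier N\<rbrakk> \<Longrightarrow> \<beta> m (n \<oplus>\<^bsub>N\<^esub> n') = \<beta> m n \<oplus>\<^bsub>P\<^esub> \<beta> m n'"
    and "\<lbrakk>r \<in> carrier R; m \<in> carrier M; n \<in> carrier N\<rbrakk> \<Longrightarrow> \<beta> m (r \<odot>\<^bsub>N\<^esub> n) = r \<odot>\<^bsub>P\<^esub> \<beta> m n"
  using assms by (auto simp: bilinear_def module_hom_def)

lemma bilinearI:
  assumes "\<And>m n. \<lbrakk>m \<in> carrier M; n \<in> carrier N\<rbrakk> \<Longrightarrow> \<beta> m n \<in> carrier P"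
    and "\<And>m m' n. \<lbrakk>m \<in> carrier M; m' \<in> carrier M; n \<in> carrier N\<rbrakk> \<Longrightarrow> \<beta> (m \<oplus>\<^bsub>M\<^esub> m') n = \<beta> m n \<oplus>\<^bsub>P\<^esub> \<beta> m' n"
    and "\<And>r m n. \<lbrakk>r \<in> carrier R; m \<in> carrier M; n \<in> carrier N\<rbrakk> \<Longrightarrow> \<beta> (r \<odot>\<^bsub>M\<^esub> m) n = r \<odot>\<^bsub>P\<^esub> \<beta> m n"
    and "\<And>m n n'. \<lbrakk>m \<in> carrier M; n \<in> carrier N; n' \<in> carrier N\<rbrakk> \<Longrightarrow> \<beta> m (n \<oplus>\<^bsub>N\<^esub> n') = \<beta> m n \<oplus>\<^bsub>P\<^esub> \<beta> m n'"
    and "\<And>r m n. \<lbrakk>r \<in> carrier R; m \<in> carrier M; n \<in> carrier N\<rbrakk> \<Longrightarrow> \<beta> m (r \<odot>\<^bsub>N\<^esub> n) = r \<odot>\<^bsub>P\<^esub> \<beta> m n"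
  shows "bilinear R M N P \<beta>"
  using assms by (auto simp: bilinear_def intro!: module_homI)

text \<open>
  The models are all pairs of a module \<open>P\<close> and a bilinear map \<open>M \<times> N \<rightarrow> P\<close>. Each of them is a lift by
  evaluation, and \<open>(m, n) \<mapsto> m \<otimes> n\<close> is bilinear because it is so after every evaluation.
\<close>

lemma tensor_product_exists:
  fixes M N :: "'u mod_obj"
  assumes inf: "infinite (UNIV :: 'u set)" and M: "module R M" and N: "module R N"
  shows "\<exists>T \<tau>. is_tensor_product R M N T \<tau>"
proof -
  interpret M: module R M by (rule M)
  interpret N: module R N by (rule N)
  obtain p :: "'u \<times> 'u \<Rightarrow> 'u" where "inj p"
    using infinite_pairing[OF inf] .
  then obtain code :: "('u, 'u \<times> 'u) expr \<Rightarrow> 'u" where code: "inj code"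
    by (rule expr_encoding[OF inf])
  define K where "K = {(P, \<lambda>(m, n). \<beta> m n) | P \<beta>. module R P \<and> bilinear R M N P \<beta>}"
  interpret Q: presentation R "wf_expr False (carrier R) (carrier M \<times> carrier N)" K code
  proof (rule presentation.intro; (rule code M.R.is_cring)?)
    fix A e g assume "(A, e) \<in> K" "wf_expr False (carrier R) (carrier M \<times> carrier N) (Gen g)"
    then show "e g \<in> carrier A"
      by (cases g) (auto simp: K_def bilinear_def module_hom_def)
  qed (auto simp: K_def)
  let ?wf = "wf_expr False (carrier R) (carrier M \<times> carrier N)"
  let ?\<tau> = "\<lambda>m n. Q.rep (Gen (m, n))"
  have "bilinear R M N Q.quot ?\<tau>"
  proof (rule bilinearI)
    note bil = bilinearD[of R M N _ "\<lambda>m n. e (m, n)" for e]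
    have K: "bilinear R M N P (\<lambda>m n. e (m, n))" if "(P, e) \<in> K" for P e
      using that by (auto simp: K_def)
    show "?\<tau> m n \<in> carrier Q.quot"
      if "m \<in> carrier M" "n \<in> carrier N" for m n
      using that by simp
    show "?\<tau> (m \<oplus>\<^bsub>M\<^esub> m') n = ?\<tau> m n \<oplus>\<^bsub>Q.quot\<^esub> ?\<tau> m' n"
      if "m \<in> carrier M" "m' \<in> carrier M" "n \<in> carrier N" for m m' n
      by (rule Q.quot_eqI) (use that in \<open>auto intro: bil(2)[OF K]\<close>)
    show "?\<tau> (r \<odot>\<^bsub>M\<^esub> m) n = r \<odot>\<^bsub>Q.quot\<^esub> ?\<tau> m n"
      if "r \<in> carrier R" "m \<in> carrier M" "n \<in> carrier N" for r m n
      by (rule Q.quot_eqI) (use that in \<open>auto intro: bil(3)[OF K]\<close>)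
    show "?\<tau> m (n \<oplus>\<^bsub>N\<^esub> n') = ?\<tau> m n \<oplus>\<^bsub>Q.quot\<^esub> ?\<tau> m n'"
      if "m \<in> carrier M" "n \<in> carrier N" "n' \<in> carrier N" for m n n'
      by (rule Q.quot_eqI) (use that in \<open>auto intro: bil(4)[OF K]\<close>)
    show "?\<tau> m (r \<odot>\<^bsub>N\<^esub> n) = r \<odot>\<^bsub>Q.quot\<^esub> ?\<tau> m n"
      if "r \<in> carrier R" "m \<in> carrier M" "n \<in> carrier N" for r m n
      by (rule Q.quot_eqI) (use that in \<open>auto intro: bil(5)[OF K]\<close>)
  qed
  moreover have "\<exists>!h. h \<in> module_hom R Q.quot P \<inter> extensional (carrier Q.quot) \<and>
      (\<forall>m \<in> carrier M. \<forall>n \<in> carrier N. h (?\<tau> m n) = \<beta> m n)"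
    if P: "module R P" and \<beta>: "bilinear R M N P \<beta>" for P \<beta>
  proof (rule ex_ex1I)
    let ?h = "restrict (Q.ev P (\<lambda>(m, n). \<beta> m n)) (carrier Q.quot)"
    have K: "(P, \<lambda>(m, n). \<beta> m n) \<in> K"
      unfolding K_def using P \<beta>
      by (intro CollectI exI[of _ P] exI[of _ \<beta>] conjI) (rule refl)
    have "?h \<in> module_hom R Q.quot P \<inter> extensional (carrier Q.quot) \<and>
        (\<forall>m \<in> carrier M. \<forall>n \<in> carrier N. ?h (?\<tau> m n) = \<beta> m n)"
    proof (intro conjI ballI IntI restrict_extensional)
      show "?h \<in> module_hom R Q.quot P"
        by (rule module_homI) (simp_all add: K)
    qed (simp add: K)
    then show "\<exists>h. h \<in> module_hom R Q.quot P \<inter> extensional (carrier Q.quot) \<and>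
        (\<forall>m \<in> carrier M. \<forall>n \<in> carrier N. h (?\<tau> m n) = \<beta> m n)"
      by (rule exI[of _ ?h])
  next
    fix h h'
    assume h: "h \<in> module_hom R Q.quot P \<inter> extensional (carrier Q.quot) \<and>
        (\<forall>m \<in> carrier M. \<forall>n \<in> carrier N. h (?\<tau> m n) = \<beta> m n)"
      and h': "h' \<in> module_hom R Q.quot P \<inter> extensional (carrier Q.quot) \<and>
        (\<forall>m \<in> carrier M. \<forall>n \<in> carrier N. h' (?\<tau> m n) = \<beta> m n)"
    note hom = module_homD[of h R Q.quot P] module_homD[of h' R Q.quot P]
      module_hom_zero[OF Q.module_quot P, of h] module_hom_zero[OF Q.module_quot P, of h']
    show "h = h'"
    proof (rule extensionalityI)
      fix x assume "x \<in> carrier Q.quot"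
      then show "h x = h' x"
      proof (induction x rule: Q.quot_induct)
        case (gen g)
        then show ?case using h h' by (cases g) simp
      qed (use h h' in \<open>simp_all add: hom\<close>)
    qed (use h h' in auto)
  qed
  ultimately show ?thesis
    using Q.module_quot unfolding is_tensor_product_def by (intro exI conjI allI impI) (blast | simp)+
qed

locale tensor_modules =
  fixes R :: "'u ring" and M N :: "'u mod_obj"
  assumes inf: "infinite (UNIV :: 'u set)"
    and M: "module R M"
    and N: "module R N"
begin

abbreviation T where "T \<equiv> tensor R M N"
abbreviation pr where "pr \<equiv> pure R M N"

lemma is_tensor_product: "is_tensor_product R M N T pr"
proof -
  have "case tensor_choice R M N of (X, \<tau>) \<Rightarrow> is_tensor_product R M N X \<tau>"
    unfolding tensor_choice_def
    by (rule someI_ex) (use tensor_product_exists[OF inf M N] in auto)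
  then show ?thesis
    by (simp add: tensor_def pure_def split_beta)
qed

lemma module_T: "module R T"
  and bilinear_pr: "bilinear R M N T pr"
  using is_tensor_product unfolding is_tensor_product_def by auto

lemma lift_ex1:
  assumes "module R P" "bilinear R M N P \<beta>"
  shows "\<exists>!h. h \<in> module_hom R T P \<inter> extensional (carrier T) \<and>
    (\<forall>m \<in> carrier M. \<forall>n \<in> carrier N. h (pr m n) = \<beta> m n)"
  using is_tensor_product assms unfolding is_tensor_product_def by blast

lemma lift_unique:
  assumes P: "module R P" "bilinear R M N P \<beta>"
    and h: "h \<in> module_hom R T P" "h \<in> extensional (carrier T)"
      "\<And>m n. \<lbrakk>m \<in> carrier M; n \<in> carrier N\<rbrakk> \<Longrightarrow> h (pr m n) = \<beta> m n"
    and h': "h' \<in> module_hom R T P" "h' \<in> extensional (carrier T)"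
      "\<And>m n. \<lbrakk>m \<in> carrier M; n \<in> carrier N\<rbrakk> \<Longrightarrow> h' (pr m n) = \<beta> m n"
  shows "h = h'"
  using lift_ex1[OF P] h h' by blast

lemma lift_pure:
  assumes "module R P" "bilinear R M N P \<beta>"
  shows "tensor_lift R M N P \<beta> \<in> module_hom R T P \<inter> extensional (carrier T)"
    and "\<lbrakk>m \<in> carrier M; n \<in> carrier N\<rbrakk> \<Longrightarrow> tensor_lift R M N P \<beta> (pr m n) = \<beta> m n"
  using theI'[OF lift_ex1[OF assms]] by (auto simp: tensor_lift_def)

text \<open>
  The pure tensors generate \<open>M \<otimes> N\<close>. As the tensor product is known only by its universal property,
  the argument is abstract: if \<open>W\<close> is a submodule that contains the pure tensors, then the map
  \<open>M \<otimes> N \<rightarrow> W \<rightarrow> M \<otimes> N\<close> fixes the pure tensors and so is the identity, whence \<open>W\<close> is everything.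
\<close>

lemma tensor_induct [consumes 1, case_names pure add smult]:
  assumes x: "x \<in> carrier T"
    and pure: "\<And>m n. \<lbrakk>m \<in> carrier M; n \<in> carrier N\<rbrakk> \<Longrightarrow> P (pr m n)"
    and add: "\<And>x y. \<lbrakk>x \<in> carrier T; y \<in> carrier T; P x; P y\<rbrakk> \<Longrightarrow> P (x \<oplus>\<^bsub>T\<^esub> y)"
    and smult: "\<And>r x. \<lbrakk>r \<in> carrier R; x \<in> carrier T; P x\<rbrakk> \<Longrightarrow> P (r \<odot>\<^bsub>T\<^esub> x)"
  shows "P x"
proof -
  interpret T: module R T by (rule module_T)
  interpret M: module R M by (rule M)
  interpret N: module R N by (rule N)
  let ?W = "{x \<in> carrier T. P x}"
  let ?TW = "T\<lparr>carrier := ?W\<rparr>"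
  have pr [simp]: "pr m n \<in> carrier T" if "m \<in> carrier M" "n \<in> carrier N" for m n
    using bilinearD(1)[OF bilinear_pr] that .
  \<comment> \<open>The induction rule has no case for zero, which is a multiple of a pure tensor.\<close>
  have "P (\<zero>\<^bsub>R\<^esub> \<odot>\<^bsub>T\<^esub> pr \<zero>\<^bsub>M\<^esub> \<zero>\<^bsub>N\<^esub>)"
    by (intro smult pure) auto
  then have "P \<zero>\<^bsub>T\<^esub>"
    by simp
  moreover have "P (\<ominus>\<^bsub>T\<^esub> a)" if "a \<in> ?W" for a
  proof -
    have "P ((\<ominus>\<^bsub>R\<^esub> \<one>\<^bsub>R\<^esub>) \<odot>\<^bsub>T\<^esub> a)"
      using that by (intro smult) auto
    then show ?thesis
      using that by (simp add: T.smult_l_minus)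
  qed
  ultimately have "submodule ?W R T"
    by (intro T.submoduleI) (auto intro: add smult)
  then have W: "module R ?TW"
    by (rule submodule.submodule_is_module[OF _ module_T])
  have bil: "bilinear R M N ?TW pr"
    by (rule bilinearI) (auto simp: bilinearD[OF bilinear_pr] pure)
  define h where "h = tensor_lift R M N ?TW pr"
  have h: "h \<in> module_hom R T ?TW" "h \<in> extensional (carrier T)"
    "\<And>m n. \<lbrakk>m \<in> carrier M; n \<in> carrier N\<rbrakk> \<Longrightarrow> h (pr m n) = pr m n"
    using lift_pure[OF W bil] by (auto simp: h_def)
  have hT: "h \<in> module_hom R T T"
    using module_homD[OF h(1)] by (intro module_homI) auto
  have "h = (\<lambda>x\<in>carrier T. x)"
  proof (rule lift_unique[OF module_T bilinear_pr])
    show "(\<lambda>x\<in>carrier T. x) \<in> module_hom R T T"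
      by (rule module_homI) auto
  qed (use h hT in auto)
  then have "h x = x"
    using x by simp
  then show ?thesis
    using module_homD(1)[OF h(1) x] by simp
qed

end

section \<open>Extension of scalars for modules\<close>

lemma Arr_Cring:
  "f \<in> Arr Cring \<longleftrightarrow> cring (src f) \<and> cring (tgt f) \<and> fn f \<in> ring_hom (src f) (tgt f) \<and>
     fn f \<in> extensional (carrier (src f))"
  by (cases f) (auto simp: Cring_def concrete_category_def)

lemma restrict_scalars_simps [simp]:
  "carrier (restrict_scalars f N) = carrier N"
  "mult (restrict_scalars f N) = mult N"
  "one (restrict_scalars f N) = one N"
  "zero (restrict_scalars f N) = zero N"
  "add (restrict_scalars f N) = add N"
  "smult (restrict_scalars f N) = (\<lambda>r. smult N (fn f r))"
  by (simp_all add: restrict_scalars_def fun_eq_iff)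

lemma target_module_simps [simp]:
  "carrier (target_module f) = carrier (tgt f)"
  "add (target_module f) = add (tgt f)"
  "zero (target_module f) = zero (tgt f)"
  "smult (target_module f) = (\<lambda>r s. fn f r \<otimes>\<^bsub>tgt f\<^esub> s)"
  by (simp_all add: target_module_def Let_def)

lemma abelian_group_cong:
  assumes "carrier A = carrier B" "add A = add B" "zero A = zero B" "abelian_group A"
  shows "abelian_group B"
proof -
  interpret A: abelian_group A by fact
  show ?thesis
    by (rule abelian_groupI)
       (use A.a_closed A.zero_closed A.a_assoc A.a_comm A.l_zero A.l_neg A.a_inv_closed
         in \<open>auto simp flip: assms(1-3)\<close>)
qed

lemma cring_cong:
  assumes "carrier A = carrier B" "add A = add B" "zero A = zero B" "mult A = mult B" "one A = one B"
    "cring A"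
  shows "cring B"
proof -
  interpret A: cring A by fact
  show ?thesis
  proof (rule cringI)
    show "abelian_group B"
      by (rule abelian_group_cong[OF assms(1-3)]) (rule A.abelian_group_axioms)
    show "comm_monoid B"
      by (rule comm_monoidI) (auto simp flip: assms(1-5) intro: A.m_assoc A.m_comm)
    fix x y z assume "x \<in> carrier B" "y \<in> carrier B" "z \<in> carrier B"
    then show "(x \<oplus>\<^bsub>B\<^esub> y) \<otimes>\<^bsub>B\<^esub> z = x \<otimes>\<^bsub>B\<^esub> z \<oplus>\<^bsub>B\<^esub> y \<otimes>\<^bsub>B\<^esub> z"
      by (auto simp flip: assms(1-5) intro: A.l_distr)
  qed
qed

lemma module_restrict_scalars:
  assumes f: "f \<in> Arr Cring" and N: "module (tgt f) N"
  shows "module (src f) (restrict_scalars f N)"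
proof -
  interpret N: module "tgt f" N by (rule N)
  have hom: "fn f \<in> ring_hom (src f) (tgt f)" and R: "cring (src f)"
    using f by (simp_all add: Arr_Cring)
  show ?thesis
  proof (rule moduleI[OF R])
    show "abelian_group (restrict_scalars f N)"
      by (rule abelian_group_cong[of N]) (auto intro: N.abelian_group_axioms)
  qed (use hom in \<open>auto simp: ring_hom_closed ring_hom_add ring_hom_mult ring_hom_one
         intro: N.smult_l_distr N.smult_r_distr N.smult_assoc1\<close>)
qed

lemma algebra_restrict_scalars:
  assumes f: "f \<in> Arr Cring" and B: "algebra (tgt f) B"
  shows "algebra (src f) (restrict_scalars f B)"
proof -
  interpret B: algebra "tgt f" B by (rule B)
  have hom: "fn f \<in> ring_hom (src f) (tgt f)"
    using f by (simp add: Arr_Cring)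
  show ?thesis
  proof (rule algebra.intro[OF module_restrict_scalars[OF f B.module]])
    show "cring (restrict_scalars f B)"
      by (rule cring_cong[of B]) (auto intro: B.M_cring)
    show "algebra_axioms (src f) (restrict_scalars f B)"
      by (rule algebra_axioms.intro) (use hom in \<open>auto simp: ring_hom_closed intro: B.smult_assoc2\<close>)
  qed
qed

lemma module_target_module:
  assumes f: "f \<in> Arr Cring"
  shows "module (src f) (target_module f)"
proof -
  interpret S: cring "tgt f" using f by (simp add: Arr_Cring)
  have hom: "fn f \<in> ring_hom (src f) (tgt f)" and R: "cring (src f)"
    using f by (simp_all add: Arr_Cring)
  show ?thesis
  proof (rule moduleI[OF R])
    show "abelian_group (target_module f)"
      by (rule abelian_group_cong[of "tgt f"]) (auto intro: S.abelian_group_axioms)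
  qed (use hom in \<open>auto simp: ring_hom_closed ring_hom_add ring_hom_mult ring_hom_one
         S.l_distr S.r_distr S.m_assoc\<close>)
qed

text \<open>
  A lift depends on its target only through the linear maps into it, and on the bilinear map only
  through the values on the carriers. This reconciles the different targets that occur for the same
  map, such as \<open>M \<otimes> S\<close> as an \<open>R\<close>-module and the restriction of \<open>M \<otimes> S\<close> as an \<open>S\<close>-module.
\<close>

lemma tensor_lift_cong:
  assumes "\<And>h. h \<in> module_hom R (tensor R M N) P \<longleftrightarrow> h \<in> module_hom R (tensor R M N) P'"
    and "\<And>m n. \<lbrakk>m \<in> carrier M; n \<in> carrier N\<rbrakk> \<Longrightarrow> \<beta> m n = \<beta>' m n"
  shows "tensor_lift R M N P \<beta> = tensor_lift R M N P' \<beta>'"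
  unfolding tensor_lift_def using assms by (auto intro!: arg_cong[where f = The])

lemma ext_module_simps [simp]:
  "carrier (ext_module f M) = carrier (ext_tensor f M)"
  "add (ext_module f M) = add (ext_tensor f M)"
  "zero (ext_module f M) = zero (ext_tensor f M)"
  by (simp_all add: ext_module_def)

lemma ext_algebra_simps [simp]:
  "carrier (ext_algebra f M) = carrier (ext_tensor f M)"
  "add (ext_algebra f M) = add (ext_tensor f M)"
  "zero (ext_algebra f M) = zero (ext_tensor f M)"
  "smult (ext_algebra f M) = smult (ext_module f M)"
  by (simp_all add: ext_algebra_def)

text \<open>
  For an \<open>R\<close>-linear map \<open>h\<close> from \<open>M\<close> to the restriction of \<open>N\<close>, this is the \<open>S\<close>-linear map \<open>M \<otimes> S \<rightarrow> N\<close>,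
  \<open>m \<otimes> s \<mapsto> s \<odot> h m\<close>, that corresponds to \<open>h\<close> under the adjunction of extension and restriction.
\<close>

definition universal_lift ::
    "'u ring_arrow \<Rightarrow> 'u mod_obj \<Rightarrow> 'u mod_obj \<Rightarrow> ('u \<Rightarrow> 'u) \<Rightarrow> 'u \<Rightarrow> 'u" where
  "universal_lift f M N h = ext_lift f M (restrict_scalars f N) (\<lambda>m s. s \<odot>\<^bsub>N\<^esub> h m)"

locale extension =
  fixes f :: "'u ring_arrow" and M :: "'u mod_obj"
  assumes inf: "infinite (UNIV :: 'u set)"
    and f: "f \<in> Arr Cring"
    and M: "module (src f) M"

sublocale extension \<subseteq> tensor_modules "src f" M "target_module f"
  by (rule tensor_modules.intro[OF inf M module_target_module[OF f]])

context extension begin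

abbreviation "R \<equiv> src f"
abbreviation "S \<equiv> tgt f"
abbreviation "\<phi> \<equiv> fn f"
abbreviation "X \<equiv> ext_module f M"
abbreviation u where "u m \<equiv> pr m \<one>\<^bsub>S\<^esub>"

lemma hom: "\<phi> \<in> ring_hom R S" and R: "cring R" and S: "cring S"
  using f by (simp_all add: Arr_Cring)

sublocale S: cring S by (rule S)
sublocale R: cring R by (rule R)
sublocale M: module R M by (rule M)
sublocale T: module R T by (rule module_T)

lemmas pr = bilinearD[OF bilinear_pr, simplified]

lemma \<phi>_closed [simp]: "r \<in> carrier R \<Longrightarrow> \<phi> r \<in> carrier S"
  using hom by (rule ring_hom_closed)

lemma bilinear_act:
  assumes "s' \<in> carrier S"
  shows "bilinear R M (target_module f) T (\<lambda>m s. pr m (s' \<otimes>\<^bsub>S\<^esub> s))"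
proof -
  have "pr m (s' \<otimes>\<^bsub>S\<^esub> (\<phi> r \<otimes>\<^bsub>S\<^esub> s)) = r \<odot>\<^bsub>T\<^esub> pr m (s' \<otimes>\<^bsub>S\<^esub> s)"
    if "m \<in> carrier M" "r \<in> carrier R" "s \<in> carrier S" for m r s
    using that assms pr(5)[of r m "s' \<otimes>\<^bsub>S\<^esub> s"] by (simp add: S.m_lcomm)
  then show ?thesis
    using assms by (intro bilinearI) (auto simp: pr S.r_distr)
qed

lemma smult_X: "s' \<odot>\<^bsub>X\<^esub> x = ext_lift f M T (\<lambda>m s. pr m (s' \<otimes>\<^bsub>S\<^esub> s)) x"
  by (simp add: ext_module_def)

lemma act_hom: "s \<in> carrier S \<Longrightarrow> (\<lambda>x. s \<odot>\<^bsub>X\<^esub> x) \<in> module_hom R T T"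
  using lift_pure(1)[OF module_T bilinear_act] by (simp add: smult_X)

lemmas act = module_homD[OF act_hom]

lemma act_pure:
  "\<lbrakk>s' \<in> carrier S; m \<in> carrier M; s \<in> carrier S\<rbrakk> \<Longrightarrow> s' \<odot>\<^bsub>X\<^esub> pr m s = pr m (s' \<otimes>\<^bsub>S\<^esub> s)"
  using lift_pure(2)[OF module_T bilinear_act] by (simp add: smult_X)

text \<open>
  The \<open>R\<close>-module \<open>M \<otimes> S\<close> is the restriction of scalars of the \<open>S\<close>-module \<open>M \<otimes> S\<close>. Both scalar actions
  are determined by their values on pure tensors, where the claim is \<open>r (m \<otimes> s) = m \<otimes> f(r) s\<close>.
\<close>

lemma smult_T_eq_act:
  assumes r: "r \<in> carrier R" and x: "x \<in> carrier T"
  shows "r \<odot>\<^bsub>T\<^esub> x = \<phi> r \<odot>\<^bsub>X\<^esub> x"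
  using x
proof (induction x rule: tensor_induct)
  case (pure m n)
  then show ?case using r by (simp add: act_pure pr)
next
  case (add x y)
  then show ?case using r by (simp add: act T.smult_r_distr)
next
  case (smult r' x)
  have "r \<odot>\<^bsub>T\<^esub> (r' \<odot>\<^bsub>T\<^esub> x) = r' \<odot>\<^bsub>T\<^esub> (r \<odot>\<^bsub>T\<^esub> x)"
    using r smult(1,2) T.smult_assoc1[of r r' x] T.smult_assoc1[of r' r x] R.m_comm[of r r'] by simp
  then show ?case
    using smult r by (simp add: act(3))
qed

lemma module_X: "module S X"
proof (rule moduleI[OF S])
  show "abelian_group X"
    by (rule abelian_group_cong[of T]) (auto intro: T.M.abelian_group_axioms)
  fix a b x y assume *: "a \<in> carrier S" "b \<in> carrier S" "x \<in> carrier X" "y \<in> carrier X"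
  show "a \<odot>\<^bsub>X\<^esub> x \<in> carrier X" "a \<odot>\<^bsub>X\<^esub> (x \<oplus>\<^bsub>X\<^esub> y) = a \<odot>\<^bsub>X\<^esub> x \<oplus>\<^bsub>X\<^esub> a \<odot>\<^bsub>X\<^esub> y"
    using * by (simp_all add: act)
  have "x \<in> carrier T" using * by simp
  then show "(a \<oplus>\<^bsub>S\<^esub> b) \<odot>\<^bsub>X\<^esub> x = a \<odot>\<^bsub>X\<^esub> x \<oplus>\<^bsub>X\<^esub> b \<odot>\<^bsub>X\<^esub> x"
    using *(1,2)
    by (induction x rule: tensor_induct)
       (simp_all add: act_pure act pr S.l_distr T.smult_r_distr T.M.a_ac)
  show "(a \<otimes>\<^bsub>S\<^esub> b) \<odot>\<^bsub>X\<^esub> x = a \<odot>\<^bsub>X\<^esub> (b \<odot>\<^bsub>X\<^esub> x)"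
    using \<open>x \<in> carrier T\<close> *(1,2)
    by (induction x rule: tensor_induct) (simp_all add: act_pure act S.m_assoc)
next
  fix x assume "x \<in> carrier X"
  then have "x \<in> carrier T" by simp
  then show "\<one>\<^bsub>S\<^esub> \<odot>\<^bsub>X\<^esub> x = x"
    by (induction x rule: tensor_induct) (simp_all add: act_pure act)
qed

sublocale X: module S X by (rule module_X)

lemma u_closed [simp]: "m \<in> carrier M \<Longrightarrow> u m \<in> carrier T"
  by (simp add: pr)

lemma pure_eq_act: "\<lbrakk>m \<in> carrier M; s \<in> carrier S\<rbrakk> \<Longrightarrow> pr m s = s \<odot>\<^bsub>X\<^esub> u m"
  by (simp add: act_pure)

text \<open>
  Since \<open>m \<otimes> s = s (m \<otimes> 1)\<close>, the elements \<open>m \<otimes> 1\<close> generate \<open>M \<otimes> S\<close> over \<open>S\<close>. All later comparisons of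
  maps out of \<open>M \<otimes> S\<close> rest on this.
\<close>

lemma ext_induct [consumes 1, case_names unit add smult]:
  assumes x: "x \<in> carrier T"
    and unit: "\<And>m. m \<in> carrier M \<Longrightarrow> P (u m)"
    and add: "\<And>x y. \<lbrakk>x \<in> carrier T; y \<in> carrier T; P x; P y\<rbrakk> \<Longrightarrow> P (x \<oplus>\<^bsub>T\<^esub> y)"
    and smult: "\<And>s x. \<lbrakk>s \<in> carrier S; x \<in> carrier T; P x\<rbrakk> \<Longrightarrow> P (s \<odot>\<^bsub>X\<^esub> x)"
  shows "P x"
  using x
proof (induction x rule: tensor_induct)
  case (pure m s)
  then show ?case by (simp add: pure_eq_act[of m s] unit smult)
next
  case (smult r x)
  then show ?case by (simp add: smult_T_eq_act[of r x] assms(4))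
qed (rule add)

lemma unit_hom: "u \<in> module_hom R M (restrict_scalars f X)"
proof (rule module_homI)
  fix r m assume "r \<in> carrier R" "m \<in> carrier M"
  then show "u (r \<odot>\<^bsub>M\<^esub> m) = r \<odot>\<^bsub>restrict_scalars f X\<^esub> u m"
    by (simp add: pr smult_T_eq_act)
qed (simp_all add: pr)

lemma hom_to_T_iff:
  "h \<in> module_hom R N (restrict_scalars f X) \<longleftrightarrow> h \<in> module_hom R N T"
  by (auto simp: module_hom_def Pi_iff smult_T_eq_act)

lemma ext_hom_eqI:
  assumes "x \<in> carrier T" "k \<in> module_hom S X N" "k' \<in> module_hom S X N"
    "\<And>m. m \<in> carrier M \<Longrightarrow> k (u m) = k' (u m)"
  shows "k x = k' x"
  using assms(1)
  by (induction x rule: ext_induct)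
     (use assms(4) module_homD(2,3)[OF assms(2)] module_homD(2,3)[OF assms(3)] in auto)

context
  fixes N :: "'u mod_obj" and h
  assumes N: "module S N" and h: "h \<in> module_hom R M (restrict_scalars f N)"
begin

interpretation N: module S N by (rule N)

lemma bilinear_smult_hom: "bilinear R M (target_module f) (restrict_scalars f N) (\<lambda>m s. s \<odot>\<^bsub>N\<^esub> h m)"
proof -
  note h' = module_homD[OF h]
  have "s \<odot>\<^bsub>N\<^esub> (\<phi> r \<odot>\<^bsub>N\<^esub> h m) = \<phi> r \<odot>\<^bsub>N\<^esub> (s \<odot>\<^bsub>N\<^esub> h m)"
    if "m \<in> carrier M" "r \<in> carrier R" "s \<in> carrier S" for m r s
    using that h'(1) by (simp flip: N.smult_assoc1 add: S.m_comm)
  then show ?thesis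
    using h' by (intro bilinearI) (auto simp: N.smult_r_distr N.smult_l_distr N.smult_assoc1)
qed

lemmas lift_raw = lift_pure[OF module_restrict_scalars[OF f N] bilinear_smult_hom,
  folded universal_lift_def, simplified]

lemma universal_lift_unit:
  assumes "m \<in> carrier M"
  shows "universal_lift f M N h (u m) = h m"
  using assms module_homD(1)[OF h] lift_raw(2)[of m "\<one>\<^bsub>S\<^esub>"] by simp

lemma universal_lift_extensional: "universal_lift f M N h \<in> extensional (carrier X)"
  using lift_raw(1) by simp

lemma universal_lift_hom: "universal_lift f M N h \<in> module_hom S X N"
proof -
  let ?k = "universal_lift f M N h"
  have k: "?k \<in> module_hom R T (restrict_scalars f N)"
    using lift_raw(1) by simp
  note kD = module_homD[OF k, simplified]
  show ?thesis
  proof (rule module_homI)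
    fix s x assume s: "s \<in> carrier S" and "x \<in> carrier X"
    then have "x \<in> carrier T" by simp
    then show "?k (s \<odot>\<^bsub>X\<^esub> x) = s \<odot>\<^bsub>N\<^esub> ?k x"
    proof (induction x rule: tensor_induct)
      case (pure m s')
      then show ?case
        using s module_homD(1)[OF h] by (simp add: act_pure lift_raw(2) N.smult_assoc1)
    next
      case (smult r x)
      then show ?case
        using s kD(1) by (simp add: act kD(3)) (simp flip: N.smult_assoc1 add: S.m_comm)
    qed (use s kD in \<open>auto simp: act N.smult_r_distr\<close>)
  qed (use kD in auto)
qed

end

end

section \<open>Extension of scalars for algebras\<close>

locale algebra_extension =
  fixes f :: "'u ring_arrow" and A :: "'u mod_obj"
  assumes inf': "infinite (UNIV :: 'u set)"
    and f': "f \<in> Arr Cring"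
    and A: "algebra (src f) A"

sublocale algebra_extension \<subseteq> extension f A
  by (rule extension.intro[OF inf' f' algebra.module[OF A]])

context algebra_extension begin

sublocale A: algebra R A by (rule A)

abbreviation "Y \<equiv> ext_algebra f A"

text \<open>
  Multiplication by the pure tensor \<open>a \<otimes> s\<close>, the inner lift in the definition of the product on
  \<open>A \<otimes> S\<close>.
\<close>

definition pure_mult :: "'u \<Rightarrow> 'u \<Rightarrow> 'u \<Rightarrow> 'u" where
  "pure_mult a s = ext_lift f A T (\<lambda>a' s'. pr (a \<otimes>\<^bsub>A\<^esub> a') (s \<otimes>\<^bsub>S\<^esub> s'))"

lemma A_mult_smult: "\<lbrakk>r \<in> carrier R; a \<in> carrier A; b \<in> carrier A\<rbrakk>
  \<Longrightarrow> a \<otimes>\<^bsub>A\<^esub> (r \<odot>\<^bsub>A\<^esub> b) = r \<odot>\<^bsub>A\<^esub> (a \<otimes>\<^bsub>A\<^esub> b)"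
  by (metis A.m_comm A.smult_assoc2 M.smult_closed)

lemma bilinear_pure_mult:
  assumes "a \<in> carrier A" "s \<in> carrier S"
  shows "bilinear R A (target_module f) T (\<lambda>a' s'. pr (a \<otimes>\<^bsub>A\<^esub> a') (s \<otimes>\<^bsub>S\<^esub> s'))"
proof -
  have "pr (a \<otimes>\<^bsub>A\<^esub> a') (s \<otimes>\<^bsub>S\<^esub> (\<phi> r \<otimes>\<^bsub>S\<^esub> s')) = r \<odot>\<^bsub>T\<^esub> pr (a \<otimes>\<^bsub>A\<^esub> a') (s \<otimes>\<^bsub>S\<^esub> s')"
    if "a' \<in> carrier A" "r \<in> carrier R" "s' \<in> carrier S" for a' r s'
    using that assms pr(5)[of r "a \<otimes>\<^bsub>A\<^esub> a'" "s \<otimes>\<^bsub>S\<^esub> s'"] by (simp add: S.m_lcomm)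
  then show ?thesis
    using assms by (intro bilinearI) (auto simp: pr S.r_distr A.r_distr A_mult_smult)
qed

lemma pure_mult_hom:
  "\<lbrakk>a \<in> carrier A; s \<in> carrier S\<rbrakk> \<Longrightarrow> pure_mult a s \<in> module_hom R T T"
  using lift_pure(1)[OF module_T bilinear_pure_mult] by (simp add: pure_mult_def)

lemmas pure_mult = module_homD[OF pure_mult_hom]

lemma pure_mult_pure:
  "\<lbrakk>a \<in> carrier A; s \<in> carrier S; a' \<in> carrier A; s' \<in> carrier S\<rbrakk>
    \<Longrightarrow> pure_mult a s (pr a' s') = pr (a \<otimes>\<^bsub>A\<^esub> a') (s \<otimes>\<^bsub>S\<^esub> s')"
  using lift_pure(2)[OF module_T bilinear_pure_mult] by (simp add: pure_mult_def)

text \<open>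
  For the outer lift, multiplication by \<open>a \<otimes> s\<close> must be bilinear in \<open>a\<close> and \<open>s\<close> at every element \<open>y\<close> of
  \<open>A \<otimes> S\<close>. On a pure tensor \<open>y\<close> this is distributivity in \<open>A\<close> and in \<open>S\<close>, and the property is
  preserved under sums and scalar multiples of \<open>y\<close>.
\<close>

lemma bilinear_pure_mult_left:
  assumes y: "y \<in> carrier T"
  shows "bilinear R A (target_module f) T (\<lambda>a s. pure_mult a s y)"
proof (rule bilinearI)
  show "pure_mult a s y \<in> carrier T" if "a \<in> carrier A" "s \<in> carrier (target_module f)" for a s
    using that y by (simp add: pure_mult)
  show "pure_mult (a \<oplus>\<^bsub>A\<^esub> a') s y = pure_mult a s y \<oplus>\<^bsub>T\<^esub> pure_mult a' s y"
    if "a \<in> carrier A" "a' \<in> carrier A" "s \<in> carrier (target_module f)" for a a' s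
    using y that
    by (induction y rule: tensor_induct)
       (simp_all add: pure_mult_pure pure_mult pr A.l_distr T.smult_r_distr T.M.a_ac)
  show "pure_mult (r \<odot>\<^bsub>A\<^esub> a) s y = r \<odot>\<^bsub>T\<^esub> pure_mult a s y"
    if "r \<in> carrier R" "a \<in> carrier A" "s \<in> carrier (target_module f)" for r a s
    using y
  proof (induction y rule: tensor_induct)
    case (smult r' y)
    have "pure_mult a s y \<in> carrier T"
      using smult that by (simp add: pure_mult)
    then show ?case
      using smult that T.smult_assoc1[of r r'] T.smult_assoc1[of r' r] R.m_comm[of r r']
      by (simp add: pure_mult(3))
  qed (use that in \<open>simp_all add: pure_mult_pure pure_mult pr A.smult_assoc2 T.smult_r_distr\<close>)
  show "pure_mult a (s \<oplus>\<^bsub>target_module f\<^esub> s') y = pure_mult a s y \<oplus>\<^bsub>T\<^esub> pure_mult a s' y"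
    if "a \<in> carrier A" "s \<in> carrier (target_module f)" "s' \<in> carrier (target_module f)" for a s s'
    using y that
    by (induction y rule: tensor_induct)
       (simp_all add: pure_mult_pure pure_mult pr S.l_distr T.smult_r_distr T.M.a_ac)
  show "pure_mult a (r \<odot>\<^bsub>target_module f\<^esub> s) y = r \<odot>\<^bsub>T\<^esub> pure_mult a s y"
    if "r \<in> carrier R" "a \<in> carrier A" "s \<in> carrier (target_module f)" for r a s
    using y
  proof (induction y rule: tensor_induct)
    case (pure a' s')
    then show ?case
      using that pr(5)[of r "a \<otimes>\<^bsub>A\<^esub> a'" "s \<otimes>\<^bsub>S\<^esub> s'"] by (simp add: pure_mult_pure S.m_assoc)
  next
    case (smult r' y)
    have "pure_mult a s y \<in> carrier T"
      using smult that by (simp add: pure_mult)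
    then show ?case
      using smult that T.smult_assoc1[of r r'] T.smult_assoc1[of r' r] R.m_comm[of r r']
      by (simp add: pure_mult(3))
  qed (use that in \<open>simp_all add: pure_mult T.smult_r_distr\<close>)
qed

lemma mult_Y: "x \<otimes>\<^bsub>Y\<^esub> y = ext_lift f A T (\<lambda>a s. pure_mult a s y) x"
  by (simp add: ext_algebra_def pure_mult_def)

lemma one_Y: "\<one>\<^bsub>Y\<^esub> = u \<one>\<^bsub>A\<^esub>"
  by (simp add: ext_algebra_def)

lemma mult_left_hom: "y \<in> carrier T \<Longrightarrow> (\<lambda>x. x \<otimes>\<^bsub>Y\<^esub> y) \<in> module_hom R T T"
  using lift_pure(1)[OF module_T bilinear_pure_mult_left] by (simp add: mult_Y)

lemma mult_pure_left:
  "\<lbrakk>y \<in> carrier T; a \<in> carrier A; s \<in> carrier S\<rbrakk> \<Longrightarrow> pr a s \<otimes>\<^bsub>Y\<^esub> y = pure_mult a s y"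
  using lift_pure(2)[OF module_T bilinear_pure_mult_left] by (simp add: mult_Y)

lemmas mult_left = module_homD[OF mult_left_hom]

lemma mult_pure:
  "\<lbrakk>a \<in> carrier A; s \<in> carrier S; a' \<in> carrier A; s' \<in> carrier S\<rbrakk>
    \<Longrightarrow> pr a s \<otimes>\<^bsub>Y\<^esub> pr a' s' = pr (a \<otimes>\<^bsub>A\<^esub> a') (s \<otimes>\<^bsub>S\<^esub> s')"
  by (simp add: mult_pure_left pure_mult_pure pr)

text \<open>
  The product is linear in its left argument by construction. Linearity in the right argument holds
  for a pure left argument and extends to all others by left linearity. Once the product is known to
  be bilinear, each ring law needs to be checked on pure tensors only.
\<close>

lemma mult_add_right:
  assumes "x \<in> carrier T" "y \<in> carrier T" "z \<in> carrier T"
  shows "x \<otimes>\<^bsub>Y\<^esub> (y \<oplus>\<^bsub>T\<^esub> z) = x \<otimes>\<^bsub>Y\<^esub> y \<oplus>\<^bsub>T\<^esub> x \<otimes>\<^bsub>Y\<^esub> z"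
  using assms
  by (induction x rule: tensor_induct)
     (simp_all add: mult_pure_left pure_mult mult_left T.smult_r_distr T.M.a_ac)

lemma mult_smult_right:
  assumes r: "r \<in> carrier R" and x: "x \<in> carrier T" and y: "y \<in> carrier T"
  shows "x \<otimes>\<^bsub>Y\<^esub> (r \<odot>\<^bsub>T\<^esub> y) = r \<odot>\<^bsub>T\<^esub> (x \<otimes>\<^bsub>Y\<^esub> y)"
  using x
proof (induction x rule: tensor_induct)
  case (smult r' x)
  have "x \<otimes>\<^bsub>Y\<^esub> y \<in> carrier T"
    using smult y by (simp add: mult_left)
  then show ?case
    using smult r y T.smult_assoc1[of r r'] T.smult_assoc1[of r' r] R.m_comm[of r r']
    by (simp add: mult_left(3))
qed (use r y in \<open>simp_all add: mult_pure_left pure_mult mult_left T.smult_r_distr\<close>)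

lemma mult_act_left:
  assumes s: "s \<in> carrier S" and x: "x \<in> carrier T" and y: "y \<in> carrier T"
  shows "(s \<odot>\<^bsub>X\<^esub> x) \<otimes>\<^bsub>Y\<^esub> y = s \<odot>\<^bsub>X\<^esub> (x \<otimes>\<^bsub>Y\<^esub> y)"
  using x
proof (induction x rule: tensor_induct)
  case (pure a s')
  show ?case
    using y
  proof (induction y rule: tensor_induct)
    case (pure b t)
    then show ?case
      using s \<open>a \<in> carrier A\<close> \<open>s' \<in> carrier (target_module f)\<close> by (simp add: mult_pure act_pure S.m_assoc)
  qed (use s pure in \<open>simp_all add: pr act mult_add_right mult_smult_right mult_left(1)\<close>)
qed (use s y in \<open>simp_all add: act mult_left\<close>)

lemma mult_comm:
  assumes x: "x \<in> carrier T" and y: "y \<in> carrier T"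
  shows "x \<otimes>\<^bsub>Y\<^esub> y = y \<otimes>\<^bsub>Y\<^esub> x"
  using x
proof (induction x rule: tensor_induct)
  case (pure a s)
  show ?case
    using y
    by (induction y rule: tensor_induct)
       (use pure in \<open>simp_all add: mult_pure pr mult_add_right mult_smult_right mult_left A.m_comm S.m_comm\<close>)
qed (use y in \<open>simp_all add: mult_left mult_add_right mult_smult_right\<close>)

lemma mult_assoc:
  assumes x: "x \<in> carrier T" and y: "y \<in> carrier T" and z: "z \<in> carrier T"
  shows "(x \<otimes>\<^bsub>Y\<^esub> y) \<otimes>\<^bsub>Y\<^esub> z = x \<otimes>\<^bsub>Y\<^esub> (y \<otimes>\<^bsub>Y\<^esub> z)"
  using x
proof (induction x rule: tensor_induct)
  case a: (pure a s)
  then have [simp]: "pr a s \<in> carrier T" by (simp add: pr)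
  show ?case
    using y
  proof (induction y rule: tensor_induct)
    case b: (pure b t)
    then have [simp]: "pr b t \<in> carrier T" by (simp add: pr)
    show ?case
      using z
    proof (induction z rule: tensor_induct)
      case (pure c w)
      then show ?case using a b by (simp add: mult_pure A.m_assoc S.m_assoc)
    qed (use a b in \<open>simp_all add: mult_add_right mult_smult_right mult_left(1)\<close>)
  qed (use a z in \<open>simp_all add: mult_add_right mult_smult_right mult_left\<close>)
qed (use y z in \<open>simp_all add: mult_left\<close>)

lemma mult_one: "x \<in> carrier T \<Longrightarrow> \<one>\<^bsub>Y\<^esub> \<otimes>\<^bsub>Y\<^esub> x = x"
  by (induction x rule: tensor_induct)
     (simp_all add: one_Y mult_pure mult_add_right mult_smult_right)

lemma algebra_Y: "algebra S Y"
proof (rule algebraI[OF S])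
  show "cring Y"
  proof (rule cringI)
    show "abelian_group Y"
      by (rule abelian_group_cong[of T]) (auto intro: T.M.abelian_group_axioms)
    show "comm_monoid Y"
    proof (rule comm_monoidI)
      show "\<one>\<^bsub>Y\<^esub> \<in> carrier Y"
        by (simp add: one_Y)
      show "x \<otimes>\<^bsub>Y\<^esub> y = y \<otimes>\<^bsub>Y\<^esub> x" if "x \<in> carrier Y" "y \<in> carrier Y" for x y
        using that mult_comm by simp
    qed (simp_all add: mult_left(1) mult_assoc mult_one)
  qed (simp add: mult_left)
qed (use module_X in \<open>simp_all add: module.smult_closed[of S X, simplified] X.smult_l_distr[simplified]
       X.smult_r_distr[simplified] X.smult_assoc1[simplified] X.smult_one[simplified] mult_act_left\<close>)

sublocale Y: algebra S Y by (rule algebra_Y)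

lemma unit_ring_hom: "u \<in> ring_hom A Y"
  by (rule ring_hom_memI) (simp_all add: mult_pure pr one_Y)

text \<open>
  Both sides of \<open>k (x y) = k x * k y\<close> are \<open>S\<close>-bilinear in \<open>x\<close> and \<open>y\<close>, so it suffices that \<open>k\<close> is multiplicative
  on the generators \<open>a \<otimes> 1\<close>, where it agrees with the ring homomorphism \<open>h\<close>.
\<close>

lemma universal_lift_ring_hom:
  assumes B: "algebra S B" and h: "h \<in> ring_hom A B" "h \<in> module_hom R A (restrict_scalars f B)"
  shows "universal_lift f A B h \<in> ring_hom Y B"
proof -
  interpret B: algebra S B by (rule B)
  let ?k = "universal_lift f A B h"
  have unit: "?k (u a) = h a" if "a \<in> carrier A" for a
    by (rule universal_lift_unit[OF B.module h(2) that])
  note k = module_homD[OF universal_lift_hom[OF B.module h(2)], simplified]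
  show ?thesis
  proof (rule ring_hom_memI)
    fix x y assume "x \<in> carrier Y" "y \<in> carrier Y"
    then have x: "x \<in> carrier T" and y: "y \<in> carrier T" by simp_all
    show "?k (x \<otimes>\<^bsub>Y\<^esub> y) = ?k x \<otimes>\<^bsub>B\<^esub> ?k y"
      using x
    proof (induction x rule: ext_induct)
      case (unit a)
      show ?case
        using y
      proof (induction y rule: ext_induct)
        case (unit b)
        have "u a \<otimes>\<^bsub>Y\<^esub> u b = u (a \<otimes>\<^bsub>A\<^esub> b)"
          using unit \<open>a \<in> carrier A\<close> by (simp add: mult_pure)
        then show ?case
          using unit \<open>a \<in> carrier A\<close> by (simp add: \<open>\<And>a. a \<in> carrier A \<Longrightarrow> ?k (u a) = h a\<close> ring_hom_mult[OF h(1)])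
      next
        case (add y z)
        then show ?case
          using \<open>a \<in> carrier A\<close> by (simp add: mult_add_right k mult_left(1) B.r_distr)
      next
        case (smult s y)
        have "u a \<otimes>\<^bsub>Y\<^esub> (s \<odot>\<^bsub>X\<^esub> y) = s \<odot>\<^bsub>X\<^esub> (u a \<otimes>\<^bsub>Y\<^esub> y)"
          using smult \<open>a \<in> carrier A\<close> by (simp add: mult_comm[of "u a"] act mult_act_left)
        moreover have "?k (u a) \<otimes>\<^bsub>B\<^esub> (s \<odot>\<^bsub>B\<^esub> ?k y) = s \<odot>\<^bsub>B\<^esub> (?k (u a) \<otimes>\<^bsub>B\<^esub> ?k y)"
          using smult \<open>a \<in> carrier A\<close> by (simp add: B.m_comm[of "?k (u a)"] k B.smult_assoc2)
        ultimately show ?case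
          using smult \<open>a \<in> carrier A\<close> by (simp add: k mult_left(1))
      qed
    qed (use y in \<open>simp_all add: mult_left k mult_act_left B.l_distr B.smult_assoc2\<close>)
  qed (simp_all add: k one_Y unit ring_hom_one[OF h(1)])
qed

end

section \<open>Base change maps and compositors as universal lifts\<close>

text \<open>
  The map \<open>h \<otimes> S\<close> is defined by \<open>m \<otimes> s \<mapsto> h m \<otimes> s\<close> as an \<open>R\<close>-linear map; since \<open>h m \<otimes> s = s (h m \<otimes> 1)\<close>, it is
  the universal lift of \<open>m \<mapsto> h m \<otimes> 1\<close>. In this form it is \<open>S\<close>-linear, and multiplicative whenever \<open>h\<close>
  is.
\<close>

lemma ext_map_eq:
  assumes inf: "infinite (UNIV :: 'u set)" and f: "f \<in> Arr Cring"
    and M: "module (src f) (src k)" and N: "module (src f) (tgt (k :: 'u mod_arrow))"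
    and k: "fn k \<in> module_hom (src f) (src k) (tgt k)"
  shows "ext_map f k = universal_lift f (src k) (ext_module f (tgt k))
    (\<lambda>m. ext_pure f (tgt k) (fn k m) \<one>\<^bsub>tgt f\<^esub>)"
proof -
  interpret N: extension f "tgt k"
    by (rule extension.intro[OF inf f N])
  show ?thesis
    unfolding ext_map_def universal_lift_def
  proof (rule tensor_lift_cong)
    fix m s assume "m \<in> carrier (src k)" "s \<in> carrier (target_module f)"
    then show "N.pr (fn k m) s = s \<odot>\<^bsub>N.X\<^esub> N.u (fn k m)"
      using module_homD(1)[OF k] by (intro N.pure_eq_act) simp_all
  qed (simp add: N.hom_to_T_iff)
qed

lemma Cmp_Cring:
  "src (g \<cdot>\<^bsub>Cring\<^esub> f) = src f"
  "tgt (g \<cdot>\<^bsub>Cring\<^esub> f) = tgt g"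
  "r \<in> carrier (src f) \<Longrightarrow> fn (g \<cdot>\<^bsub>Cring\<^esub> f) r = fn g (fn f r)"
  by (simp_all add: Cring_def concrete_category_def compose_def)

lemma Cmp_Cring_in_Arr:
  assumes f: "f \<in> Arr Cring" and g: "g \<in> Arr Cring" and gf: "src g = tgt f"
  shows "g \<cdot>\<^bsub>Cring\<^esub> f \<in> Arr Cring"
proof -
  have "fn g \<circ> fn f \<in> ring_hom (src f) (tgt g)"
    using f g gf by (intro ring_hom_trans) (auto simp: Arr_Cring)
  then have "fn (g \<cdot>\<^bsub>Cring\<^esub> f) \<in> ring_hom (src f) (tgt g)"
    using f by (auto simp: ring_hom_def Cmp_Cring Pi_iff Arr_Cring cring.cring_simprules)
  then show ?thesis
    using f g by (simp add: Arr_Cring Cmp_Cring) (simp add: Cring_def concrete_category_def compose_def)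
qed

text \<open>
  The compositor is a two-step universal lift of \<open>m \<mapsto> m \<otimes> 1\<close>, first along \<open>f\<close> and then along \<open>g\<close>: on
  pure tensors, \<open>m \<otimes> g(s) t = t (g(s) (m \<otimes> 1))\<close>.
\<close>

lemma ext_compositor_map_eq:
  assumes inf: "infinite (UNIV :: 'u set)" and f: "f \<in> Arr Cring" and g: "g \<in> Arr Cring"
    and gf: "src g = tgt f" and M: "module (src f) (M :: 'u mod_obj)"
  shows "ext_compositor_map f g M =
    universal_lift g (ext_module f M) (ext_module (g \<cdot>\<^bsub>Cring\<^esub> f) M)
      (universal_lift f M (restrict_scalars g (ext_module (g \<cdot>\<^bsub>Cring\<^esub> f) M))
        (\<lambda>m. ext_pure (g \<cdot>\<^bsub>Cring\<^esub> f) M m \<one>\<^bsub>tgt g\<^esub>))"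
proof -
  let ?gf = "g \<cdot>\<^bsub>Cring\<^esub> f"
  note [simp] = Cmp_Cring gf
  interpret E: extension f M
    by (rule extension.intro[OF inf f M])
  interpret G: extension ?gf M
    by (rule extension.intro[OF inf Cmp_Cring_in_Arr[OF f g gf]]) (use M in simp)
  interpret T: cring "tgt g"
    using g by (simp add: Arr_Cring)
  note G_pr = G.pr[simplified] and G_act = G.act[simplified]
    and G_act_pure = G.act_pure[simplified] and G_smult_T = G.smult_T_eq_act[simplified]
  let ?W = "restrict_scalars g G.X"
  have W: "module (tgt f) ?W"
    using module_restrict_scalars[OF g, of G.X] G.module_X by simp
  let ?u = "\<lambda>m. G.pr m \<one>\<^bsub>tgt g\<^esub>"
  have unit: "?u \<in> module_hom (src f) M (restrict_scalars f ?W)"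
    using module_homD[OF G.unit_hom] by (intro module_homI) simp_all
  let ?H = "universal_lift f M ?W ?u"
  note H = module_homD[OF E.universal_lift_hom[OF W unit], simplified]
  note H_pure = E.lift_raw(2)[OF W unit, simplified]
  have g_hom: "fn g \<in> ring_hom (tgt f) (tgt g)"
    using g by (simp add: Arr_Cring)
  note g_simps = ring_hom_closed[OF g_hom] ring_hom_add[OF g_hom] ring_hom_mult[OF g_hom]
  show ?thesis
    unfolding ext_compositor_map_def Let_def universal_lift_def[of g]
  proof (rule tensor_lift_cong[OF refl])
    fix x t assume x: "x \<in> carrier (ext_module f M)" and t: "t \<in> carrier (target_module g)"
    let ?\<beta> = "\<lambda>m s. G.pr m (fn g s \<otimes>\<^bsub>tgt g\<^esub> t)"
    have "?\<beta> m (fn f r \<otimes>\<^bsub>tgt f\<^esub> s) = r \<odot>\<^bsub>G.T\<^esub> ?\<beta> m s"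
      if "r \<in> carrier (src f)" "m \<in> carrier M" "s \<in> carrier (tgt f)" for r m s
      using that t G_pr(5)[of r m "fn g s \<otimes>\<^bsub>tgt g\<^esub> t"] T.m_assoc[of "fn g (fn f r)" "fn g s" t]
      by (simp add: g_simps)
    then have bil: "bilinear (src f) M (target_module f) G.T ?\<beta>"
      using t T.l_distr by (intro bilinearI) (simp_all add: G_pr g_simps)
    have GT: "module (src f) G.T"
      using G.module_T by simp
    note L = E.lift_pure[OF GT bil]
    have L_hom: "ext_lift f M G.T ?\<beta> \<in> module_hom (src f) E.T G.T"
      using L(1) by simp
    note L' = module_homD[OF L_hom, simplified] L(2)[simplified]
    from x have "x \<in> carrier E.T" by simp
    then show "ext_lift f M G.T ?\<beta> x = t \<odot>\<^bsub>G.X\<^esub> ?H x"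
    proof (induction x rule: E.tensor_induct)
      case (pure m s)
      then show ?case
        using t by (simp add: L' H_pure G_act_pure g_simps T.m_comm)
    next
      case (add x y)
      then show ?case
        using t by (simp add: L' H G_act)
    next
      case (smult r x)
      have "?H (r \<odot>\<^bsub>E.T\<^esub> x) = r \<odot>\<^bsub>G.T\<^esub> ?H x"
        using smult by (simp add: E.smult_T_eq_act H G_smult_T)
      then show ?case
        using t smult by (simp add: L' H G_act)
    qed
  qed
qed

text \<open>
  The compositor is defined through \<open>ext_module\<close> for modules and algebras alike, whereas the universal
  property for algebras speaks of \<open>ext_algebra\<close>. The two records differ only in the multiplicative
  fields, which no module-theoretic construction inspects, not even the choice of a tensor product.
\<close>

definition same_module :: "'u mod_obj \<Rightarrow> 'u mod_obj \<Rightarrow> bool" where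
  "same_module M M' \<longleftrightarrow> carrier M = carrier M' \<and> add M = add M' \<and> smult M = smult M'"

lemma same_module_ext_algebra: "same_module (ext_module f A) (ext_algebra f A)"
  by (simp add: same_module_def)

lemma same_module_refl: "same_module M M"
  by (simp add: same_module_def)

lemma same_module_restrict_scalars:
  "same_module M M' \<Longrightarrow> same_module (restrict_scalars f M) (restrict_scalars f M')"
  by (simp add: same_module_def)

lemma universal_lift_cong:
  assumes M: "same_module M M'" and N: "same_module N N'"
  shows "universal_lift f M N h = universal_lift f M' N' h"
proof -
  have hom: "module_hom R M P = module_hom R M' P" for R P
    using M by (simp add: module_hom_def same_module_def)
  have "is_tensor_product R M L T \<tau> = is_tensor_product R M' L T \<tau>" for R L T \<tau>
    using M by (simp add: is_tensor_product_def bilinear_def hom same_module_def)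
  then have choice: "tensor_choice R M L = tensor_choice R M' L" for R L
    by (simp add: tensor_choice_def)
  have hom': "module_hom R L (restrict_scalars f N) = module_hom R L (restrict_scalars f N')" for R L
    using N by (simp add: module_hom_def same_module_def)
  show ?thesis
    using M N by (simp add: universal_lift_def tensor_lift_def tensor_def pure_def choice hom' same_module_def)
qed

section \<open>Concrete categories\<close>

lemma concrete_category_simps [simp]:
  "Obj (concrete_category Z V H) = Z"
  "Dom (concrete_category Z V H) = src"
  "Cod (concrete_category Z V H) = tgt"
  "Idt (concrete_category Z V H) A = Arrow A A (\<lambda>x\<in>V A. x)"
  by (simp_all add: concrete_category_def)

lemma Arr_concrete_category:
  "p \<in> Arr (concrete_category Z V H) \<longleftrightarrow>
     src p \<in> Z \<and> tgt p \<in> Z \<and> fn p \<in> H (src p) (tgt p) \<and> fn p \<in> extensional (V (src p))"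
  by (cases p) (auto simp: concrete_category_def)

lemma Hom_concrete_category:
  "p \<in> Hom (concrete_category Z V H) A B \<longleftrightarrow>
     src p = A \<and> tgt p = B \<and> A \<in> Z \<and> B \<in> Z \<and> fn p \<in> H A B \<and> fn p \<in> extensional (V A)"
  by (auto simp: Hom_def Arr_concrete_category)

lemma Cmp_concrete_category [simp]:
  "src (q \<cdot>\<^bsub>concrete_category Z V H\<^esub> p) = src p"
  "tgt (q \<cdot>\<^bsub>concrete_category Z V H\<^esub> p) = tgt q"
  "fn (q \<cdot>\<^bsub>concrete_category Z V H\<^esub> p) = compose (V (src p)) (fn q) (fn p)"
  by (simp_all add: concrete_category_def)

lemma arrow_eqI: "\<lbrakk>src p = src q; tgt p = tgt q; fn p = fn q\<rbrakk> \<Longrightarrow> p = q"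
  by (cases p; cases q) simp

lemma Hom_concrete_category_eqI:
  assumes "p \<in> Hom (concrete_category Z V H) A B" "q \<in> Hom (concrete_category Z V H) A B"
    and "\<And>x. x \<in> V A \<Longrightarrow> fn p x = fn q x"
  shows "p = q"
  using assms by (intro arrow_eqI) (auto simp: Hom_concrete_category intro: extensionalityI)

lemma category_concrete_category:
  assumes to_V: "\<And>A B h. h \<in> H A B \<Longrightarrow> h \<in> V A \<rightarrow> V B"
    and id: "\<And>A. A \<in> Z \<Longrightarrow> (\<lambda>x\<in>V A. x) \<in> H A A"
    and comp: "\<And>A B C h k. \<lbrakk>A \<in> Z; B \<in> Z; C \<in> Z; h \<in> H A B; k \<in> H B C\<rbrakk> \<Longrightarrow> compose (V A) k h \<in> H A C"
  shows "category (concrete_category Z V H)"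
proof -
  let ?C = "concrete_category Z V H"
  have Idt: "Idt ?C A \<in> Hom ?C A A" if "A \<in> Z" for A
    using that id by (simp add: Hom_concrete_category)
  have Cmp: "q \<cdot>\<^bsub>?C\<^esub> p \<in> Hom ?C A C" if "p \<in> Hom ?C A B" "q \<in> Hom ?C B C" for p q A B C
    using that comp by (auto simp: Hom_concrete_category)
  have in_V: "fn p x \<in> V B" if "p \<in> Hom ?C A B" "x \<in> V A" for p x A B
    using that to_V by (fastforce simp: Hom_concrete_category)
  have src: "src p = A" if "p \<in> Hom ?C A B" for p A B
    using that by (simp add: Hom_concrete_category)
  show ?thesis
  proof
    show "Dom ?C p \<in> Obj ?C" "Cod ?C p \<in> Obj ?C" if "p \<in> Arr ?C" for p
      using that by (simp_all add: Arr_concrete_category)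
    show "Idt ?C A \<in> Hom ?C A A" if "A \<in> Obj ?C" for A
      using that Idt by simp
    show "q \<cdot>\<^bsub>?C\<^esub> p \<in> Hom ?C A C" if "p \<in> Hom ?C A B" "q \<in> Hom ?C B C" for p q A B C
      using that by (rule Cmp)
    show "Idt ?C B \<cdot>\<^bsub>?C\<^esub> p = p" if p: "p \<in> Hom ?C A B" for p A B
      by (rule Hom_concrete_category_eqI[OF Cmp[OF p Idt] p])
         (use p in_V[OF p] src[OF p] in \<open>auto simp: Hom_concrete_category compose_def\<close>)
    show "p \<cdot>\<^bsub>?C\<^esub> Idt ?C A = p" if p: "p \<in> Hom ?C A B" for p A B
      by (rule Hom_concrete_category_eqI[OF Cmp[OF Idt p] p])
         (use p in_V[OF p] src[OF p] in \<open>auto simp: Hom_concrete_category compose_def\<close>)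
    show "r \<cdot>\<^bsub>?C\<^esub> q \<cdot>\<^bsub>?C\<^esub> p = r \<cdot>\<^bsub>?C\<^esub> (q \<cdot>\<^bsub>?C\<^esub> p)"
      if p: "p \<in> Hom ?C A B" and q: "q \<in> Hom ?C B C" and r: "r \<in> Hom ?C C D" for p q r A B C D
      by (rule Hom_concrete_category_eqI[OF Cmp[OF p Cmp[OF q r]] Cmp[OF Cmp[OF p q] r]])
         (use in_V[OF p] src[OF p] src[OF q] src[OF Cmp[OF p q]] in \<open>simp add: compose_def\<close>)
  qed
qed

lemma compose_ring_hom:
  assumes "cring A" "h \<in> ring_hom A B" "k \<in> ring_hom B C"
  shows "compose (carrier A) k h \<in> ring_hom A C"
proof -
  interpret A: cring A by fact
  show ?thesis
    using assms(2,3) by (intro ring_hom_memI)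
      (simp_all add: compose_def ring_hom_closed ring_hom_mult ring_hom_add ring_hom_one)
qed

lemma category_Cring: "category (Cring :: ('u ring, 'u ring_arrow) category)"
  unfolding Cring_def
proof (rule category_concrete_category)
  fix A :: "'u ring" assume "A \<in> {R. cring R}"
  then interpret A: cring A by simp
  show "(\<lambda>x\<in>carrier A. x) \<in> ring_hom A A"
    by (rule ring_hom_memI) auto
qed (auto simp: compose_ring_hom ring_hom_closed)

section \<open>Pseudofunctors from universal extensions of scalars\<close>

lemma nat_isoI:
  assumes F: "cat_functor C D F" and G: "cat_functor C D G"
    and hom: "\<And>a. a \<in> Obj C \<Longrightarrow> \<tau> a \<in> Hom D (Fo F a) (Fo G a)"
    and nat: "\<And>f a b. f \<in> Hom C a b \<Longrightarrow> Fa G f \<cdot>\<^bsub>D\<^esub> \<tau> a = \<tau> b \<cdot>\<^bsub>D\<^esub> Fa F f"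
    and inv: "\<And>a. a \<in> Obj C \<Longrightarrow> \<exists>q \<in> Hom D (Fo G a) (Fo F a).
      q \<cdot>\<^bsub>D\<^esub> \<tau> a = Idt D (Fo F a) \<and> \<tau> a \<cdot>\<^bsub>D\<^esub> q = Idt D (Fo G a)"
  shows "nat_iso C D F G \<tau>"
proof -
  interpret F: cat_functor C D F by (rule F)
  interpret G: cat_functor C D G by (rule G)
  show ?thesis
  proof
    show "iso_in D (\<tau> a)" if "a \<in> Obj C" for a
      using hom[OF that] inv[OF that] by (simp add: iso_in_def Hom_def)
  qed (use hom nat in auto)
qed

lemma id_fctr_functor: "category C \<Longrightarrow> cat_functor C C id_fctr"
  by (intro cat_functor.intro cat_functor_axioms.intro) (simp_all add: id_fctr_def)

lemma comp_fctr_functor: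
  assumes "cat_functor C D F" "cat_functor D E G"
  shows "cat_functor C E (G \<circ>\<^sub>F F)"
proof -
  interpret F: cat_functor C D F by fact
  interpret G: cat_functor D E G by fact
  show ?thesis
    by unfold_locales
       (auto simp: comp_fctr_def F.Fo_in_Obj G.Fo_in_Obj F.Fa_Idt G.Fa_Idt F.Fa_Cmp
         intro: F.Fa_in_Hom G.Fa_in_Hom G.Fa_Cmp)
qed

lemma Hom_Cring_iff: "f \<in> Hom Cring R S \<longleftrightarrow> f \<in> Arr Cring \<and> src f = R \<and> tgt f = S"
  by (auto simp: Hom_def Cring_def)

text \<open>
  The common shape of modules and algebras: over each ring \<open>R\<close> a concrete category with objects
  \<open>ob R\<close> and maps \<open>hm R\<close>, restriction functors that are functorial in the ring map, and an extension
  functor left adjoint to restriction with unit \<open>ext_unit_map f M : M \<rightarrow> X f M\<close>. The assumptions on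
  \<open>ext_map\<close> and \<open>ext_compositor_map\<close> fix their values on the image of the unit, which by \<open>agree\<close>
  determines them.
  
  In other words, the maps over \<open>f\<close>, from \<open>M\<close> over \<open>R\<close> to \<open>N\<close> over \<open>S\<close>, are those from \<open>M\<close> to the restriction
  of \<open>N\<close> along \<open>f\<close>; they form a category over that of commutative rings, in which \<open>ext_unit_map f M\<close> is an
  opcartesian map. The pseudofunctor is the one that belongs to this choice of opcartesian maps.
\<close>

locale scalar_extension =
  fixes ob :: "'u ring \<Rightarrow> 'u mod_obj set"
    and hm :: "'u ring \<Rightarrow> 'u mod_obj \<Rightarrow> 'u mod_obj \<Rightarrow> ('u \<Rightarrow> 'u) set"
    and X :: "'u extension"
  assumes hm_fun: "h \<in> hm R M N \<Longrightarrow> h \<in> carrier M \<rightarrow> carrier N"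
    and hm_id: "\<lbrakk>cring R; M \<in> ob R\<rbrakk> \<Longrightarrow> (\<lambda>x\<in>carrier M. x) \<in> hm R M M"
    and hm_comp: "\<lbrakk>M \<in> ob R; h \<in> hm R M N; k \<in> hm R N P\<rbrakk> \<Longrightarrow> compose (carrier M) k h \<in> hm R M P"
    and hm_restrict: "\<lbrakk>f \<in> Arr Cring; k \<in> hm (tgt f) N P\<rbrakk>
      \<Longrightarrow> k \<in> hm (src f) (restrict_scalars f N) (restrict_scalars f P)"
    and hm_restrict_Idt: "\<lbrakk>cring R; M \<in> ob R\<rbrakk> \<Longrightarrow> hm R M (restrict_scalars (Idt Cring R) N) = hm R M N"
    and hm_restrict_Cmp: "\<lbrakk>f \<in> Arr Cring; g \<in> Arr Cring; src g = tgt f\<rbrakk> \<Longrightarrow>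
      hm (src f) M (restrict_scalars f (restrict_scalars g P)) = hm (src f) M (restrict_scalars (g \<cdot>\<^bsub>Cring\<^esub> f) P)"
    and X_ob: "\<lbrakk>f \<in> Arr Cring; M \<in> ob (src f)\<rbrakk> \<Longrightarrow> X f M \<in> ob (tgt f)"
    and unit_hm: "\<lbrakk>f \<in> Arr Cring; M \<in> ob (src f)\<rbrakk>
      \<Longrightarrow> ext_unit_map f M \<in> hm (src f) M (restrict_scalars f (X f M))"
    and lift: "\<lbrakk>f \<in> Arr Cring; M \<in> ob (src f); N \<in> ob (tgt f); h \<in> hm (src f) M (restrict_scalars f N)\<rbrakk>
      \<Longrightarrow> \<exists>k \<in> hm (tgt f) (X f M) N \<inter> extensional (carrier (X f M)).
        \<forall>m \<in> carrier M. k (ext_unit_map f M m) = h m"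
    and agree: "\<lbrakk>f \<in> Arr Cring; M \<in> ob (src f); k \<in> hm (tgt f) (X f M) N; k' \<in> hm (tgt f) (X f M) N;
      \<And>m. m \<in> carrier M \<Longrightarrow> k (ext_unit_map f M m) = k' (ext_unit_map f M m); x \<in> carrier (X f M)\<rbrakk>
      \<Longrightarrow> k x = k' x"
    and ext_map: "\<lbrakk>f \<in> Arr Cring; p \<in> Hom (concrete_category (ob (src f)) carrier (hm (src f))) M N\<rbrakk> \<Longrightarrow>
      ext_map f p \<in> hm (tgt f) (X f M) (X f N) \<inter> extensional (carrier (X f M)) \<and>
      (\<forall>m \<in> carrier M. ext_map f p (ext_unit_map f M m) = ext_unit_map f N (fn p m))"
    and ext_compositor: "\<lbrakk>f \<in> Arr Cring; g \<in> Arr Cring; src g = tgt f; M \<in> ob (src f)\<rbrakk> \<Longrightarrow>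
      ext_compositor_map f g M \<in> hm (tgt g) (X g (X f M)) (X (g \<cdot>\<^bsub>Cring\<^esub> f) M)
        \<inter> extensional (carrier (X g (X f M))) \<and>
      (\<forall>m \<in> carrier M. ext_compositor_map f g M (ext_unit_map g (X f M) (ext_unit_map f M m))
        = ext_unit_map (g \<cdot>\<^bsub>Cring\<^esub> f) M m)"
begin

abbreviation "\<upsilon> \<equiv> ext_unit_map"

definition E :: "'u ring \<Rightarrow> ('u mod_obj, 'u mod_arrow) category" where
  "E R = concrete_category (ob R) carrier (hm R)"

abbreviation "psf \<equiv> ext_psfunctor E X"

lemma category_E: "cring R \<Longrightarrow> category (E R)"
  unfolding E_def by (rule category_concrete_category) (auto simp: hm_fun hm_id hm_comp)

lemma E_simps [simp]: "Obj (E R) = ob R" "Idt (E R) M = Arrow M M (\<lambda>x\<in>carrier M. x)"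
  by (simp_all add: E_def)

lemma Hom_E:
  "p \<in> Hom (E R) M N \<longleftrightarrow> src p = M \<and> tgt p = N \<and> M \<in> ob R \<and> N \<in> ob R \<and> fn p \<in> hm R M N \<and>
     fn p \<in> extensional (carrier M)"
  by (simp add: E_def Hom_concrete_category)

lemma fn_Cmp_E:
  "\<lbrakk>p \<in> Hom (E R) M N; x \<in> carrier M\<rbrakk> \<Longrightarrow> fn (q \<cdot>\<^bsub>E R\<^esub> p) x = fn q (fn p x)"
  by (simp add: E_def Hom_concrete_category compose_def)

lemma fn_in_carrier: "\<lbrakk>p \<in> Hom (E R) M N; x \<in> carrier M\<rbrakk> \<Longrightarrow> fn p x \<in> carrier N"
  using hm_fun by (fastforce simp: Hom_E)

lemma unit_closed:
  "\<lbrakk>f \<in> Arr Cring; M \<in> ob (src f); m \<in> carrier M\<rbrakk> \<Longrightarrow> \<upsilon> f M m \<in> carrier (X f M)"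
  using hm_fun[OF unit_hm, of f M] by auto

lemma precompose_unit:
  assumes "f \<in> Arr Cring" "M \<in> ob (src f)" "k \<in> hm (tgt f) (X f M) N"
  shows "compose (carrier M) k (\<upsilon> f M) \<in> hm (src f) M (restrict_scalars f N)"
  using assms by (intro hm_comp[OF _ unit_hm hm_restrict]) auto

text \<open>
  Maps out of an iterated extension are compared by stripping off one extension at a time: composed
  with the outer unit, they become maps over \<open>g\<close> out of the inner extension.
\<close>

lemma agree2:
  assumes f: "f \<in> Arr Cring" "M \<in> ob (src f)" and g: "g \<in> Arr Cring" "src g = tgt f"
    and k: "k \<in> hm (tgt g) (X g (X f M)) N" "k' \<in> hm (tgt g) (X g (X f M)) N"
    and eq: "\<And>m. m \<in> carrier M \<Longrightarrow> k (\<upsilon> g (X f M) (\<upsilon> f M m)) = k' (\<upsilon> g (X f M) (\<upsilon> f M m))"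
    and x: "x \<in> carrier (X g (X f M))"
  shows "k x = k' x"
proof (rule agree[OF g(1) _ k _ x])
  show ob: "X f M \<in> ob (src g)"
    using X_ob[OF f] g by simp
  fix y assume y: "y \<in> carrier (X f M)"
  have "compose (carrier (X f M)) k (\<upsilon> g (X f M)) y = compose (carrier (X f M)) k' (\<upsilon> g (X f M)) y"
    by (rule agree[OF f precompose_unit[OF g(1) ob k(1), unfolded g(2)]
          precompose_unit[OF g(1) ob k(2), unfolded g(2)] _ y])
       (use eq unit_closed[OF f] in \<open>simp add: compose_def\<close>)
  then show "k (\<upsilon> g (X f M) y) = k' (\<upsilon> g (X f M) y)"
    using y by (simp add: compose_def)
qed

lemma agree3:
  assumes f: "f \<in> Arr Cring" "M \<in> ob (src f)" and g: "g \<in> Arr Cring" "src g = tgt f"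
    and h: "h \<in> Arr Cring" "src h = tgt g"
    and k: "k \<in> hm (tgt h) (X h (X g (X f M))) N" "k' \<in> hm (tgt h) (X h (X g (X f M))) N"
    and eq: "\<And>m. m \<in> carrier M \<Longrightarrow> k (\<upsilon> h (X g (X f M)) (\<upsilon> g (X f M) (\<upsilon> f M m)))
      = k' (\<upsilon> h (X g (X f M)) (\<upsilon> g (X f M) (\<upsilon> f M m)))"
    and x: "x \<in> carrier (X h (X g (X f M)))"
  shows "k x = k' x"
proof (rule agree[OF h(1) _ k _ x])
  have ob: "X f M \<in> ob (src g)"
    using X_ob[OF f] g by simp
  then show ob': "X g (X f M) \<in> ob (src h)"
    using X_ob[OF g(1)] h by simp
  fix y assume y: "y \<in> carrier (X g (X f M))"
  let ?L = "X g (X f M)"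
  have "compose (carrier ?L) k (\<upsilon> h ?L) y = compose (carrier ?L) k' (\<upsilon> h ?L) y"
    by (rule agree2[OF f g precompose_unit[OF h(1) ob' k(1), unfolded h(2)]
          precompose_unit[OF h(1) ob' k(2), unfolded h(2)] _ y])
       (use eq unit_closed[OF f] unit_closed[OF g(1) ob] in \<open>simp add: compose_def\<close>)
  then show "k (\<upsilon> h ?L y) = k' (\<upsilon> h ?L y)"
    using y by (simp add: compose_def)
qed

lemma Hom_eqI:
  assumes "f \<in> Arr Cring" "M \<in> ob (src f)" "p \<in> Hom (E (tgt f)) (X f M) N" "q \<in> Hom (E (tgt f)) (X f M) N"
    and "\<And>m. m \<in> carrier M \<Longrightarrow> fn p (\<upsilon> f M m) = fn q (\<upsilon> f M m)"
  shows "p = q"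
  using assms(3,4) unfolding E_def
  by (rule Hom_concrete_category_eqI) (use assms in \<open>auto simp: Hom_E intro: agree\<close>)

lemma Hom_eqI2:
  assumes "f \<in> Arr Cring" "M \<in> ob (src f)" "g \<in> Arr Cring" "src g = tgt f"
    and "p \<in> Hom (E (tgt g)) (X g (X f M)) N" "q \<in> Hom (E (tgt g)) (X g (X f M)) N"
    and "\<And>m. m \<in> carrier M \<Longrightarrow> fn p (\<upsilon> g (X f M) (\<upsilon> f M m)) = fn q (\<upsilon> g (X f M) (\<upsilon> f M m))"
  shows "p = q"
  using assms(5,6) unfolding E_def
  by (rule Hom_concrete_category_eqI) (use assms in \<open>auto simp: Hom_E intro: agree2\<close>)

lemma Hom_eqI3:
  assumes "f \<in> Arr Cring" "M \<in> ob (src f)" "g \<in> Arr Cring" "src g = tgt f" "h \<in> Arr Cring" "src h = tgt g"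
    and "p \<in> Hom (E (tgt h)) (X h (X g (X f M))) N" "q \<in> Hom (E (tgt h)) (X h (X g (X f M))) N"
    and "\<And>m. m \<in> carrier M \<Longrightarrow> fn p (\<upsilon> h (X g (X f M)) (\<upsilon> g (X f M) (\<upsilon> f M m)))
      = fn q (\<upsilon> h (X g (X f M)) (\<upsilon> g (X f M) (\<upsilon> f M m)))"
  shows "p = q"
  using assms(7,8) unfolding E_def
  by (rule Hom_concrete_category_eqI) (use assms in \<open>auto simp: Hom_E intro: agree3\<close>)

lemma lift_Hom:
  assumes "f \<in> Arr Cring" "M \<in> ob (src f)" "N \<in> ob (tgt f)" "h \<in> hm (src f) M (restrict_scalars f N)"
  obtains p where "p \<in> Hom (E (tgt f)) (X f M) N" "\<And>m. m \<in> carrier M \<Longrightarrow> fn p (\<upsilon> f M m) = h m"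
proof -
  obtain k where "k \<in> hm (tgt f) (X f M) N \<inter> extensional (carrier (X f M))"
    "\<forall>m \<in> carrier M. k (\<upsilon> f M m) = h m"
    using lift[OF assms] by blast
  then show thesis
    using that[of "Arrow (X f M) N k"] X_ob assms by (simp add: Hom_E)
qed

lemma psf_simps [simp]:
  "fibre psf = E"
  "Fo (push psf f) = X f"
  by (simp_all add: ext_psfunctor_def ext_fctr_def)

lemma push_Hom:
  assumes "f \<in> Arr Cring" "k \<in> Hom (E (src f)) M N"
  shows "Fa (push psf f) k \<in> Hom (E (tgt f)) (X f M) (X f N)"
    and "m \<in> carrier M \<Longrightarrow> fn (Fa (push psf f) k) (\<upsilon> f M m) = \<upsilon> f N (fn k m)"
  using ext_map[OF assms[unfolded E_def]] assms X_ob
  by (auto simp: Hom_E ext_psfunctor_def ext_fctr_def)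

lemma compositor_Hom:
  assumes "f \<in> Arr Cring" "g \<in> Arr Cring" "src g = tgt f" "M \<in> ob (src f)"
  shows "compositor psf f g M \<in> Hom (E (tgt g)) (X g (X f M)) (X (g \<cdot>\<^bsub>Cring\<^esub> f) M)"
    and "m \<in> carrier M \<Longrightarrow> fn (compositor psf f g M) (\<upsilon> g (X f M) (\<upsilon> f M m)) = \<upsilon> (g \<cdot>\<^bsub>Cring\<^esub> f) M m"
  using ext_compositor[OF assms] X_ob[of f M] X_ob[of g "X f M"] X_ob[OF Cmp_Cring_in_Arr, of f g M] assms
  by (auto simp: Hom_E ext_psfunctor_def Cmp_Cring)

lemma Idt_Cring:
  assumes "cring R"
  shows "Idt Cring R \<in> Arr Cring" "src (Idt Cring R) = R" "tgt (Idt Cring R) = R"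
  using category.Idt_in_Hom[OF category_Cring, of R] assms
  by (simp_all add: Hom_def Cring_def)

lemma unitor_Hom:
  assumes "cring R" "M \<in> ob R"
  shows "unitor psf R M \<in> Hom (E R) M (X (Idt Cring R) M)"
    and "fn (unitor psf R M) = \<upsilon> (Idt Cring R) M"
  using unit_hm[of "Idt Cring R" M] X_ob[of "Idt Cring R" M] assms
  by (auto simp: Hom_E ext_psfunctor_def Idt_Cring hm_restrict_Idt ext_unit_map_def)

text \<open>
  Here and below, an equation of arrows whose source is an extension is reduced to the generators by
  \<open>Hom_eqI\<close>, \<open>Hom_eqI2\<close> or \<open>Hom_eqI3\<close>, according to the number of extensions in the source, and
  holds there by the values of the structure maps on the units.
\<close>

lemma push_functor:
  assumes f: "f \<in> Arr Cring"
  shows "cat_functor (E (src f)) (E (tgt f)) (push psf f)"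
proof -
  have cr: "cring (src f)" "cring (tgt f)"
    using f by (simp_all add: Arr_Cring)
  interpret R: category "E (src f)" by (rule category_E[OF cr(1)])
  interpret S: category "E (tgt f)" by (rule category_E[OF cr(2)])
  show ?thesis
  proof
    fix M assume M: "M \<in> Obj (E (src f))"
    then show "Fo (push psf f) M \<in> Obj (E (tgt f))"
      using X_ob f by simp
    show "Fa (push psf f) (Idt (E (src f)) M) = Idt (E (tgt f)) (Fo (push psf f) M)"
    proof (rule Hom_eqI[OF f])
      show "Fa (push psf f) (Idt (E (src f)) M) \<in> Hom (E (tgt f)) (X f M) (X f M)"
        using push_Hom(1)[OF f R.Idt_in_Hom[OF M]] .
      show "Idt (E (tgt f)) (Fo (push psf f) M) \<in> Hom (E (tgt f)) (X f M) (X f M)"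
        using S.Idt_in_Hom[of "X f M"] X_ob f M by simp
      show "fn (Fa (push psf f) (Idt (E (src f)) M)) (\<upsilon> f M m)
          = fn (Idt (E (tgt f)) (Fo (push psf f) M)) (\<upsilon> f M m)" if "m \<in> carrier M" for m
        using push_Hom(2)[OF f R.Idt_in_Hom[OF M] that] M that unit_closed[OF f] by simp
    qed (use M in simp)
  next
    fix k M N assume "k \<in> Hom (E (src f)) M N"
    then show "Fa (push psf f) k \<in> Hom (E (tgt f)) (Fo (push psf f) M) (Fo (push psf f) N)"
      using push_Hom(1)[OF f] by simp
    fix l P assume k: "k \<in> Hom (E (src f)) M N" and l: "l \<in> Hom (E (src f)) N P"
    show "Fa (push psf f) (l \<cdot>\<^bsub>E (src f)\<^esub> k) = Fa (push psf f) l \<cdot>\<^bsub>E (tgt f)\<^esub> Fa (push psf f) k"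
    proof (rule Hom_eqI[OF f])
      show "Fa (push psf f) (l \<cdot>\<^bsub>E (src f)\<^esub> k) \<in> Hom (E (tgt f)) (X f M) (X f P)"
        by (rule push_Hom(1)[OF f R.Cmp_in_Hom[OF k l]])
      show "Fa (push psf f) l \<cdot>\<^bsub>E (tgt f)\<^esub> Fa (push psf f) k \<in> Hom (E (tgt f)) (X f M) (X f P)"
        by (rule S.Cmp_in_Hom[OF push_Hom(1)[OF f k] push_Hom(1)[OF f l]])
      show M: "M \<in> ob (src f)"
        using k by (simp add: Hom_E)
      show "fn (Fa (push psf f) (l \<cdot>\<^bsub>E (src f)\<^esub> k)) (\<upsilon> f M m)
          = fn (Fa (push psf f) l \<cdot>\<^bsub>E (tgt f)\<^esub> Fa (push psf f) k) (\<upsilon> f M m)" if "m \<in> carrier M" for m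
        using that push_Hom(2)[OF f k] push_Hom(2)[OF f l] push_Hom(2)[OF f R.Cmp_in_Hom[OF k l]]
          fn_Cmp_E[OF k] fn_Cmp_E[OF push_Hom(1)[OF f k]] unit_closed[OF f M] fn_in_carrier[OF k]
        by simp
    qed
  qed
qed

text \<open>
  The inverse \<open>M \<otimes>\<^sub>R T \<rightarrow> (M \<otimes>\<^sub>R S) \<otimes>\<^sub>S T\<close> is the lift of \<open>m \<mapsto> (m \<otimes> 1) \<otimes> 1\<close>.
\<close>

lemma compositor_iso:
  assumes f: "f \<in> Arr Cring" and g: "g \<in> Arr Cring" "src g = tgt f"
  shows "nat_iso (E (src f)) (E (tgt g)) (push psf g \<circ>\<^sub>F push psf f) (push psf (g \<cdot>\<^bsub>Cring\<^esub> f)) (compositor psf f g)"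
proof (rule nat_isoI)
  let ?gf = "g \<cdot>\<^bsub>Cring\<^esub> f"
  have gf: "?gf \<in> Arr Cring"
    by (rule Cmp_Cring_in_Arr[OF f g])
  interpret T: category "E (tgt g)"
    using g by (intro category_E) (simp add: Arr_Cring)
  show "cat_functor (E (src f)) (E (tgt g)) (push psf g \<circ>\<^sub>F push psf f)"
    using comp_fctr_functor[OF push_functor[OF f]] push_functor[OF g(1)] g(2) by simp
  show "cat_functor (E (src f)) (E (tgt g)) (push psf ?gf)"
    using push_functor[OF gf] by (simp add: Cmp_Cring)
  have comp: "compositor psf f g M \<in> Hom (E (tgt g)) (X g (X f M)) (X ?gf M)" if "M \<in> ob (src f)" for M
    using compositor_Hom(1)[OF f g that] .
  then show "compositor psf f g M \<in> Hom (E (tgt g)) (Fo (push psf g \<circ>\<^sub>F push psf f) M) (Fo (push psf ?gf) M)"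
    if "M \<in> Obj (E (src f))" for M
    using that by (simp add: comp_fctr_def)
  show "Fa (push psf ?gf) k \<cdot>\<^bsub>E (tgt g)\<^esub> compositor psf f g M
      = compositor psf f g N \<cdot>\<^bsub>E (tgt g)\<^esub> Fa (push psf g \<circ>\<^sub>F push psf f) k"
    if k: "k \<in> Hom (E (src f)) M N" for k M N
  proof -
    have ob: "M \<in> ob (src f)" "N \<in> ob (src f)" "X f M \<in> ob (src g)"
      using k X_ob[OF f] g by (simp_all add: Hom_E)
    have k': "k \<in> Hom (E (src ?gf)) M N"
      using k by (simp add: Cmp_Cring)
    have fk: "Fa (push psf f) k \<in> Hom (E (src g)) (X f M) (X f N)"
      using push_Hom(1)[OF f k] g by simp
    have gfk: "Fa (push psf ?gf) k \<in> Hom (E (tgt g)) (X ?gf M) (X ?gf N)"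
      using push_Hom(1)[OF gf k'] by (simp add: Cmp_Cring)
    show ?thesis
    proof (rule Hom_eqI2[OF f ob(1) g])
      show "Fa (push psf ?gf) k \<cdot>\<^bsub>E (tgt g)\<^esub> compositor psf f g M
          \<in> Hom (E (tgt g)) (X g (X f M)) (X ?gf N)"
        by (rule T.Cmp_in_Hom[OF comp[OF ob(1)] gfk])
      show "compositor psf f g N \<cdot>\<^bsub>E (tgt g)\<^esub> Fa (push psf g \<circ>\<^sub>F push psf f) k
          \<in> Hom (E (tgt g)) (X g (X f M)) (X ?gf N)"
        using T.Cmp_in_Hom[OF push_Hom(1)[OF g(1) fk] comp[OF ob(2)]] by (simp add: comp_fctr_def)
      fix m assume m: "m \<in> carrier M"
      note u = unit_closed[OF f ob(1) m] unit_closed[OF g(1) ob(3) unit_closed[OF f ob(1) m]]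
      show "fn (Fa (push psf ?gf) k \<cdot>\<^bsub>E (tgt g)\<^esub> compositor psf f g M) (\<upsilon> g (X f M) (\<upsilon> f M m))
          = fn (compositor psf f g N \<cdot>\<^bsub>E (tgt g)\<^esub> Fa (push psf g \<circ>\<^sub>F push psf f) k) (\<upsilon> g (X f M) (\<upsilon> f M m))"
        using m u fn_Cmp_E[OF comp[OF ob(1)]] fn_Cmp_E[OF push_Hom(1)[OF g(1) fk]]
          push_Hom(2)[OF g(1) fk] push_Hom(2)[OF f k] push_Hom(2)[OF gf k'] fn_in_carrier[OF k]
          compositor_Hom(2)[OF f g ob(1)] compositor_Hom(2)[OF f g ob(2)]
        by (simp add: comp_fctr_def)
    qed
  qed
  show "\<exists>q \<in> Hom (E (tgt g)) (Fo (push psf ?gf) M) (Fo (push psf g \<circ>\<^sub>F push psf f) M).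
      q \<cdot>\<^bsub>E (tgt g)\<^esub> compositor psf f g M = Idt (E (tgt g)) (Fo (push psf g \<circ>\<^sub>F push psf f) M) \<and>
      compositor psf f g M \<cdot>\<^bsub>E (tgt g)\<^esub> q = Idt (E (tgt g)) (Fo (push psf ?gf) M)"
    if "M \<in> Obj (E (src f))" for M
  proof -
    have ob: "M \<in> ob (src f)" "X f M \<in> ob (src g)" "X g (X f M) \<in> ob (tgt g)"
      "M \<in> ob (src ?gf)" "X ?gf M \<in> ob (tgt g)"
      using that X_ob[OF f] X_ob[OF g(1), of "X f M"] X_ob[OF gf, of M] g by (simp_all add: Cmp_Cring)
    let ?L = "X g (X f M)"
    have "compose (carrier M) (\<upsilon> g (X f M)) (\<upsilon> f M) \<in> hm (src f) M (restrict_scalars ?gf ?L)"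
      using precompose_unit[OF f ob(1)] unit_hm[OF g(1) ob(2)] g hm_restrict_Cmp[OF f g] by metis
    then obtain q where q: "q \<in> Hom (E (tgt g)) (X ?gf M) ?L"
      and q_unit: "\<And>m. m \<in> carrier M \<Longrightarrow> fn q (\<upsilon> ?gf M m) = \<upsilon> g (X f M) (\<upsilon> f M m)"
      using lift_Hom[OF gf ob(4), of ?L "compose (carrier M) (\<upsilon> g (X f M)) (\<upsilon> f M)"] ob(3)
      by (auto simp: Cmp_Cring compose_def)
    have "q \<cdot>\<^bsub>E (tgt g)\<^esub> compositor psf f g M = Idt (E (tgt g)) ?L"
    proof (rule Hom_eqI2[OF f ob(1) g T.Cmp_in_Hom[OF comp[OF ob(1)] q] T.Idt_in_Hom])
      fix m assume m: "m \<in> carrier M"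
      note u = unit_closed[OF f ob(1) m] unit_closed[OF g(1) ob(2) unit_closed[OF f ob(1) m]]
      show "fn (q \<cdot>\<^bsub>E (tgt g)\<^esub> compositor psf f g M) (\<upsilon> g (X f M) (\<upsilon> f M m))
          = fn (Idt (E (tgt g)) ?L) (\<upsilon> g (X f M) (\<upsilon> f M m))"
        using m u fn_Cmp_E[OF comp[OF ob(1)]] compositor_Hom(2)[OF f g ob(1)] q_unit by simp
    qed (use ob in simp)
    moreover have "compositor psf f g M \<cdot>\<^bsub>E (tgt g)\<^esub> q = Idt (E (tgt g)) (X ?gf M)"
    proof (rule Hom_eqI[OF gf ob(4)])
      show "compositor psf f g M \<cdot>\<^bsub>E (tgt g)\<^esub> q \<in> Hom (E (tgt ?gf)) (X ?gf M) (X ?gf M)"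
        using T.Cmp_in_Hom[OF q comp[OF ob(1)]] by (simp add: Cmp_Cring)
      show "Idt (E (tgt g)) (X ?gf M) \<in> Hom (E (tgt ?gf)) (X ?gf M) (X ?gf M)"
        using T.Idt_in_Hom[of "X ?gf M"] ob by (simp add: Cmp_Cring)
      fix m assume m: "m \<in> carrier M"
      show "fn (compositor psf f g M \<cdot>\<^bsub>E (tgt g)\<^esub> q) (\<upsilon> ?gf M m) = fn (Idt (E (tgt g)) (X ?gf M)) (\<upsilon> ?gf M m)"
        using m unit_closed[OF gf ob(4) m] fn_Cmp_E[OF q] compositor_Hom(2)[OF f g ob(1)] q_unit by simp
    qed
    ultimately show ?thesis
      using q by (auto simp: comp_fctr_def simp del: E_simps)
  qed
qed

text \<open>
  The inverse \<open>M \<otimes>\<^sub>R R \<rightarrow> M\<close> is the lift of the identity of \<open>M\<close>.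
\<close>

lemma unitor_iso:
  assumes R: "cring R"
  shows "nat_iso (E R) (E R) id_fctr (push psf (Idt Cring R)) (unitor psf R)"
proof (rule nat_isoI)
  let ?i = "Idt Cring R"
  note i = Idt_Cring[OF R]
  interpret R: category "E R" by (rule category_E[OF R])
  show "cat_functor (E R) (E R) id_fctr"
    by (rule id_fctr_functor[OF category_E[OF R]])
  show "cat_functor (E R) (E R) (push psf ?i)"
    using push_functor[OF i(1)] i by simp
  show "unitor psf R M \<in> Hom (E R) (Fo id_fctr M) (Fo (push psf ?i) M)" if "M \<in> Obj (E R)" for M
    using unitor_Hom(1)[OF R] that by (simp add: id_fctr_def)
  show "Fa (push psf ?i) k \<cdot>\<^bsub>E R\<^esub> unitor psf R M = unitor psf R N \<cdot>\<^bsub>E R\<^esub> Fa id_fctr k"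
    if k: "k \<in> Hom (E R) M N" for k M N
  proof -
    have ob: "M \<in> ob R" "N \<in> ob R"
      using k by (simp_all add: Hom_E)
    have ik: "Fa (push psf ?i) k \<in> Hom (E R) (X ?i M) (X ?i N)"
      using push_Hom(1)[OF i(1)] k i by simp
    show ?thesis
    proof (rule Hom_concrete_category_eqI)
      show "Fa (push psf ?i) k \<cdot>\<^bsub>E R\<^esub> unitor psf R M \<in> Hom (concrete_category (ob R) carrier (hm R)) M (X ?i N)"
        using R.Cmp_in_Hom[OF unitor_Hom(1)[OF R ob(1)] ik] by (simp add: E_def)
      show "unitor psf R N \<cdot>\<^bsub>E R\<^esub> Fa id_fctr k \<in> Hom (concrete_category (ob R) carrier (hm R)) M (X ?i N)"
        using R.Cmp_in_Hom[OF k unitor_Hom(1)[OF R ob(2)]] by (simp add: E_def id_fctr_def)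
      fix m assume m: "m \<in> carrier M"
      show "fn (Fa (push psf ?i) k \<cdot>\<^bsub>E R\<^esub> unitor psf R M) m = fn (unitor psf R N \<cdot>\<^bsub>E R\<^esub> Fa id_fctr k) m"
        using m fn_Cmp_E[OF unitor_Hom(1)[OF R ob(1)]] fn_Cmp_E[OF k] push_Hom(2)[OF i(1), of k M N] k i
          unitor_Hom(2)[OF R] ob
        by (simp add: id_fctr_def)
    qed
  qed
  show "\<exists>q \<in> Hom (E R) (Fo (push psf ?i) M) (Fo id_fctr M).
      q \<cdot>\<^bsub>E R\<^esub> unitor psf R M = Idt (E R) (Fo id_fctr M) \<and>
      unitor psf R M \<cdot>\<^bsub>E R\<^esub> q = Idt (E R) (Fo (push psf ?i) M)" if "M \<in> Obj (E R)" for M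
  proof -
    have M: "M \<in> ob R" "M \<in> ob (src ?i)" "M \<in> ob (tgt ?i)"
      using that i by simp_all
    obtain q where q: "q \<in> Hom (E R) (X ?i M) M"
      and q_unit: "\<And>m. m \<in> carrier M \<Longrightarrow> fn q (\<upsilon> ?i M m) = m"
      using lift_Hom[OF i(1) M(2,3), of "\<lambda>x\<in>carrier M. x"] hm_id[OF R M(1)] hm_restrict_Idt[OF R M(1)] i by auto
    note un = unitor_Hom[OF R M(1)]
    have "q \<cdot>\<^bsub>E R\<^esub> unitor psf R M = Idt (E R) M"
    proof (rule Hom_concrete_category_eqI)
      show "q \<cdot>\<^bsub>E R\<^esub> unitor psf R M \<in> Hom (concrete_category (ob R) carrier (hm R)) M M"
        using R.Cmp_in_Hom[OF un(1) q] by (simp add: E_def)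
      show "Idt (E R) M \<in> Hom (concrete_category (ob R) carrier (hm R)) M M"
        using R.Idt_in_Hom[of M] M by (simp add: E_def)
      show "fn (q \<cdot>\<^bsub>E R\<^esub> unitor psf R M) m = fn (Idt (E R) M) m" if "m \<in> carrier M" for m
        using that fn_Cmp_E[OF un(1)] un(2) q_unit by simp
    qed
    moreover have "unitor psf R M \<cdot>\<^bsub>E R\<^esub> q = Idt (E R) (X ?i M)"
    proof (rule Hom_eqI[OF i(1) M(2)])
      show "unitor psf R M \<cdot>\<^bsub>E R\<^esub> q \<in> Hom (E (tgt ?i)) (X ?i M) (X ?i M)"
        using R.Cmp_in_Hom[OF q un(1)] i by simp
      show "Idt (E R) (X ?i M) \<in> Hom (E (tgt ?i)) (X ?i M) (X ?i M)"
        using R.Idt_in_Hom[of "X ?i M"] X_ob[OF i(1) M(2)] i by simp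
      show "fn (unitor psf R M \<cdot>\<^bsub>E R\<^esub> q) (\<upsilon> ?i M m) = fn (Idt (E R) (X ?i M)) (\<upsilon> ?i M m)"
        if "m \<in> carrier M" for m
        using that fn_Cmp_E[OF q] un(2) q_unit unit_closed[OF i(1) M(2)] by simp
    qed
    ultimately show ?thesis
      using q by (auto simp: id_fctr_def simp del: E_simps)
  qed
qed

theorem pseudofunctor: "pseudofunctor (Cring :: ('u ring, 'u ring_arrow) category) psf"
proof (intro pseudofunctor.intro category_Cring pseudofunctor_axioms.intro)
  have cr: "cring R" if "R \<in> Obj Cring" for R :: "'u ring"
    using that by (simp add: Cring_def)
  note HC = Hom_Cring_iff
  show "category (fibre psf R)" if "R \<in> Obj Cring" for R
    using category_E[OF cr[OF that]] by simp
  show "cat_functor (fibre psf R) (fibre psf S) (push psf f)" if "f \<in> Hom Cring R S" for f R S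
    using push_functor that by (auto simp: HC)
  show "nat_iso (fibre psf R) (fibre psf T) (push psf g \<circ>\<^sub>F push psf f) (push psf (g \<cdot>\<^bsub>Cring\<^esub> f))
      (compositor psf f g)" if "f \<in> Hom Cring R S" "g \<in> Hom Cring S T" for f g R S T
    using compositor_iso that by (auto simp: HC)
  show "nat_iso (fibre psf R) (fibre psf R) id_fctr (push psf (Idt Cring R)) (unitor psf R)"
    if "R \<in> Obj Cring" for R
    using unitor_iso[OF cr[OF that]] by simp
next
  fix f g h and R S T U :: "'u ring" and M
  assume fgh: "f \<in> Hom Cring R S" "g \<in> Hom Cring S T" "h \<in> Hom Cring T U" and "M \<in> Obj (fibre psf R)"
  then have f: "f \<in> Arr Cring" "M \<in> ob (src f)" and g: "g \<in> Arr Cring" "src g = tgt f"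
    and h: "h \<in> Arr Cring" "src h = tgt g" and [simp]: "tgt h = U"
    by (auto simp: Hom_Cring_iff)
  let ?gf = "g \<cdot>\<^bsub>Cring\<^esub> f" and ?hg = "h \<cdot>\<^bsub>Cring\<^esub> g"
  let ?hgf = "h \<cdot>\<^bsub>Cring\<^esub> ?gf"
  have gf: "?gf \<in> Arr Cring" "M \<in> ob (src ?gf)" "src h = tgt ?gf"
    and hg: "?hg \<in> Arr Cring" "src ?hg = tgt f"
    using Cmp_Cring_in_Arr[OF f(1) g] Cmp_Cring_in_Arr[OF g(1) h] f g h by (simp_all add: Cmp_Cring)
  have assoc: "?hg \<cdot>\<^bsub>Cring\<^esub> f = ?hgf"
    using category.Cmp_assoc[OF category_Cring fgh] .
  interpret U: category "E U"
    using h by (intro category_E) (auto simp: Arr_Cring)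
  have ob: "X f M \<in> ob (src g)" "X g (X f M) \<in> ob (src h)"
    using X_ob[OF f] X_ob[OF g(1), of "X f M"] g h by simp_all
  note c1 = compositor_Hom[OF f(1) g f(2)] compositor_Hom[OF gf(1) h(1) gf(3) gf(2)]
    compositor_Hom[OF f(1) hg f(2), unfolded assoc] compositor_Hom[OF g(1) h ob(1)]
  have cgf: "compositor psf f g M \<in> Hom (E (src h)) (X g (X f M)) (X ?gf M)"
    using c1(1) h by simp
  note p = push_Hom[OF h(1) cgf]
  have c4: "compositor psf g h (X f M) \<in> Hom (E U) (X h (X g (X f M))) (X ?hg (X f M))"
    using c1(7) by simp
  have c3: "compositor psf f ?hg M \<in> Hom (E U) (X ?hg (X f M)) (X ?hgf M)"
    using c1(5) by (simp add: Cmp_Cring)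
  have c2: "compositor psf ?gf h M \<in> Hom (E U) (X h (X ?gf M)) (X ?hgf M)"
    using c1(3) by simp
  have p': "Fa (push psf h) (compositor psf f g M) \<in> Hom (E U) (X h (X g (X f M))) (X h (X ?gf M))"
    using p(1) by simp
  have "compositor psf ?gf h M \<cdot>\<^bsub>E U\<^esub> Fa (push psf h) (compositor psf f g M)
      = compositor psf f ?hg M \<cdot>\<^bsub>E U\<^esub> compositor psf g h (X f M)"
  proof (rule Hom_eqI3[OF f g h])
    show "compositor psf ?gf h M \<cdot>\<^bsub>E U\<^esub> Fa (push psf h) (compositor psf f g M)
        \<in> Hom (E (tgt h)) (X h (X g (X f M))) (X ?hgf M)"
      using U.Cmp_in_Hom[OF p' c2] by simp
    show "compositor psf f ?hg M \<cdot>\<^bsub>E U\<^esub> compositor psf g h (X f M)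
        \<in> Hom (E (tgt h)) (X h (X g (X f M))) (X ?hgf M)"
      using U.Cmp_in_Hom[OF c4 c3] by simp
    fix m assume m: "m \<in> carrier M"
    note u = unit_closed[OF f m]
    note uu = unit_closed[OF g(1) ob(1) u]
    note uuu = unit_closed[OF h(1) ob(2) uu]
    show "fn (compositor psf ?gf h M \<cdot>\<^bsub>E U\<^esub> Fa (push psf h) (compositor psf f g M))
          (\<upsilon> h (X g (X f M)) (\<upsilon> g (X f M) (\<upsilon> f M m)))
        = fn (compositor psf f ?hg M \<cdot>\<^bsub>E U\<^esub> compositor psf g h (X f M))
          (\<upsilon> h (X g (X f M)) (\<upsilon> g (X f M) (\<upsilon> f M m)))"
      using fn_Cmp_E[OF p' uuu] fn_Cmp_E[OF c4 uuu] p(2)[OF uu] c1(2,4,6)[OF m] c1(8)[OF u] by simp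
  qed
  then show "compositor psf ?gf h M \<cdot>\<^bsub>fibre psf U\<^esub> Fa (push psf h) (compositor psf f g M)
      = compositor psf f ?hg M \<cdot>\<^bsub>fibre psf U\<^esub> compositor psf g h (Fo (push psf f) M)"
    by simp
next
  fix f and R S :: "'u ring" and M
  assume fH: "f \<in> Hom Cring R S" and "M \<in> Obj (fibre psf R)"
  then have f: "f \<in> Arr Cring" "M \<in> ob (src f)" and fR: "src f = R" "tgt f = S"
    by (auto simp: Hom_Cring_iff)
  have R: "cring R" "cring S"
    using f fR by (auto simp: Arr_Cring)
  interpret S: category "E S" by (rule category_E[OF R(2)])
  have u: "unitor psf R M \<in> Hom (E (src f)) M (X (Idt Cring R) M)"
    using unitor_Hom(1)[OF R(1)] f fR by simp
  have XM: "X f M \<in> ob S"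
    using X_ob[OF f] fR by simp
  have id: "f \<cdot>\<^bsub>Cring\<^esub> Idt Cring R = f" "Idt Cring S \<cdot>\<^bsub>Cring\<^esub> f = f"
    using category.Cmp_Idt_right[OF category_Cring fH] category.Cmp_Idt_left[OF category_Cring fH] by auto
  note i = Idt_Cring[OF R(1)] and j = Idt_Cring[OF R(2)]
  have "src f = tgt (Idt Cring R)" "M \<in> ob (src (Idt Cring R))"
    using i f fR by simp_all
  note c = compositor_Hom[OF i(1) f(1) this, unfolded id fR]
  have "src (Idt Cring S) = tgt f"
    using j fR by simp
  note d = compositor_Hom[OF f(1) j(1) this f(2), unfolded id j]
  note p = push_Hom[OF f(1) u, unfolded fR]
  have "compositor psf (Idt Cring R) f M \<cdot>\<^bsub>E S\<^esub> Fa (push psf f) (unitor psf R M) = Idt (E S) (X f M)"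
  proof (rule Hom_eqI[OF f])
    show "compositor psf (Idt Cring R) f M \<cdot>\<^bsub>E S\<^esub> Fa (push psf f) (unitor psf R M)
        \<in> Hom (E (tgt f)) (X f M) (X f M)"
      using S.Cmp_in_Hom[OF p(1) c(1)] fR by simp
    show "Idt (E S) (X f M) \<in> Hom (E (tgt f)) (X f M) (X f M)"
      using S.Idt_in_Hom[of "X f M"] XM fR by simp
    fix m assume m: "m \<in> carrier M"
    show "fn (compositor psf (Idt Cring R) f M \<cdot>\<^bsub>E S\<^esub> Fa (push psf f) (unitor psf R M)) (\<upsilon> f M m)
        = fn (Idt (E S) (X f M)) (\<upsilon> f M m)"
      using unit_closed[OF f m] fn_Cmp_E[OF p(1)] p(2)[OF m] c(2)[OF m] unitor_Hom(2)[OF R(1)] f fR by simp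
  qed
  then show "compositor psf (Idt Cring R) f M \<cdot>\<^bsub>fibre psf S\<^esub> Fa (push psf f) (unitor psf R M)
      = Idt (fibre psf S) (Fo (push psf f) M)"
    by simp
  note v = unitor_Hom[OF R(2) XM]
  have "compositor psf f (Idt Cring S) M \<cdot>\<^bsub>E S\<^esub> unitor psf S (X f M) = Idt (E S) (X f M)"
  proof (rule Hom_eqI[OF f])
    show "compositor psf f (Idt Cring S) M \<cdot>\<^bsub>E S\<^esub> unitor psf S (X f M) \<in> Hom (E (tgt f)) (X f M) (X f M)"
      using S.Cmp_in_Hom[OF v(1) d(1)] fR by simp
    show "Idt (E S) (X f M) \<in> Hom (E (tgt f)) (X f M) (X f M)"
      using S.Idt_in_Hom[of "X f M"] XM fR by simp
    fix m assume m: "m \<in> carrier M"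
    show "fn (compositor psf f (Idt Cring S) M \<cdot>\<^bsub>E S\<^esub> unitor psf S (X f M)) (\<upsilon> f M m)
        = fn (Idt (E S) (X f M)) (\<upsilon> f M m)"
      using unit_closed[OF f m] fn_Cmp_E[OF v(1)] v(2) d(2)[OF m] by simp
  qed
  then show "compositor psf f (Idt Cring S) M \<cdot>\<^bsub>fibre psf S\<^esub> unitor psf S (Fo (push psf f) M)
      = Idt (fibre psf S) (Fo (push psf f) M)"
    by simp
qed

end

section \<open>The pseudofunctors of modules and of algebras\<close>

lemma module_hom_id: "module R M \<Longrightarrow> (\<lambda>x\<in>carrier M. x) \<in> module_hom R M M"
  by (rule module_homI) (auto dest: module.axioms(2)
      intro: abelian_monoid.a_closed abelian_group.axioms module.smult_closed)

lemma module_hom_comp: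
  assumes "module R M" "h \<in> module_hom R M N" "k \<in> module_hom R N P"
  shows "compose (carrier M) k h \<in> module_hom R M P"
proof -
  interpret M: module R M by fact
  show ?thesis
    by (rule module_homI) (simp_all add: compose_def module_homD[OF assms(2)] module_homD[OF assms(3)])
qed

lemma module_hom_restrict_scalars:
  assumes "f \<in> Arr Cring" "k \<in> module_hom (tgt f) N P"
  shows "k \<in> module_hom (src f) (restrict_scalars f N) (restrict_scalars f P)"
  using assms by (intro module_homI) (auto simp: module_homD[OF assms(2)] Arr_Cring ring_hom_closed)

lemma module_hom_restrict_scalars_Idt:
  "module_hom R M (restrict_scalars (Idt Cring R) N) = module_hom R M N"
  by (auto simp: module_hom_def Cring_def)

lemma module_hom_restrict_scalars_Cmp:
  "module_hom (src f) M (restrict_scalars f (restrict_scalars g P))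
    = module_hom (src f) M (restrict_scalars (g \<cdot>\<^bsub>Cring\<^esub> f) P)"
  by (auto simp: module_hom_def Cmp_Cring)

lemma ring_hom_restrict_scalars [simp]:
  "ring_hom A (restrict_scalars f B) = ring_hom A B"
  "ring_hom (restrict_scalars f A) B = ring_hom A B"
  by (simp_all add: ring_hom_def)

context extension begin

lemma ext_unit_map_eq: "m \<in> carrier M \<Longrightarrow> ext_unit_map f M m = u m"
  by (simp add: ext_unit_map_def)

lemma ext_unit_map_hom: "ext_unit_map f M \<in> module_hom R M (restrict_scalars f X)"
  using unit_hom M.smult_closed by (auto simp: module_hom_def ext_unit_map_def)

lemma universal_lift_cong_map:
  assumes "\<And>m. m \<in> carrier M \<Longrightarrow> h m = h' m"
  shows "universal_lift f M N h = universal_lift f M N h'"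
  unfolding universal_lift_def by (rule tensor_lift_cong) (simp_all add: assms)

lemma universal_lift_spec:
  assumes "module S N" "h \<in> module_hom R M (restrict_scalars f N)"
  shows "universal_lift f M N h \<in> module_hom S X N \<inter> extensional (carrier X)"
    and "m \<in> carrier M \<Longrightarrow> universal_lift f M N h (ext_unit_map f M m) = h m"
  using universal_lift_hom[OF assms] universal_lift_extensional[OF assms] universal_lift_unit[OF assms]
  by (simp_all add: ext_unit_map_eq)

end

lemma ext_map_eq_lift:
  assumes inf: "infinite (UNIV :: 'u set)" and f: "f \<in> Arr Cring"
    and M: "module (src f) M" and N: "module (src f) (N :: 'u mod_obj)"
    and k: "src k = M" "tgt k = N" "fn k \<in> module_hom (src f) M N"
  shows "ext_map f k = universal_lift f M (ext_module f N) (compose (carrier M) (ext_unit_map f N) (fn k))"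
    and "compose (carrier M) (ext_unit_map f N) (fn k) \<in> module_hom (src f) M (restrict_scalars f (ext_module f N))"
proof -
  interpret M: extension f M by (rule extension.intro[OF inf f M])
  interpret N: extension f N by (rule extension.intro[OF inf f N])
  show "compose (carrier M) (ext_unit_map f N) (fn k) \<in> module_hom (src f) M (restrict_scalars f (ext_module f N))"
    by (rule module_hom_comp[OF M k(3) N.ext_unit_map_hom])
  show "ext_map f k = universal_lift f M (ext_module f N) (compose (carrier M) (ext_unit_map f N) (fn k))"
    unfolding ext_map_eq[OF inf f M[folded k(1)] N[folded k(2)] k(3)[folded k(1,2)]] unfolding k
    by (rule M.universal_lift_cong_map)
       (simp add: compose_def N.ext_unit_map_eq module_homD(1)[OF k(3)])
qed

lemma ext_compositor_map_eq_lift: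
  assumes inf: "infinite (UNIV :: 'u set)" and f: "f \<in> Arr Cring" and g: "g \<in> Arr Cring"
    and gf: "src g = tgt f" and M: "module (src f) (M :: 'u mod_obj)"
  shows "ext_compositor_map f g M =
    universal_lift g (ext_module f M) (ext_module (g \<cdot>\<^bsub>Cring\<^esub> f) M)
      (universal_lift f M (restrict_scalars g (ext_module (g \<cdot>\<^bsub>Cring\<^esub> f) M))
        (ext_unit_map (g \<cdot>\<^bsub>Cring\<^esub> f) M))"
proof -
  interpret M: extension f M by (rule extension.intro[OF inf f M])
  show ?thesis
    unfolding ext_compositor_map_eq[OF assms]
    by (rule arg_cong[where f = "universal_lift g _ _"], rule M.universal_lift_cong_map)
       (simp add: ext_unit_map_def Cmp_Cring)
qed

lemma scalar_extension_modules:
  assumes inf: "infinite (UNIV :: 'u set)"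
  shows "scalar_extension (\<lambda>R. {M :: 'u mod_obj. module R M}) module_hom ext_module"
proof
  fix f g :: "'u ring_arrow" and M N :: "'u mod_obj"
  assume f: "f \<in> Arr Cring" and "M \<in> {M. module (src f) M}"
  then have M: "module (src f) M" by simp
  interpret M: extension f M by (rule extension.intro[OF inf f M])
  show "ext_module f M \<in> {M. module (tgt f) M}"
    using M.module_X by simp
  show "ext_unit_map f M \<in> module_hom (src f) M (restrict_scalars f (ext_module f M))"
    by (rule M.ext_unit_map_hom)
  show "\<exists>k \<in> module_hom (tgt f) (ext_module f M) N \<inter> extensional (carrier (ext_module f M)).
      \<forall>m \<in> carrier M. k (ext_unit_map f M m) = h m"
    if "N \<in> {M. module (tgt f) M}" "h \<in> module_hom (src f) M (restrict_scalars f N)" for h N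
    using M.universal_lift_spec[of N h] that by blast
  show "k x = k' x"
    if "k \<in> module_hom (tgt f) (ext_module f M) N" "k' \<in> module_hom (tgt f) (ext_module f M) N"
      "\<And>m. m \<in> carrier M \<Longrightarrow> k (ext_unit_map f M m) = k' (ext_unit_map f M m)"
      "x \<in> carrier (ext_module f M)" for k k' x N
    using M.ext_hom_eqI[of x k N k'] that by (simp add: M.ext_unit_map_eq)
  assume g: "g \<in> Arr Cring" and gf: "src g = tgt f"
  let ?gf = "g \<cdot>\<^bsub>Cring\<^esub> f"
  have M': "module (src ?gf) M"
    using M by (simp add: Cmp_Cring)
  interpret G: extension ?gf M by (rule extension.intro[OF inf Cmp_Cring_in_Arr[OF f g gf] M'])
  interpret L: extension g "ext_module f M"
    by (rule extension.intro[OF inf g]) (simp add: gf M.module_X)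
  let ?W = "restrict_scalars g (ext_module ?gf M)"
  have G: "module (tgt g) (ext_module ?gf M)"
    using G.module_X by (simp add: Cmp_Cring)
  have W: "module (tgt f) ?W"
    using module_restrict_scalars[OF g G] gf by simp
  have u: "ext_unit_map ?gf M \<in> module_hom (src f) M (restrict_scalars f ?W)"
    using G.ext_unit_map_hom by (simp add: module_hom_restrict_scalars_Cmp Cmp_Cring)
  note 1 = M.universal_lift_spec[OF W u]
  have "universal_lift f M ?W (ext_unit_map ?gf M) \<in> module_hom (src g) (ext_module f M) ?W"
    using 1(1) gf by simp
  note 2 = L.universal_lift_spec[OF G this]
  show "ext_compositor_map f g M \<in> module_hom (tgt g) (ext_module g (ext_module f M)) (ext_module ?gf M)
      \<inter> extensional (carrier (ext_module g (ext_module f M))) \<and>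
    (\<forall>m\<in>carrier M. ext_compositor_map f g M (ext_unit_map g (ext_module f M) (ext_unit_map f M m))
      = ext_unit_map ?gf M m)"
    unfolding ext_compositor_map_eq_lift[OF inf f g gf M]
    using 1(2) 2 M.u_closed by (simp add: M.ext_unit_map_eq)
next
  fix f :: "'u ring_arrow" and p :: "'u mod_arrow" and M N
  assume f: "f \<in> Arr Cring"
    and "p \<in> Hom (concrete_category {M. module (src f) M} carrier (module_hom (src f))) M N"
  then have p: "module (src f) M" "module (src f) N" "src p = M" "tgt p = N" "fn p \<in> module_hom (src f) M N"
    by (auto simp: Hom_concrete_category)
  interpret M: extension f M by (rule extension.intro[OF inf f p(1)])
  interpret N: extension f N by (rule extension.intro[OF inf f p(2)])
  note eq = ext_map_eq_lift[OF inf f p]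
  show "ext_map f p \<in> module_hom (tgt f) (ext_module f M) (ext_module f N)
      \<inter> extensional (carrier (ext_module f M)) \<and>
    (\<forall>m\<in>carrier M. ext_map f p (ext_unit_map f M m) = ext_unit_map f N (fn p m))"
    using M.universal_lift_spec[OF N.module_X eq(2)] unfolding eq(1) by (simp add: compose_def)
qed (auto simp: module_hom_id module_hom_comp module_hom_restrict_scalars
       module_hom_restrict_scalars_Idt module_hom_restrict_scalars_Cmp dest: module_homD(1))

context algebra_extension begin

lemma hom_Y: "module_hom R' Y N = module_hom R' X N" "module_hom R' N' Y = module_hom R' N' X"
  "module_hom R N' (restrict_scalars f Y) = module_hom R N' (restrict_scalars f X)"
  by (simp_all add: module_hom_def)

lemma ext_unit_map_ring_hom: "ext_unit_map f A \<in> ring_hom A Y"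
  using unit_ring_hom by (auto simp: ring_hom_def ext_unit_map_def Pi_iff)

lemma universal_lift_algebra_spec:
  assumes "algebra S B" "h \<in> ring_hom A B" "h \<in> module_hom R A (restrict_scalars f B)"
  shows "universal_lift f A B h \<in> ring_hom Y B \<inter> module_hom S Y B \<inter> extensional (carrier Y)"
    and "m \<in> carrier A \<Longrightarrow> universal_lift f A B h (ext_unit_map f A m) = h m"
  using universal_lift_ring_hom[OF assms] universal_lift_spec[OF algebra.module[OF assms(1)] assms(3)]
  by (simp_all add: hom_Y)

end

text \<open>
  Each map required here is already known as a linear map from the case of modules. It remains to
  see that the universal lifts involved are multiplicative, after the objects \<open>ext_module f A\<close> in
  their definitions have been exchanged for \<open>ext_algebra f A\<close>.
\<close>

lemma scalar_extension_algebras: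
  assumes inf: "infinite (UNIV :: 'u set)"
  shows "scalar_extension (\<lambda>R. {A :: 'u mod_obj. algebra R A}) (\<lambda>R A B. ring_hom A B \<inter> module_hom R A B) ext_algebra"
    (is "scalar_extension ?ob ?hm ext_algebra")
proof
  fix f g :: "'u ring_arrow" and M N :: "'u mod_obj"
  assume f: "f \<in> Arr Cring" and "M \<in> ?ob (src f)"
  then have M: "algebra (src f) M" by simp
  interpret M: algebra_extension f M by (rule algebra_extension.intro[OF inf f M])
  show "ext_algebra f M \<in> ?ob (tgt f)"
    using M.algebra_Y by simp
  show "ext_unit_map f M \<in> ?hm (src f) M (restrict_scalars f (ext_algebra f M))"
    using M.ext_unit_map_hom M.ext_unit_map_ring_hom by (simp add: M.hom_Y)
  show "\<exists>k \<in> ?hm (tgt f) (ext_algebra f M) N \<inter> extensional (carrier (ext_algebra f M)).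
      \<forall>m \<in> carrier M. k (ext_unit_map f M m) = h m"
    if "N \<in> ?ob (tgt f)" "h \<in> ?hm (src f) M (restrict_scalars f N)" for h N
    using M.universal_lift_algebra_spec[of N h] that by auto
  show "k x = k' x"
    if "k \<in> ?hm (tgt f) (ext_algebra f M) N" "k' \<in> ?hm (tgt f) (ext_algebra f M) N"
      "\<And>m. m \<in> carrier M \<Longrightarrow> k (ext_unit_map f M m) = k' (ext_unit_map f M m)"
      "x \<in> carrier (ext_algebra f M)" for k k' x N
    using M.ext_hom_eqI[of x k N k'] that by (simp add: M.ext_unit_map_eq M.hom_Y)
  assume g: "g \<in> Arr Cring" and gf: "src g = tgt f"
  let ?gf = "g \<cdot>\<^bsub>Cring\<^esub> f"
  have M': "algebra (src ?gf) M"
    using M by (simp add: Cmp_Cring)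
  interpret G: algebra_extension ?gf M by (rule algebra_extension.intro[OF inf Cmp_Cring_in_Arr[OF f g gf] M'])
  interpret L: algebra_extension g "ext_algebra f M"
    by (rule algebra_extension.intro[OF inf g]) (simp add: gf M.algebra_Y)
  let ?W = "restrict_scalars g (ext_algebra ?gf M)"
  have G: "algebra (tgt g) (ext_algebra ?gf M)"
    using G.algebra_Y by (simp add: Cmp_Cring)
  have W: "algebra (tgt f) ?W"
    using algebra_restrict_scalars[OF g G] gf by simp
  have u: "ext_unit_map ?gf M \<in> ring_hom M ?W" "ext_unit_map ?gf M \<in> module_hom (src f) M (restrict_scalars f ?W)"
    unfolding module_hom_restrict_scalars_Cmp
    using G.ext_unit_map_hom[folded G.hom_Y(3)] G.ext_unit_map_ring_hom by (simp_all add: Cmp_Cring(1))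
  note 1 = M.universal_lift_algebra_spec[OF W u]
  have "universal_lift f M ?W (ext_unit_map ?gf M) \<in> ring_hom (ext_algebra f M) (ext_algebra ?gf M)"
    "universal_lift f M ?W (ext_unit_map ?gf M) \<in> module_hom (src g) (ext_algebra f M) ?W"
    using 1(1) gf by simp_all
  note 2 = L.universal_lift_algebra_spec[OF G this]
  have same: "same_module (ext_module h L) (ext_algebra h L)" for h and L :: "'u mod_obj"
    by (rule same_module_ext_algebra)
  have eq: "ext_compositor_map f g M =
      universal_lift g (ext_algebra f M) (ext_algebra ?gf M) (universal_lift f M ?W (ext_unit_map ?gf M))"
    unfolding ext_compositor_map_eq_lift[OF inf f g gf algebra.module[OF M]]
      universal_lift_cong[OF same_module_refl same_module_restrict_scalars[OF same]]
      universal_lift_cong[OF same same] ..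
  show "ext_compositor_map f g M \<in> ?hm (tgt g) (ext_algebra g (ext_algebra f M)) (ext_algebra ?gf M)
      \<inter> extensional (carrier (ext_algebra g (ext_algebra f M))) \<and>
    (\<forall>m\<in>carrier M. ext_compositor_map f g M (ext_unit_map g (ext_algebra f M) (ext_unit_map f M m))
      = ext_unit_map ?gf M m)"
    unfolding eq using 1(2) 2 M.u_closed by (simp add: M.ext_unit_map_eq)
next
  fix f :: "'u ring_arrow" and p :: "'u mod_arrow" and M N
  assume f: "f \<in> Arr Cring"
    and "p \<in> Hom (concrete_category (?ob (src f)) carrier (?hm (src f))) M N"
  then have p: "algebra (src f) M" "algebra (src f) N" "src p = M" "tgt p = N"
    "fn p \<in> module_hom (src f) M N" "fn p \<in> ring_hom M N"
    by (auto simp: Hom_concrete_category)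
  interpret M: algebra_extension f M by (rule algebra_extension.intro[OF inf f p(1)])
  interpret N: algebra_extension f N by (rule algebra_extension.intro[OF inf f p(2)])
  note eq = ext_map_eq_lift[OF inf f p(1,2)[THEN algebra.module] p(3-5)]
  have eq': "ext_map f p = universal_lift f M (ext_algebra f N) (compose (carrier M) (ext_unit_map f N) (fn p))"
    unfolding eq(1) by (rule universal_lift_cong[OF same_module_refl same_module_ext_algebra])
  have hom: "compose (carrier M) (ext_unit_map f N) (fn p) \<in> ring_hom M (ext_algebra f N)"
    by (rule compose_ring_hom[OF M.A.M_cring p(6) N.ext_unit_map_ring_hom])
  show "ext_map f p \<in> ?hm (tgt f) (ext_algebra f M) (ext_algebra f N)
      \<inter> extensional (carrier (ext_algebra f M)) \<and>
    (\<forall>m\<in>carrier M. ext_map f p (ext_unit_map f M m) = ext_unit_map f N (fn p m))"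
    using M.universal_lift_algebra_spec[OF N.algebra_Y hom eq(2)[folded N.hom_Y(3)]]
    unfolding eq' by (simp add: compose_def)
next
  fix R and M :: "'u mod_obj" assume "cring R" "M \<in> ?ob R"
  then interpret M: algebra R M by simp
  show "(\<lambda>x\<in>carrier M. x) \<in> ?hm R M M"
    using M.module by (auto simp: module_hom_id intro!: ring_hom_memI)
next
  fix R h k and M N P :: "'u mod_obj" assume "M \<in> ?ob R" "h \<in> ?hm R M N" "k \<in> ?hm R N P"
  then show "compose (carrier M) k h \<in> ?hm R M P"
    by (auto intro: module_hom_comp compose_ring_hom algebra.module algebra.M_cring)
qed (auto simp: module_hom_restrict_scalars
       module_hom_restrict_scalars_Idt module_hom_restrict_scalars_Cmp dest: module_homD(1))

section \<open>Free commutative algebras and left adjoints\<close>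

lemma Hom_RMod:
  "p \<in> Hom (RMod R) M N \<longleftrightarrow> src p = M \<and> tgt p = N \<and> module R M \<and> module R N \<and>
     fn p \<in> module_hom R M N \<and> fn p \<in> extensional (carrier M)"
  by (simp add: RMod_def Hom_concrete_category)

lemma Hom_CAlg:
  "p \<in> Hom (CAlg R) A B \<longleftrightarrow> src p = A \<and> tgt p = B \<and> algebra R A \<and> algebra R B \<and>
     fn p \<in> ring_hom A B \<and> fn p \<in> module_hom R A B \<and> fn p \<in> extensional (carrier A)"
  by (auto simp: CAlg_def Hom_concrete_category)

text \<open>
  The models are all algebras \<open>B\<close> with a linear map \<open>M \<rightarrow> B\<close>, and multiplicative terms are admitted.
  Linearity of the universal map holds because it holds after evaluation in every model.
\<close>

lemma free_algebra_exists:
  fixes R :: "'u ring" and M :: "'u mod_obj"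
  assumes inf: "infinite (UNIV :: 'u set)" and M: "module R M"
  shows "\<exists>(A :: 'u mod_obj) \<eta>. algebra R A \<and> \<eta> \<in> module_hom R M A \<and>
    (\<forall>(B :: 'u mod_obj) h. algebra R B \<and> h \<in> module_hom R M B \<longrightarrow>
      (\<exists>!k. k \<in> ring_hom A B \<inter> module_hom R A B \<inter> extensional (carrier A) \<and>
        (\<forall>m \<in> carrier M. k (\<eta> m) = h m)))"
proof -
  interpret M: module R M by (rule M)
  obtain code :: "('u, 'u) expr \<Rightarrow> 'u" where code: "inj code"
    by (rule expr_encoding[OF inf inj_on_id[of UNIV, unfolded id_def]])
  define K where "K = {(B, h) | (B :: 'u mod_obj) h. algebra R B \<and> h \<in> module_hom R M B}"
  interpret Q: presentation R "wf_expr True (carrier R) (carrier M)" K code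
  proof (rule presentation.intro; (rule code M.R.is_cring)?)
    fix A e g assume "(A, e) \<in> K" "wf_expr True (carrier R) (carrier M) (Gen g)"
    then show "e g \<in> carrier A"
      by (auto simp: K_def module_hom_def)
  qed (auto simp: K_def intro: algebra.module)
  let ?\<eta> = "\<lambda>m. Q.rep (Gen m)"
  have A: "algebra R Q.quot"
    by (rule Q.algebra_quot) simp
  have \<eta>: "?\<eta> \<in> module_hom R M Q.quot"
  proof (rule module_homI)
    have K: "h \<in> module_hom R M B" if "(B, h) \<in> K" for B h
      using that by (simp add: K_def)
    show "?\<eta> m \<in> carrier Q.quot" if "m \<in> carrier M" for m
      using that by simp
    show "?\<eta> (m \<oplus>\<^bsub>M\<^esub> n) = ?\<eta> m \<oplus>\<^bsub>Q.quot\<^esub> ?\<eta> n" if "m \<in> carrier M" "n \<in> carrier M" for m n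
      by (rule Q.quot_eqI) (use that in \<open>auto intro: module_homD(2)[OF K]\<close>)
    show "?\<eta> (r \<odot>\<^bsub>M\<^esub> m) = r \<odot>\<^bsub>Q.quot\<^esub> ?\<eta> m" if "r \<in> carrier R" "m \<in> carrier M" for r m
      by (rule Q.quot_eqI) (use that in \<open>auto intro: module_homD(3)[OF K]\<close>)
  qed
  have univ: "\<exists>!k. k \<in> ring_hom Q.quot B \<inter> module_hom R Q.quot B \<inter> extensional (carrier Q.quot) \<and>
      (\<forall>m \<in> carrier M. k (?\<eta> m) = h m)" if B: "algebra R B" and h: "h \<in> module_hom R M B" for B :: "'u mod_obj" and h
  proof (rule ex_ex1I)
    have K: "(B, h) \<in> K"
      using B h by (simp add: K_def)
    interpret Q': algebra R Q.quot by (rule A)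
    let ?k = "restrict (Q.ev B h) (carrier Q.quot)"
    have "?k \<in> ring_hom Q.quot B"
      by (rule ring_hom_memI) (simp_all add: K)
    moreover have "?k \<in> module_hom R Q.quot B"
      by (rule module_homI) (simp_all add: K)
    moreover have "?k (?\<eta> m) = h m" if "m \<in> carrier M" for m
      using that by (simp add: K)
    ultimately show "\<exists>k. k \<in> ring_hom Q.quot B \<inter> module_hom R Q.quot B \<inter> extensional (carrier Q.quot) \<and>
      (\<forall>m \<in> carrier M. k (?\<eta> m) = h m)"
      by (intro exI[of _ ?k]) simp
  next
    fix k k'
    assume k: "k \<in> ring_hom Q.quot B \<inter> module_hom R Q.quot B \<inter> extensional (carrier Q.quot) \<and>
        (\<forall>m \<in> carrier M. k (?\<eta> m) = h m)"
      and k': "k' \<in> ring_hom Q.quot B \<inter> module_hom R Q.quot B \<inter> extensional (carrier Q.quot) \<and>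
        (\<forall>m \<in> carrier M. k' (?\<eta> m) = h m)"
    note hom = module_homD[of k R Q.quot B] module_homD[of k' R Q.quot B]
      ring_hom_mult[of k Q.quot B] ring_hom_mult[of k' Q.quot B]
      ring_hom_one[of k Q.quot B] ring_hom_one[of k' Q.quot B]
      module_hom_zero[OF Q.module_quot algebra.module[OF B], of k]
      module_hom_zero[OF Q.module_quot algebra.module[OF B], of k']
    show "k = k'"
    proof (rule extensionalityI)
      fix x assume "x \<in> carrier Q.quot"
      then show "k x = k' x"
      proof (induction x rule: Q.quot_induct)
        case (gen m)
        then show ?case using k k' by simp
      qed (use k k' in \<open>simp_all add: hom\<close>)
    qed (use k k' in auto)
  qed
  show ?thesis
    by (rule exI[of _ Q.quot], rule exI[of _ ?\<eta>]) (use A \<eta> univ in blast)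
qed

text \<open>
  Universal arrows chosen separately for each object assemble into a left adjoint, its action on an
  arrow \<open>k : a \<rightarrow> b\<close> being forced by naturality of the unit: it is the arrow that carries \<open>\<eta> a\<close> to
  \<open>\<eta> b \<cdot> k\<close>.
\<close>

lemma left_adjoint_from_universal_arrows:
  assumes C: "category C" and D: "category D" and U: "cat_functor D C U"
    and univ: "\<And>c. c \<in> Obj C \<Longrightarrow> \<exists>d \<eta>. d \<in> Obj D \<and> \<eta> \<in> Hom C c (Fo U d) \<and>
      (\<forall>d' \<in> Obj D. \<forall>h \<in> Hom C c (Fo U d'). \<exists>!k. k \<in> Hom D d d' \<and> Fa U k \<cdot>\<^bsub>C\<^esub> \<eta> = h)"
  shows "\<exists>F \<eta>. left_adjoint C D F U \<eta>"
proof -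
  interpret C: category C by (rule C)
  interpret D: category D by (rule D)
  interpret U: cat_functor D C U by (rule U)
  obtain d \<eta> where d: "\<And>c. c \<in> Obj C \<Longrightarrow> d c \<in> Obj D"
    and \<eta>: "\<And>c. c \<in> Obj C \<Longrightarrow> \<eta> c \<in> Hom C c (Fo U (d c))"
    and ex1: "\<And>c d' h. \<lbrakk>c \<in> Obj C; d' \<in> Obj D; h \<in> Hom C c (Fo U d')\<rbrakk>
      \<Longrightarrow> \<exists>!k. k \<in> Hom D (d c) d' \<and> Fa U k \<cdot>\<^bsub>C\<^esub> \<eta> c = h"
    using univ by metis
  define map where "map k = (THE l. l \<in> Hom D (d (Dom C k)) (d (Cod C k)) \<and>
    Fa U l \<cdot>\<^bsub>C\<^esub> \<eta> (Dom C k) = \<eta> (Cod C k) \<cdot>\<^bsub>C\<^esub> k)" for k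
  have ob: "a \<in> Obj C" "b \<in> Obj C" if "k \<in> Hom C a b" for k a b
    using that C.Dom_in_Obj C.Cod_in_Obj by (auto simp: Hom_def)
  have map: "map k \<in> Hom D (d a) (d b)" "Fa U (map k) \<cdot>\<^bsub>C\<^esub> \<eta> a = \<eta> b \<cdot>\<^bsub>C\<^esub> k"
    if k: "k \<in> Hom C a b" for k a b
  proof -
    have "Dom C k = a" "Cod C k = b"
      using k by (auto simp: Hom_def)
    then show "map k \<in> Hom D (d a) (d b)" "Fa U (map k) \<cdot>\<^bsub>C\<^esub> \<eta> a = \<eta> b \<cdot>\<^bsub>C\<^esub> k"
      using theI'[OF ex1[OF ob(1)[OF k] d[OF ob(2)[OF k]] C.Cmp_in_Hom[OF k \<eta>[OF ob(2)[OF k]]]]]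
      by (simp_all add: map_def)
  qed
  have uniq: "l = l'"
    if "c \<in> Obj C" "d' \<in> Obj D" "l \<in> Hom D (d c) d'" "l' \<in> Hom D (d c) d'"
      "Fa U l \<cdot>\<^bsub>C\<^esub> \<eta> c = Fa U l' \<cdot>\<^bsub>C\<^esub> \<eta> c" for c d' l l'
    using ex1[OF that(1,2) C.Cmp_in_Hom[OF \<eta>[OF that(1)] U.Fa_in_Hom[OF that(4)]]] that by blast
  let ?F = "\<lparr>Fo = d, Fa = map\<rparr>"
  have F: "cat_functor C D ?F"
  proof (intro cat_functor.intro cat_functor_axioms.intro C D)
    show "Fo ?F a \<in> Obj D" if "a \<in> Obj C" for a
      using d that by simp
    show "Fa ?F k \<in> Hom D (Fo ?F a) (Fo ?F b)" if "k \<in> Hom C a b" for k a b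
      using map(1)[OF that] by simp
    show "Fa ?F (Idt C a) = Idt D (Fo ?F a)" if a: "a \<in> Obj C" for a
    proof -
      note i = C.Idt_in_Hom[OF a]
      have "Fa U (map (Idt C a)) \<cdot>\<^bsub>C\<^esub> \<eta> a = Fa U (Idt D (d a)) \<cdot>\<^bsub>C\<^esub> \<eta> a"
        using map(2)[OF i] U.Fa_Idt[OF d[OF a]] C.Cmp_Idt_left[OF \<eta>[OF a]] C.Cmp_Idt_right[OF \<eta>[OF a]] by simp
      then show ?thesis
        using uniq[OF a d[OF a] map(1)[OF i] D.Idt_in_Hom[OF d[OF a]]] by simp
    qed
    show "Fa ?F (l \<cdot>\<^bsub>C\<^esub> k) = Fa ?F l \<cdot>\<^bsub>D\<^esub> Fa ?F k"
      if k: "k \<in> Hom C a b" and l: "l \<in> Hom C b c" for k l a b c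
    proof -
      note a = ob(1)[OF k] and b = ob(2)[OF k] and c = ob(2)[OF l]
      note lk = C.Cmp_in_Hom[OF k l] and mlk = D.Cmp_in_Hom[OF map(1)[OF k] map(1)[OF l]]
      note Uk = U.Fa_in_Hom[OF map(1)[OF k]] and Ul = U.Fa_in_Hom[OF map(1)[OF l]]
      have "Fa U (map l \<cdot>\<^bsub>D\<^esub> map k) \<cdot>\<^bsub>C\<^esub> \<eta> a = Fa U (map l) \<cdot>\<^bsub>C\<^esub> (Fa U (map k) \<cdot>\<^bsub>C\<^esub> \<eta> a)"
        by (simp add: U.Fa_Cmp[OF map(1)[OF k] map(1)[OF l]] C.Cmp_assoc[OF \<eta>[OF a] Uk Ul])
      also have "\<dots> = (Fa U (map l) \<cdot>\<^bsub>C\<^esub> \<eta> b) \<cdot>\<^bsub>C\<^esub> k"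
        by (simp add: map(2)[OF k] C.Cmp_assoc[OF k \<eta>[OF b] Ul])
      also have "\<dots> = \<eta> c \<cdot>\<^bsub>C\<^esub> (l \<cdot>\<^bsub>C\<^esub> k)"
        by (simp add: map(2)[OF l] C.Cmp_assoc[OF k l \<eta>[OF c]])
      finally show ?thesis
        using uniq[OF a d[OF c] map(1)[OF lk] mlk] map(2)[OF lk] by simp
    qed
  qed
  have "nat_trans C C id_fctr (U \<circ>\<^sub>F ?F) \<eta>"
    by (intro nat_trans.intro nat_trans_axioms.intro id_fctr_functor[OF C] comp_fctr_functor[OF F U])
       (auto simp: id_fctr_def comp_fctr_def \<eta> map)
  then have "left_adjoint C D ?F U \<eta>"
    by (intro left_adjoint.intro left_adjoint_axioms.intro F U) (simp_all add: ex1)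
  then show ?thesis by blast
qed

section \<open>The symmetric algebra and its compatibility with base change\<close>

lemma CAlg_RMod: "p \<in> Hom (CAlg R) A B \<Longrightarrow> p \<in> Hom (RMod R) A B"
  by (simp add: Hom_RMod Hom_CAlg algebra.module)

lemma RMod_eqI:
  "\<lbrakk>p \<in> Hom (RMod R) M N; q \<in> Hom (RMod R) M N; \<And>m. m \<in> carrier M \<Longrightarrow> fn p m = fn q m\<rbrakk> \<Longrightarrow> p = q"
  unfolding RMod_def by (rule Hom_concrete_category_eqI)

lemma Und_functor:
  assumes "category (RMod R)" "category (CAlg R)"
  shows "cat_functor (CAlg R) (RMod R) Und"
proof (intro cat_functor.intro cat_functor_axioms.intro assms)
  show "Fo Und A \<in> Obj (RMod R)" if "A \<in> Obj (CAlg R)" for A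
    using that by (simp add: Und_def RMod_def CAlg_def algebra.module)
  show "Fa Und k \<in> Hom (RMod R) (Fo Und A) (Fo Und B)" if "k \<in> Hom (CAlg R) A B" for k A B
    using that by (simp add: Und_def Hom_RMod Hom_CAlg algebra.module)
qed (simp_all add: Und_def RMod_def CAlg_def concrete_category_def)

context
  assumes inf: "infinite (UNIV :: 'u set)"
begin

interpretation Mo: scalar_extension "\<lambda>R. {M :: 'u mod_obj. module R M}" module_hom ext_module
  rewrites "scalar_extension.E (\<lambda>R. {M :: 'u mod_obj. module R M}) module_hom = RMod"
proof -
  show "scalar_extension (\<lambda>R. {M :: 'u mod_obj. module R M}) module_hom ext_module"
    by (rule scalar_extension_modules[OF inf])
  then show "scalar_extension.E (\<lambda>R. {M :: 'u mod_obj. module R M}) module_hom = RMod"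
    by (intro ext) (simp add: scalar_extension.E_def RMod_def)
qed

interpretation Al: scalar_extension "\<lambda>R. {A :: 'u mod_obj. algebra R A}"
    "\<lambda>R A B. ring_hom A B \<inter> module_hom R A B" ext_algebra
  rewrites "scalar_extension.E (\<lambda>R. {A :: 'u mod_obj. algebra R A})
    (\<lambda>R A B. ring_hom A B \<inter> module_hom R A B) = CAlg"
proof -
  show "scalar_extension (\<lambda>R. {A :: 'u mod_obj. algebra R A})
      (\<lambda>R A B. ring_hom A B \<inter> module_hom R A B) ext_algebra"
    by (rule scalar_extension_algebras[OF inf])
  then show "scalar_extension.E (\<lambda>R. {A :: 'u mod_obj. algebra R A})
      (\<lambda>R A B. ring_hom A B \<inter> module_hom R A B) = CAlg"
    by (intro ext) (simp add: scalar_extension.E_def CAlg_def)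
qed

text \<open>
  \<open>Sym\<close> is a choice among the left adjoints of \<open>Und\<close>, so only the existence of one is at stake.
\<close>

lemma Sym_left_adjoint:
  assumes R: "cring (R :: 'u ring)"
  shows "left_adjoint (RMod R) (CAlg R) (Sym R) Und (Sym_unit R)"
proof -
  have "\<exists>F \<eta>. left_adjoint (RMod R) (CAlg R) F (Und :: 'u mod_fctr) \<eta>"
  proof (rule left_adjoint_from_universal_arrows)
    show cat: "category (RMod R)" "category (CAlg R)"
      using R by (rule Mo.category_E, rule Al.category_E)
    then show "cat_functor (CAlg R) (RMod R) Und"
      by (rule Und_functor)
    fix M assume "M \<in> Obj (RMod R)"
    then have M: "module R M" by simp
    obtain A :: "'u mod_obj" and \<eta> where A: "algebra R A" and \<eta>: "\<eta> \<in> module_hom R M A"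
      and univ: "\<forall>(B :: 'u mod_obj) h. algebra R B \<and> h \<in> module_hom R M B \<longrightarrow>
        (\<exists>!k. k \<in> ring_hom A B \<inter> module_hom R A B \<inter> extensional (carrier A) \<and>
          (\<forall>m \<in> carrier M. k (\<eta> m) = h m))"
      using free_algebra_exists[OF inf M] by (elim exE conjE) (rule that)
    interpret M: module R M by (rule M)
    let ?\<eta> = "Arrow M A (restrict \<eta> (carrier M))"
    have \<eta>': "?\<eta> \<in> Hom (RMod R) M A"
      using M A \<eta> by (auto simp: Hom_RMod module_hom_def intro: algebra.module)
    have Cmp: "k \<cdot>\<^bsub>RMod R\<^esub> ?\<eta> = h \<longleftrightarrow> (\<forall>m \<in> carrier M. fn k (\<eta> m) = fn h m)"
      if k: "k \<in> Hom (CAlg R) A B" and h: "h \<in> Hom (RMod R) M B" for k h B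
    proof
      have fn: "fn (k \<cdot>\<^bsub>RMod R\<^esub> ?\<eta>) m = fn k (\<eta> m)" if "m \<in> carrier M" for m
        using Mo.fn_Cmp_E[OF \<eta>' that] that by simp
      show "\<forall>m \<in> carrier M. fn k (\<eta> m) = fn h m" if "k \<cdot>\<^bsub>RMod R\<^esub> ?\<eta> = h"
        using fn that by auto
      show "k \<cdot>\<^bsub>RMod R\<^esub> ?\<eta> = h" if "\<forall>m \<in> carrier M. fn k (\<eta> m) = fn h m"
        by (rule RMod_eqI[OF category.Cmp_in_Hom[OF cat(1) \<eta>' CAlg_RMod] h])
           (use k fn that in auto)
    qed
    have ex1: "\<exists>!k. k \<in> Hom (CAlg R) A B \<and> k \<cdot>\<^bsub>RMod R\<^esub> ?\<eta> = h"
      if B: "algebra R B" and h: "h \<in> Hom (RMod R) M B" for B h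
    proof -
      have h': "fn h \<in> module_hom R M B"
        using h by (simp add: Hom_RMod)
      obtain k where k: "k \<in> ring_hom A B \<inter> module_hom R A B \<inter> extensional (carrier A)"
          "\<forall>m \<in> carrier M. k (\<eta> m) = fn h m"
        and k_uniq: "\<forall>k'. k' \<in> ring_hom A B \<inter> module_hom R A B \<inter> extensional (carrier A) \<and>
          (\<forall>m \<in> carrier M. k' (\<eta> m) = fn h m) \<longrightarrow> k' = k"
        using univ[rule_format, OF conjI[OF B h']] by (elim ex1E conjE) (rule that)
      have K: "Arrow A B k \<in> Hom (CAlg R) A B"
        using A B k by (simp add: Hom_CAlg)
      show ?thesis
      proof (rule ex1I[of _ "Arrow A B k"])
        show "Arrow A B k \<in> Hom (CAlg R) A B \<and> Arrow A B k \<cdot>\<^bsub>RMod R\<^esub> ?\<eta> = h"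
          using K Cmp[OF K h] k by simp
        fix l assume "l \<in> Hom (CAlg R) A B \<and> l \<cdot>\<^bsub>RMod R\<^esub> ?\<eta> = h"
        then have l: "l \<in> Hom (CAlg R) A B" and "\<forall>m \<in> carrier M. fn l (\<eta> m) = fn h m"
          using Cmp[of l B h] h by auto
        then have "fn l = k"
          by (intro k_uniq[rule_format] conjI) (simp_all add: Hom_CAlg)
        then show "l = Arrow A B k"
          using l by (intro arrow_eqI) (simp_all add: Hom_CAlg)
      qed
    qed
    show "\<exists>A \<eta>. A \<in> Obj (CAlg R) \<and> \<eta> \<in> Hom (RMod R) M (Fo Und A) \<and>
        (\<forall>B \<in> Obj (CAlg R). \<forall>h \<in> Hom (RMod R) M (Fo Und B).
          \<exists>!k. k \<in> Hom (CAlg R) A B \<and> Fa Und k \<cdot>\<^bsub>RMod R\<^esub> \<eta> = h)"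
      unfolding Und_def fctr.simps
      by (rule exI[of _ A], rule exI[of _ ?\<eta>], intro conjI ballI) (use A \<eta>' ex1 in simp_all)
  qed
  then obtain F and \<eta> :: "'u mod_obj \<Rightarrow> 'u mod_arrow"
    where "left_adjoint (RMod R) (CAlg R) F Und \<eta>"
    by (elim exE)
  then have "case Sym_choice R of (F, \<eta>) \<Rightarrow> left_adjoint (RMod R) (CAlg R) F Und \<eta>"
    unfolding Sym_choice_def
    by (intro someI[of "\<lambda>(F, \<eta>). left_adjoint (RMod R) (CAlg R) F Und \<eta>" "(F, \<eta>)"]) simp
  then show ?thesis
    by (simp add: Sym_def Sym_unit_def split_beta)
qed

abbreviation SymAlg :: "'u ring \<Rightarrow> 'u mod_obj \<Rightarrow> 'u mod_obj" where
  "SymAlg R M \<equiv> Fo (Sym R) M"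

abbreviation \<eta> :: "'u ring \<Rightarrow> 'u mod_obj \<Rightarrow> 'u \<Rightarrow> 'u" where
  "\<eta> R M \<equiv> fn (Sym_unit R M)"

abbreviation \<upsilon> :: "'u ring_arrow \<Rightarrow> 'u mod_obj \<Rightarrow> 'u \<Rightarrow> 'u" where
  "\<upsilon> \<equiv> ext_unit_map"

lemma Sym_functor: "cring (R :: 'u ring) \<Longrightarrow> cat_functor (RMod R) (CAlg R) (Sym R)"
  using Sym_left_adjoint by (rule left_adjoint.axioms(1))

lemma Sym_algebra: "module R M \<Longrightarrow> algebra R (SymAlg R M)"
  using cat_functor.Fo_in_Obj[OF Sym_functor, of R M] by (simp add: module.axioms)

lemma Sym_unit_Hom:
  assumes "module R M"
  shows "Sym_unit R M \<in> Hom (RMod R) M (SymAlg R M)"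
proof -
  have R: "cring R" using assms by (rule module.axioms)
  interpret left_adjoint "RMod R" "CAlg R" "Sym R" Und "Sym_unit R"
    by (rule Sym_left_adjoint[OF R])
  show ?thesis
    using unit.component_in_Hom[of M] assms by (simp add: id_fctr_def comp_fctr_def Und_def)
qed

lemma Sym_unit_closed: "\<lbrakk>module R M; m \<in> carrier M\<rbrakk> \<Longrightarrow> \<eta> R M m \<in> carrier (SymAlg R M)"
  using Mo.fn_in_carrier[OF Sym_unit_Hom] .

lemma fn_Cmp_Sym_unit:
  "\<lbrakk>module R M; m \<in> carrier M\<rbrakk> \<Longrightarrow> fn (k \<cdot>\<^bsub>RMod R\<^esub> Sym_unit R M) m = fn k (\<eta> R M m)"
  by (rule Mo.fn_Cmp_E[OF Sym_unit_Hom])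

lemma Sym_lift:
  assumes M: "module R M" and A: "algebra R A" and h: "h \<in> Hom (RMod R) M A"
  obtains p where "p \<in> Hom (CAlg R) (SymAlg R M) A" "\<And>m. m \<in> carrier M \<Longrightarrow> fn p (\<eta> R M m) = fn h m"
proof -
  have R: "cring R" using M by (rule module.axioms)
  have "\<exists>!k. k \<in> Hom (CAlg R) (SymAlg R M) A \<and> Fa Und k \<cdot>\<^bsub>RMod R\<^esub> Sym_unit R M = h"
    by (rule left_adjoint.universal[OF Sym_left_adjoint[OF R]]) (use M A h in \<open>simp_all add: Und_def\<close>)
  then obtain k where "k \<in> Hom (CAlg R) (SymAlg R M) A" "Fa Und k \<cdot>\<^bsub>RMod R\<^esub> Sym_unit R M = h"
    by blast
  then show thesis
    using that fn_Cmp_Sym_unit[OF M, of _ k] by (auto simp: Und_def)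
qed

lemma Sym_eqI:
  assumes M: "module R M" and p: "p \<in> Hom (CAlg R) (SymAlg R M) A" and q: "q \<in> Hom (CAlg R) (SymAlg R M) A"
    and eq: "\<And>m. m \<in> carrier M \<Longrightarrow> fn p (\<eta> R M m) = fn q (\<eta> R M m)"
  shows "p = q"
proof -
  have R: "cring R" using M by (rule module.axioms)
  interpret RM: category "RMod R" by (rule Mo.category_E[OF R])
  note Cmp = RM.Cmp_in_Hom[OF Sym_unit_Hom[OF M] CAlg_RMod]
  have "p \<cdot>\<^bsub>RMod R\<^esub> Sym_unit R M = q \<cdot>\<^bsub>RMod R\<^esub> Sym_unit R M"
    by (rule RMod_eqI[OF Cmp[OF p] Cmp[OF q]]) (simp add: fn_Cmp_Sym_unit[OF M] eq)
  moreover have "\<exists>!k. k \<in> Hom (CAlg R) (SymAlg R M) A \<and> Fa Und k \<cdot>\<^bsub>RMod R\<^esub> Sym_unit R M = q \<cdot>\<^bsub>RMod R\<^esub> Sym_unit R M"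
    by (rule left_adjoint.universal[OF Sym_left_adjoint[OF R]])
       (use M p Cmp[OF q] in \<open>simp_all add: Und_def Hom_CAlg\<close>)
  ultimately show ?thesis
    using p q by (auto simp: Und_def)
qed

lemma Sym_map:
  assumes k: "k \<in> Hom (RMod R) M N"
  shows "Fa (Sym R) k \<in> Hom (CAlg R) (SymAlg R M) (SymAlg R N)"
    and "m \<in> carrier M \<Longrightarrow> fn (Fa (Sym R) k) (\<eta> R M m) = \<eta> R N (fn k m)"
proof -
  have M: "module R M" using k by (simp add: Hom_RMod)
  then have R: "cring R" by (rule module.axioms)
  interpret left_adjoint "RMod R" "CAlg R" "Sym R" Und "Sym_unit R"
    by (rule Sym_left_adjoint[OF R])
  show "Fa (Sym R) k \<in> Hom (CAlg R) (SymAlg R M) (SymAlg R N)"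
    by (rule F.Fa_in_Hom[OF k])
  show "fn (Fa (Sym R) k) (\<eta> R M m) = \<eta> R N (fn k m)" if "m \<in> carrier M"
    using arg_cong[OF unit.naturality[OF k], of "\<lambda>p. fn p m"] that
      fn_Cmp_Sym_unit[OF M that] Mo.fn_Cmp_E[OF k that]
    by (simp add: id_fctr_def comp_fctr_def Und_def)
qed

lemma Al_ob:
  assumes "f \<in> Arr Cring" "module (src f) M"
  shows "SymAlg (src f) M \<in> {A. algebra (src f) A}" "algebra (tgt f) (ext_algebra f (SymAlg (src f) M))"
  using Sym_algebra[OF assms(2)] Al.X_ob[OF assms(1), of "SymAlg (src f) M"] by simp_all

lemma precompose_unit_Hom:
  assumes f: "f \<in> Arr Cring" and A: "algebra (src f) A" and p: "p \<in> Hom (CAlg (tgt f)) (ext_algebra f A) B"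
  shows "Arrow A (restrict_scalars f B) (compose (carrier A) (fn p) (\<upsilon> f A))
    \<in> Hom (CAlg (src f)) A (restrict_scalars f B)"
  using Al.precompose_unit[OF f, of A "fn p" B] p A algebra_restrict_scalars[OF f, of B]
  by (simp add: Hom_CAlg)

text \<open>
  The elements \<open>\<eta> m \<otimes> 1\<close> generate \<open>Sym\<^sub>R M \<otimes>\<^sub>R S\<close> as an \<open>S\<close>-algebra: restricted along \<open>a \<mapsto> a \<otimes> 1\<close>, two maps
  become \<open>R\<close>-algebra maps out of \<open>Sym\<^sub>R M\<close>, and these are determined by the elements \<open>\<eta> m\<close>.
\<close>

lemma ext_Sym_eqI:
  assumes f: "f \<in> Arr Cring" and M: "module (src f) M"
    and p: "p \<in> Hom (CAlg (tgt f)) (ext_algebra f (SymAlg (src f) M)) A"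
    and q: "q \<in> Hom (CAlg (tgt f)) (ext_algebra f (SymAlg (src f) M)) A"
    and eq: "\<And>m. m \<in> carrier M \<Longrightarrow> fn p (\<upsilon> f (SymAlg (src f) M) (\<eta> (src f) M m))
      = fn q (\<upsilon> f (SymAlg (src f) M) (\<eta> (src f) M m))"
  shows "p = q"
proof (rule Al.Hom_eqI[OF f Al_ob(1)[OF f M] p q])
  note A = Sym_algebra[OF M]
  fix a assume a: "a \<in> carrier (SymAlg (src f) M)"
  have "Arrow (SymAlg (src f) M) (restrict_scalars f A) (compose (carrier (SymAlg (src f) M)) (fn p) (\<upsilon> f (SymAlg (src f) M)))
    = Arrow (SymAlg (src f) M) (restrict_scalars f A) (compose (carrier (SymAlg (src f) M)) (fn q) (\<upsilon> f (SymAlg (src f) M)))"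
    by (rule Sym_eqI[OF M precompose_unit_Hom[OF f A p] precompose_unit_Hom[OF f A q]])
       (simp add: compose_def Sym_unit_closed[OF M] eq)
  then have "compose (carrier (SymAlg (src f) M)) (fn p) (\<upsilon> f (SymAlg (src f) M)) a
      = compose (carrier (SymAlg (src f) M)) (fn q) (\<upsilon> f (SymAlg (src f) M)) a"
    by simp
  then show "fn p (\<upsilon> f (SymAlg (src f) M) a) = fn q (\<upsilon> f (SymAlg (src f) M) a)"
    using a by (simp add: compose_def)
qed

lemma ext_ext_Sym_eqI:
  assumes f: "f \<in> Arr Cring" and g: "g \<in> Arr Cring" "src g = tgt f" and M: "module (src f) M"
    and p: "p \<in> Hom (CAlg (tgt g)) (ext_algebra g (ext_algebra f (SymAlg (src f) M))) A"
    and q: "q \<in> Hom (CAlg (tgt g)) (ext_algebra g (ext_algebra f (SymAlg (src f) M))) A"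
    and eq: "\<And>m. m \<in> carrier M \<Longrightarrow>
      fn p (\<upsilon> g (ext_algebra f (SymAlg (src f) M)) (\<upsilon> f (SymAlg (src f) M) (\<eta> (src f) M m)))
      = fn q (\<upsilon> g (ext_algebra f (SymAlg (src f) M)) (\<upsilon> f (SymAlg (src f) M) (\<eta> (src f) M m)))"
  shows "p = q"
proof -
  let ?L = "ext_algebra f (SymAlg (src f) M)"
  have L: "algebra (src g) ?L"
    using Al_ob(2)[OF f M] g by simp
  show ?thesis
  proof (rule Al.Hom_eqI[OF g(1) _ p q])
    show "?L \<in> {A. algebra (src g) A}"
      using L by simp
    fix a assume a: "a \<in> carrier ?L"
    have "Arrow ?L (restrict_scalars g A) (compose (carrier ?L) (fn p) (\<upsilon> g ?L))
      = Arrow ?L (restrict_scalars g A) (compose (carrier ?L) (fn q) (\<upsilon> g ?L))"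
      by (rule ext_Sym_eqI[OF f M precompose_unit_Hom[OF g(1) L p, unfolded g(2)]
            precompose_unit_Hom[OF g(1) L q, unfolded g(2)]])
         (use eq Al.unit_closed[OF f Al_ob(1)[OF f M] Sym_unit_closed[OF M]] in \<open>simp add: compose_def\<close>)
    then have "compose (carrier ?L) (fn p) (\<upsilon> g ?L) a = compose (carrier ?L) (fn q) (\<upsilon> g ?L) a"
      by simp
    then show "fn p (\<upsilon> g ?L a) = fn q (\<upsilon> g ?L a)"
      using a by (simp add: compose_def)
  qed
qed

text \<open>
  The existence half of the composite adjunction: extend \<open>h\<close> first over \<open>Sym\<^sub>R M\<close>, with values in the
  restriction of \<open>A\<close>, and then over the extension of scalars.
\<close>

lemma ext_Sym_lift:
  assumes f: "f \<in> Arr Cring" and M: "module (src f) M" and A: "algebra (tgt f) A"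
    and h: "h \<in> Hom (RMod (src f)) M (restrict_scalars f A)"
  obtains p where "p \<in> Hom (CAlg (tgt f)) (ext_algebra f (SymAlg (src f) M)) A"
    "\<And>m. m \<in> carrier M \<Longrightarrow> fn p (\<upsilon> f (SymAlg (src f) M) (\<eta> (src f) M m)) = fn h m"
proof -
  obtain q where q: "q \<in> Hom (CAlg (src f)) (SymAlg (src f) M) (restrict_scalars f A)"
    "\<And>m. m \<in> carrier M \<Longrightarrow> fn q (\<eta> (src f) M m) = fn h m"
    using Sym_lift[OF M algebra_restrict_scalars[OF f A] h] by blast
  obtain p where "p \<in> Hom (CAlg (tgt f)) (ext_algebra f (SymAlg (src f) M)) A"
    "\<And>a. a \<in> carrier (SymAlg (src f) M) \<Longrightarrow> fn p (\<upsilon> f (SymAlg (src f) M) a) = fn q a"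
    using Al.lift_Hom[OF f Al_ob(1)[OF f M], of A "fn q"] A q(1) by (auto simp: Hom_CAlg)
  then show thesis
    using that q(2) Sym_unit_closed[OF M] by auto
qed

lemma Res_Hom:
  assumes f: "f \<in> Arr Cring" and k: "k \<in> Hom (RMod (tgt f)) N P"
  shows "Fa (Res f) k \<in> Hom (RMod (src f)) (restrict_scalars f N) (restrict_scalars f P)"
    and "fn (Fa (Res f) k) = fn k"
  using k module_restrict_scalars[OF f] module_hom_restrict_scalars[OF f]
  by (auto simp: Res_def Hom_RMod)

lemma ext_unit_Hom:
  assumes f: "(f :: 'u ring_arrow) \<in> Arr Cring"
  shows "module (src f) M \<Longrightarrow> ext_unit ext_module f M \<in> Hom (RMod (src f)) M (restrict_scalars f (ext_module f M))"
    and "algebra (src f) A \<Longrightarrow> ext_unit ext_algebra f A \<in> Hom (RMod (src f)) A (restrict_scalars f (ext_algebra f A))"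
  using Mo.unit_hm[OF f, of M] Mo.X_ob[OF f, of M] Al.unit_hm[OF f, of A] Al.X_ob[OF f, of A]
    module_restrict_scalars[OF f]
  by (auto simp: ext_unit_def Hom_RMod ext_unit_map_def intro: algebra.module)

text \<open>
  The comparison of left adjoints is defined as the arrow that carries one unit to the other. Its
  defining equation between arrows of \<open>R\<close>-modules says elementwise that \<open>\<eta> m \<otimes> 1\<close> goes to \<open>\<eta> (m \<otimes> 1)\<close>, and
  by the preceding lemmas there is exactly one such algebra map.
\<close>

lemma Sym_iso:
  assumes f: "f \<in> Arr Cring" and M: "module (src f) M"
  shows Sym_iso_Hom: "Sym_iso f M \<in> Hom (CAlg (tgt f)) (ext_algebra f (SymAlg (src f) M)) (SymAlg (tgt f) (ext_module f M))"
    and Sym_iso_unit: "m \<in> carrier M \<Longrightarrow> fn (Sym_iso f M) (\<upsilon> f (SymAlg (src f) M) (\<eta> (src f) M m))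
      = \<eta> (tgt f) (ext_module f M) (\<upsilon> f M m)"
proof -
  let ?R = "src f" and ?S = "tgt f"
  let ?A = "ext_algebra f (SymAlg ?R M)" and ?B = "SymAlg ?S (ext_module f M)"
  let ?l = "comp_unit (RMod ?R) Und (Sym ?R) (Sym_unit ?R) (ext_unit ext_algebra f) M"
  let ?r = "comp_unit (RMod ?R) (Res f) (ext_fctr ext_module f) (ext_unit ext_module f) (Sym_unit ?S) M"
  have R: "cring ?R" using M by (rule module.axioms)
  interpret RM: category "RMod ?R" by (rule Mo.category_E[OF R])
  have XM: "module ?S (ext_module f M)"
    using Mo.X_ob[OF f, of M] M by simp
  have B: "algebra ?S ?B"
    by (rule Sym_algebra[OF XM])
  note uA = ext_unit_Hom(2)[OF f Sym_algebra[OF M]] and uM = ext_unit_Hom(1)[OF f M]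
  have l: "?l \<in> Hom (RMod ?R) M (restrict_scalars f ?A)"
    using RM.Cmp_in_Hom[OF Sym_unit_Hom[OF M] uA] by (simp add: comp_unit_def Und_def)
  have l_fn: "fn ?l m = \<upsilon> f (SymAlg ?R M) (\<eta> ?R M m)" if "m \<in> carrier M" for m
    using that by (simp add: comp_unit_def fn_Cmp_Sym_unit[OF M] Und_def ext_unit_def)
  note uS = Res_Hom[OF f Sym_unit_Hom[OF XM]]
  have r: "?r \<in> Hom (RMod ?R) M (restrict_scalars f ?B)"
    using RM.Cmp_in_Hom[OF uM uS(1)] by (simp add: comp_unit_def ext_fctr_def)
  have r_fn: "fn ?r m = \<eta> ?S (ext_module f M) (\<upsilon> f M m)" if "m \<in> carrier M" for m
    using that Mo.fn_Cmp_E[OF uM that] uS(2) by (simp add: comp_unit_def ext_fctr_def ext_unit_def)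
  have eq: "Fa (Res f \<circ>\<^sub>F Und) k \<cdot>\<^bsub>RMod ?R\<^esub> ?l = ?r \<longleftrightarrow>
      (\<forall>m \<in> carrier M. fn k (\<upsilon> f (SymAlg ?R M) (\<eta> ?R M m)) = \<eta> ?S (ext_module f M) (\<upsilon> f M m))"
    (is "?lhs \<longleftrightarrow> ?rhs") if k: "k \<in> Hom (CAlg ?S) ?A ?B" for k
  proof -
    note Rk = Res_Hom[OF f CAlg_RMod[OF k]]
    have Rk_l: "Fa (Res f) k \<cdot>\<^bsub>RMod ?R\<^esub> ?l \<in> Hom (RMod ?R) M (restrict_scalars f ?B)"
      by (rule RM.Cmp_in_Hom[OF l Rk(1)])
    have fn: "fn (Fa (Res f) k \<cdot>\<^bsub>RMod ?R\<^esub> ?l) m = fn k (\<upsilon> f (SymAlg ?R M) (\<eta> ?R M m))" if "m \<in> carrier M" for m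
      using Mo.fn_Cmp_E[OF l that] l_fn[OF that] Rk(2) by simp
    have "Fa (Res f) k \<cdot>\<^bsub>RMod ?R\<^esub> ?l = ?r \<longleftrightarrow> ?rhs"
    proof
      assume "Fa (Res f) k \<cdot>\<^bsub>RMod ?R\<^esub> ?l = ?r"
      then show ?rhs
        using fn r_fn by metis
    next
      assume ?rhs
      then show "Fa (Res f) k \<cdot>\<^bsub>RMod ?R\<^esub> ?l = ?r"
        by (intro RMod_eqI[OF Rk_l r]) (simp add: fn r_fn)
    qed
    then show ?thesis
      by (simp add: comp_fctr_def Und_def)
  qed
  let ?P = "\<lambda>k. k \<in> Hom (CAlg ?S) ?A ?B \<and> Fa (Res f \<circ>\<^sub>F Und) k \<cdot>\<^bsub>RMod ?R\<^esub> ?l = ?r"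
  have "\<exists>!k. ?P k"
  proof (rule ex_ex1I)
    obtain p where p: "p \<in> Hom (CAlg ?S) ?A ?B"
      "\<And>m. m \<in> carrier M \<Longrightarrow> fn p (\<upsilon> f (SymAlg ?R M) (\<eta> ?R M m)) = fn ?r m"
      using ext_Sym_lift[OF f M B r] by blast
    have "Fa (Res f \<circ>\<^sub>F Und) p \<cdot>\<^bsub>RMod ?R\<^esub> ?l = ?r"
      unfolding eq[OF p(1)] using p(2) r_fn by simp
    then show "\<exists>k. ?P k"
      by (intro exI[of _ p] conjI p(1))
    fix k k' assume k: "?P k" and k': "?P k'"
    then show "k = k'"
      using eq[of k] eq[of k'] by (intro ext_Sym_eqI[OF f M, of k _ k']) auto
  qed
  moreover have "Sym_iso f M = (THE k. ?P k)"
    by (simp add: Sym_iso_def Let_def left_adjoint_comparison_def comp_fctr_def ext_fctr_def)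
  ultimately have P: "?P (Sym_iso f M)"
    using theI'[of ?P] by simp
  then show "Sym_iso f M \<in> Hom (CAlg ?S) ?A ?B" ..
  show "fn (Sym_iso f M) (\<upsilon> f (SymAlg ?R M) (\<eta> ?R M m)) = \<eta> ?S (ext_module f M) (\<upsilon> f M m)"
    if "m \<in> carrier M"
    using P eq[of "Sym_iso f M"] that by blast
qed

text \<open>
  In the naturality square for \<open>k : M \<rightarrow> N\<close> both composites send \<open>\<eta> m \<otimes> 1\<close> to \<open>\<eta> (k m \<otimes> 1)\<close>. The inverse is
  built from the opposite chain of universal properties: \<open>m \<mapsto> \<eta> m \<otimes> 1\<close> extends to an \<open>S\<close>-linear map
  \<open>M \<otimes>\<^sub>R S \<rightarrow> Sym\<^sub>R M \<otimes>\<^sub>R S\<close>, and this to an algebra map on \<open>Sym\<^sub>S (M \<otimes>\<^sub>R S)\<close>.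
\<close>

lemma Sym_iso_nat_iso:
  assumes f: "(f :: 'u ring_arrow) \<in> Arr Cring"
  shows "nat_iso (RMod (src f)) (CAlg (tgt f)) (push CAlg_psfunctor f \<circ>\<^sub>F Sym (src f))
    (Sym (tgt f) \<circ>\<^sub>F push RMod_psfunctor f) (Sym_iso f)"
  unfolding CAlg_psfunctor_def RMod_psfunctor_def
proof (rule nat_isoI)
  let ?R = "src f" and ?S = "tgt f"
  let ?P = "ext_psfunctor RMod ext_module :: ('u ring, 'u ring_arrow, 'u mod_obj, 'u mod_arrow) psfunctor"
  let ?Q = "ext_psfunctor CAlg ext_algebra :: ('u ring, 'u ring_arrow, 'u mod_obj, 'u mod_arrow) psfunctor"
  let ?F = "push ?Q f \<circ>\<^sub>F Sym ?R" and ?G = "Sym ?S \<circ>\<^sub>F push ?P f"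
  have R: "cring ?R" and S: "cring ?S"
    using f by (simp_all add: Arr_Cring)
  interpret CS: category "CAlg ?S" by (rule Al.category_E[OF S])
  interpret RS: category "RMod ?S" by (rule Mo.category_E[OF S])
  show "cat_functor (RMod ?R) (CAlg ?S) ?F"
    by (rule comp_fctr_functor[OF Sym_functor[OF R] Al.push_functor[OF f]])
  show "cat_functor (RMod ?R) (CAlg ?S) ?G"
    by (rule comp_fctr_functor[OF Mo.push_functor[OF f] Sym_functor[OF S]])
  show "Sym_iso f M \<in> Hom (CAlg ?S) (Fo ?F M) (Fo ?G M)" if "M \<in> Obj (RMod ?R)" for M
    using Sym_iso_Hom[OF f, of M] that by (simp add: comp_fctr_def)
  show "Fa ?G k \<cdot>\<^bsub>CAlg ?S\<^esub> Sym_iso f M = Sym_iso f N \<cdot>\<^bsub>CAlg ?S\<^esub> Fa ?F k"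
    if k: "k \<in> Hom (RMod ?R) M N" for k M N
  proof -
    have M: "module ?R M" and N: "module ?R N"
      using k by (simp_all add: Hom_RMod)
    note Pk = Mo.push_Hom[OF f k] and Qk = Al.push_Hom[OF f Sym_map(1)[OF k]]
    note GHom = Sym_map(1)[OF Pk(1)]
    note 1 = CS.Cmp_in_Hom[OF Sym_iso_Hom[OF f M] GHom]
      and 2 = CS.Cmp_in_Hom[OF Qk(1) Sym_iso_Hom[OF f N]]
    have "Fa (Sym ?S) (Fa (push ?P f) k) \<cdot>\<^bsub>CAlg ?S\<^esub> Sym_iso f M
        = Sym_iso f N \<cdot>\<^bsub>CAlg ?S\<^esub> Fa (push ?Q f) (Fa (Sym ?R) k)"
    proof (rule ext_Sym_eqI[OF f M 1 2])
      fix m assume m: "m \<in> carrier M"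
      note \<eta>m = Sym_unit_closed[OF M m]
      note u = Al.unit_closed[OF f Al_ob(1)[OF f M] \<eta>m] and um = Mo.unit_closed[OF f _ m]
      show "fn (Fa (Sym ?S) (Fa (push ?P f) k) \<cdot>\<^bsub>CAlg ?S\<^esub> Sym_iso f M) (\<upsilon> f (SymAlg ?R M) (\<eta> ?R M m))
          = fn (Sym_iso f N \<cdot>\<^bsub>CAlg ?S\<^esub> Fa (push ?Q f) (Fa (Sym ?R) k)) (\<upsilon> f (SymAlg ?R M) (\<eta> ?R M m))"
        using Al.fn_Cmp_E[OF Sym_iso_Hom[OF f M] u] Al.fn_Cmp_E[OF Qk(1) u] Sym_iso_unit[OF f M m]
          Sym_map(2)[OF Pk(1) um] Pk(2)[OF m] Qk(2)[OF \<eta>m] Sym_map(2)[OF k m]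
          Sym_iso_unit[OF f N Mo.fn_in_carrier[OF k m]] M
        by simp
    qed
    then show ?thesis
      by (simp add: comp_fctr_def)
  qed
  show "\<exists>q \<in> Hom (CAlg ?S) (Fo ?G M) (Fo ?F M).
      q \<cdot>\<^bsub>CAlg ?S\<^esub> Sym_iso f M = Idt (CAlg ?S) (Fo ?F M) \<and>
      Sym_iso f M \<cdot>\<^bsub>CAlg ?S\<^esub> q = Idt (CAlg ?S) (Fo ?G M)" if "M \<in> Obj (RMod ?R)" for M
  proof -
    have M: "module ?R M" using that by simp
    let ?A = "ext_algebra f (SymAlg ?R M)" and ?XM = "ext_module f M"
    have XM: "module ?S ?XM"
      using Mo.X_ob[OF f, of M] M by simp
    have A: "algebra ?S ?A" and B: "algebra ?S (SymAlg ?S ?XM)"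
      using Al_ob(2)[OF f M] Sym_algebra[OF XM] .
    note iso = Sym_iso_Hom[OF f M]
    have "compose (carrier M) (\<upsilon> f (SymAlg ?R M)) (\<eta> ?R M) \<in> module_hom ?R M (restrict_scalars f ?A)"
      using Sym_unit_Hom[OF M] Al.unit_hm[OF f Al_ob(1)[OF f M]]
      by (intro module_hom_comp[OF M, where N = "SymAlg ?R M"]) (simp_all add: Hom_RMod)
    then obtain p where p: "p \<in> Hom (RMod ?S) ?XM ?A"
      "\<And>m. m \<in> carrier M \<Longrightarrow> fn p (\<upsilon> f M m) = \<upsilon> f (SymAlg ?R M) (\<eta> ?R M m)"
      using Mo.lift_Hom[OF f, of M ?A "compose (carrier M) (\<upsilon> f (SymAlg ?R M)) (\<eta> ?R M)"] M algebra.module[OF A]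
      by (auto simp: compose_def)
    obtain q where q: "q \<in> Hom (CAlg ?S) (SymAlg ?S ?XM) ?A"
      "\<And>x. x \<in> carrier ?XM \<Longrightarrow> fn q (\<eta> ?S ?XM x) = fn p x"
      using Sym_lift[OF XM A p(1)] by blast
    have um: "\<upsilon> f M m \<in> carrier ?XM" if "m \<in> carrier M" for m
      using Mo.unit_closed[OF f _ that] M by simp
    have "q \<cdot>\<^bsub>CAlg ?S\<^esub> Sym_iso f M = Idt (CAlg ?S) ?A"
    proof (rule ext_Sym_eqI[OF f M CS.Cmp_in_Hom[OF iso q(1)] CS.Idt_in_Hom])
      fix m assume m: "m \<in> carrier M"
      note u = Al.unit_closed[OF f Al_ob(1)[OF f M] Sym_unit_closed[OF M m]]
      show "fn (q \<cdot>\<^bsub>CAlg ?S\<^esub> Sym_iso f M) (\<upsilon> f (SymAlg ?R M) (\<eta> ?R M m))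
          = fn (Idt (CAlg ?S) ?A) (\<upsilon> f (SymAlg ?R M) (\<eta> ?R M m))"
        using Al.fn_Cmp_E[OF iso u] Sym_iso_unit[OF f M m] q(2)[OF um[OF m]] p(2)[OF m] u by simp
    qed (use A in simp)
    moreover have "Sym_iso f M \<cdot>\<^bsub>CAlg ?S\<^esub> q = Idt (CAlg ?S) (SymAlg ?S ?XM)"
    proof (rule Sym_eqI[OF XM CS.Cmp_in_Hom[OF q(1) iso] CS.Idt_in_Hom])
      \<comment> \<open>On \<open>M \<otimes>\<^sub>R S\<close> this is an equation of \<open>S\<close>-linear maps, to be checked on the elements \<open>m \<otimes> 1\<close>.\<close>
      have iso_p: "Sym_iso f M \<cdot>\<^bsub>RMod ?S\<^esub> p = Sym_unit ?S ?XM"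
      proof (rule Mo.Hom_eqI[OF f _ RS.Cmp_in_Hom[OF p(1) CAlg_RMod[OF iso]] Sym_unit_Hom[OF XM]])
        fix m assume m: "m \<in> carrier M"
        show "fn (Sym_iso f M \<cdot>\<^bsub>RMod ?S\<^esub> p) (\<upsilon> f M m) = \<eta> ?S ?XM (\<upsilon> f M m)"
          using Mo.fn_Cmp_E[OF p(1) um[OF m]] p(2)[OF m] Sym_iso_unit[OF f M m] by simp
      qed (use M in simp)
      fix x assume x: "x \<in> carrier ?XM"
      show "fn (Sym_iso f M \<cdot>\<^bsub>CAlg ?S\<^esub> q) (\<eta> ?S ?XM x) = fn (Idt (CAlg ?S) (SymAlg ?S ?XM)) (\<eta> ?S ?XM x)"
        using Al.fn_Cmp_E[OF q(1) Sym_unit_closed[OF XM x]] q(2)[OF x] Mo.fn_Cmp_E[OF p(1) x, of "Sym_iso f M"]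
          iso_p Sym_unit_closed[OF XM x] by simp
    qed (use B in simp)
    ultimately show ?thesis
      using q(1) by (auto simp: comp_fctr_def simp del: Al.E_simps)
  qed
qed

text \<open>
  On the generator \<open>(\<eta> m \<otimes> 1) \<otimes> 1\<close> the left-hand side passes through \<open>\<eta> m \<otimes> 1\<close> and the right-hand side
  through \<open>\<eta> (m \<otimes> 1) \<otimes> 1\<close> and \<open>\<eta> ((m \<otimes> 1) \<otimes> 1)\<close>; both end in \<open>\<eta> (m \<otimes> 1)\<close>.
\<close>

lemma Sym_iso_compositor:
  assumes f: "(f :: 'u ring_arrow) \<in> Arr Cring" and g: "g \<in> Arr Cring" "src g = tgt f" and M: "module (src f) M"
  shows "Sym_iso (g \<cdot>\<^bsub>Cring\<^esub> f) M \<cdot>\<^bsub>CAlg (tgt g)\<^esub> compositor CAlg_psfunctor f g (SymAlg (src f) M)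
    = Fa (Sym (tgt g)) (compositor RMod_psfunctor f g M) \<cdot>\<^bsub>CAlg (tgt g)\<^esub> Sym_iso g (ext_module f M)
        \<cdot>\<^bsub>CAlg (tgt g)\<^esub> Fa (push CAlg_psfunctor g) (Sym_iso f M)"
  unfolding CAlg_psfunctor_def RMod_psfunctor_def
proof -
  let ?R = "src f" and ?S = "tgt f" and ?T = "tgt g"
  let ?P = "ext_psfunctor RMod ext_module :: ('u ring, 'u ring_arrow, 'u mod_obj, 'u mod_arrow) psfunctor"
  let ?Q = "ext_psfunctor CAlg ext_algebra :: ('u ring, 'u ring_arrow, 'u mod_obj, 'u mod_arrow) psfunctor"
  let ?gf = "g \<cdot>\<^bsub>Cring\<^esub> f"
  let ?A = "SymAlg ?R M" and ?XM = "ext_module f M"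
  interpret CT: category "CAlg ?T"
    using g by (intro Al.category_E) (simp add: Arr_Cring)
  have gf: "?gf \<in> Arr Cring" "module (src ?gf) M"
    using Cmp_Cring_in_Arr[OF f g] M by (simp_all add: Cmp_Cring)
  have XM: "module (src g) ?XM"
    using Mo.X_ob[OF f, of M] M g by simp
  have Mob: "M \<in> {M. module ?R M}"
    using M by simp
  note \<phi>gf = Sym_iso_Hom[OF gf, unfolded Cmp_Cring(1,2)] and \<phi>gf_u = Sym_iso_unit[OF gf, unfolded Cmp_Cring(1,2)]
  note \<phi>g = Sym_iso_Hom[OF g(1) XM] and \<phi>g_u = Sym_iso_unit[OF g(1) XM]
  note \<phi>f = Sym_iso_Hom[OF f M] and \<phi>f_u = Sym_iso_unit[OF f M]
  note cP = Mo.compositor_Hom[OF f g Mob] and cQ = Al.compositor_Hom[OF f g Al_ob(1)[OF f M]]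
  note X\<phi> = Al.push_Hom[OF g(1) \<phi>f[folded g(2)]]
  show "Sym_iso ?gf M \<cdot>\<^bsub>CAlg ?T\<^esub> compositor ?Q f g ?A
    = Fa (Sym ?T) (compositor ?P f g M) \<cdot>\<^bsub>CAlg ?T\<^esub> Sym_iso g ?XM \<cdot>\<^bsub>CAlg ?T\<^esub> Fa (push ?Q g) (Sym_iso f M)"
  proof (rule ext_ext_Sym_eqI[OF f g M])
    show "Sym_iso ?gf M \<cdot>\<^bsub>CAlg ?T\<^esub> compositor ?Q f g ?A
        \<in> Hom (CAlg ?T) (ext_algebra g (ext_algebra f ?A)) (SymAlg ?T (ext_module ?gf M))"
      by (rule CT.Cmp_in_Hom[OF cQ(1) \<phi>gf])
    have SP: "Fa (Sym ?T) (compositor ?P f g M) \<cdot>\<^bsub>CAlg ?T\<^esub> Sym_iso g ?XM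
        \<in> Hom (CAlg ?T) (ext_algebra g (SymAlg (src g) ?XM)) (SymAlg ?T (ext_module ?gf M))"
      by (rule CT.Cmp_in_Hom[OF \<phi>g Sym_map(1)[OF cP(1)]])
    show "Fa (Sym ?T) (compositor ?P f g M) \<cdot>\<^bsub>CAlg ?T\<^esub> Sym_iso g ?XM \<cdot>\<^bsub>CAlg ?T\<^esub> Fa (push ?Q g) (Sym_iso f M)
        \<in> Hom (CAlg ?T) (ext_algebra g (ext_algebra f ?A)) (SymAlg ?T (ext_module ?gf M))"
      by (rule CT.Cmp_in_Hom[OF X\<phi>(1) SP])
    fix m assume m: "m \<in> carrier M"
    note \<eta>m = Sym_unit_closed[OF M m]
    note u = Al.unit_closed[OF f Al_ob(1)[OF f M] \<eta>m]
    have L: "ext_algebra f ?A \<in> {A. algebra (src g) A}"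
      using Al_ob(2)[OF f M] g by simp
    note uu = Al.unit_closed[OF g(1) L u]
    note um = Mo.unit_closed[OF f Mob m]
    have XMob: "?XM \<in> {M. module (src g) M}" using XM by simp
    note uum = Mo.unit_closed[OF g(1) XMob um]
    note \<eta>um = Sym_unit_closed[OF XM um]
    have "SymAlg (src g) ?XM \<in> {A. algebra (src g) A}"
      using Sym_algebra[OF XM] by simp
    note u\<eta>um = Al.unit_closed[OF g(1) this \<eta>um]
    have "fn (Sym_iso ?gf M \<cdot>\<^bsub>CAlg ?T\<^esub> compositor ?Q f g ?A) (\<upsilon> g (ext_algebra f ?A) (\<upsilon> f ?A (\<eta> ?R M m)))
        = \<eta> ?T (ext_module ?gf M) (\<upsilon> ?gf M m)"
      using Al.fn_Cmp_E[OF cQ(1) uu] cQ(2)[OF \<eta>m] \<phi>gf_u[OF m] by simp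
    also have "\<dots> = fn (Fa (Sym ?T) (compositor ?P f g M) \<cdot>\<^bsub>CAlg ?T\<^esub> Sym_iso g ?XM)
        (\<upsilon> g (SymAlg ?S ?XM) (\<eta> ?S ?XM (\<upsilon> f M m)))"
      using Al.fn_Cmp_E[OF \<phi>g u\<eta>um] \<phi>g_u[OF um] Sym_map(2)[OF cP(1) uum] cP(2)[OF m] g(2) by simp
    also have "\<dots> = fn (Fa (Sym ?T) (compositor ?P f g M) \<cdot>\<^bsub>CAlg ?T\<^esub> Sym_iso g ?XM
        \<cdot>\<^bsub>CAlg ?T\<^esub> Fa (push ?Q g) (Sym_iso f M)) (\<upsilon> g (ext_algebra f ?A) (\<upsilon> f ?A (\<eta> ?R M m)))"
      using Al.fn_Cmp_E[OF X\<phi>(1) uu] X\<phi>(2)[OF u] \<phi>f_u[OF m] g(2) by simp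
    finally show "fn (Sym_iso ?gf M \<cdot>\<^bsub>CAlg ?T\<^esub> compositor ?Q f g ?A)
          (\<upsilon> g (ext_algebra f ?A) (\<upsilon> f ?A (\<eta> ?R M m)))
        = fn (Fa (Sym ?T) (compositor ?P f g M) \<cdot>\<^bsub>CAlg ?T\<^esub> Sym_iso g ?XM
          \<cdot>\<^bsub>CAlg ?T\<^esub> Fa (push ?Q g) (Sym_iso f M)) (\<upsilon> g (ext_algebra f ?A) (\<upsilon> f ?A (\<eta> ?R M m)))" .
  qed
qed

text \<open>
  Both sides send \<open>\<eta> m\<close> to \<open>\<eta> (m \<otimes> 1)\<close>.
\<close>

lemma Sym_iso_unitor:
  assumes M: "module (R :: 'u ring) M"
  shows "Sym_iso (Idt Cring R) M \<cdot>\<^bsub>CAlg R\<^esub> unitor CAlg_psfunctor R (SymAlg R M)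
    = Fa (Sym R) (unitor RMod_psfunctor R M)"
  unfolding CAlg_psfunctor_def RMod_psfunctor_def
proof -
  let ?i = "Idt Cring R"
  let ?P = "ext_psfunctor RMod ext_module :: ('u ring, 'u ring_arrow, 'u mod_obj, 'u mod_arrow) psfunctor"
  let ?Q = "ext_psfunctor CAlg ext_algebra :: ('u ring, 'u ring_arrow, 'u mod_obj, 'u mod_arrow) psfunctor"
  have R: "cring R" using M by (rule module.axioms)
  note i = Al.Idt_Cring[OF R]
  interpret CR: category "CAlg R" by (rule Al.category_E[OF R])
  have iM: "module (src ?i) M" using M i by simp
  have ob: "M \<in> {M. module R M}" "SymAlg R M \<in> {A. algebra R A}"
    using M Sym_algebra[OF M] by simp_all
  note \<phi> = Sym_iso_Hom[OF i(1) iM, unfolded i] and \<phi>_u = Sym_iso_unit[OF i(1) iM, unfolded i]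
  note uP = Mo.unitor_Hom[OF R ob(1)] and uQ = Al.unitor_Hom[OF R ob(2)]
  show "Sym_iso ?i M \<cdot>\<^bsub>CAlg R\<^esub> unitor ?Q R (SymAlg R M) = Fa (Sym R) (unitor ?P R M)"
  proof (rule Sym_eqI[OF M CR.Cmp_in_Hom[OF uQ(1) \<phi>] Sym_map(1)[OF uP(1)]])
    fix m assume m: "m \<in> carrier M"
    show "fn (Sym_iso ?i M \<cdot>\<^bsub>CAlg R\<^esub> unitor ?Q R (SymAlg R M)) (\<eta> R M m) = fn (Fa (Sym R) (unitor ?P R M)) (\<eta> R M m)"
      using Al.fn_Cmp_E[OF uQ(1) Sym_unit_closed[OF M m]] uQ(2) uP(2) \<phi>_u[OF m] Sym_map(2)[OF uP(1) m] by simp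
  qed
qed

lemma Sym_pseudonatural:
  "pseudonatural_transformation (Cring :: ('u ring, 'u ring_arrow) category)
    RMod_psfunctor CAlg_psfunctor Sym Sym_iso"
proof (intro pseudonatural_transformation.intro pseudonatural_transformation_axioms.intro)
  show "pseudofunctor (Cring :: ('u ring, 'u ring_arrow) category) RMod_psfunctor"
    unfolding RMod_psfunctor_def by (rule Mo.pseudofunctor)
  show "pseudofunctor (Cring :: ('u ring, 'u ring_arrow) category) CAlg_psfunctor"
    unfolding CAlg_psfunctor_def by (rule Al.pseudofunctor)
  have fibre [simp]: "fibre RMod_psfunctor = RMod" "fibre CAlg_psfunctor = CAlg"
    "Fo (push RMod_psfunctor f) = ext_module f" for f :: "'u ring_arrow"
    by (simp_all add: RMod_psfunctor_def CAlg_psfunctor_def ext_psfunctor_def ext_fctr_def)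
  show "cat_functor (fibre RMod_psfunctor R) (fibre CAlg_psfunctor R) (Sym R)"
    if "R \<in> Obj Cring" for R :: "'u ring"
    using Sym_functor[of R] that by (simp add: Cring_def)
  show "nat_iso (fibre RMod_psfunctor R) (fibre CAlg_psfunctor S) (push CAlg_psfunctor f \<circ>\<^sub>F Sym R)
      (Sym S \<circ>\<^sub>F push RMod_psfunctor f) (Sym_iso f)" if "f \<in> Hom Cring R S" for f and R S :: "'u ring"
    using Sym_iso_nat_iso[of f] that by (auto simp: Hom_Cring_iff)
  show "Sym_iso (g \<cdot>\<^bsub>Cring\<^esub> f) M \<cdot>\<^bsub>fibre CAlg_psfunctor T\<^esub> compositor CAlg_psfunctor f g (Fo (Sym R) M)
      = Fa (Sym T) (compositor RMod_psfunctor f g M) \<cdot>\<^bsub>fibre CAlg_psfunctor T\<^esub>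
        Sym_iso g (Fo (push RMod_psfunctor f) M) \<cdot>\<^bsub>fibre CAlg_psfunctor T\<^esub> Fa (push CAlg_psfunctor g) (Sym_iso f M)"
    if "f \<in> Hom Cring R S" "g \<in> Hom Cring S T" "M \<in> Obj (fibre RMod_psfunctor R)" for f g and R S T :: "'u ring" and M
    using Sym_iso_compositor[of f g M] that by (auto simp: Hom_Cring_iff)
  show "Sym_iso (Idt Cring R) M \<cdot>\<^bsub>fibre CAlg_psfunctor R\<^esub> unitor CAlg_psfunctor R (Fo (Sym R) M)
      = Fa (Sym R) (unitor RMod_psfunctor R M)"
    if "R \<in> Obj Cring" "M \<in> Obj (fibre RMod_psfunctor R)" for R :: "'u ring" and M
    using Sym_iso_unitor[of R M] that by simp
qed

end

theorem corollary2p3p3: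
  assumes "infinite (UNIV :: 'u set)"
  shows "pseudonatural_transformation (Cring :: ('u ring, 'u ring_arrow) category)
    RMod_psfunctor CAlg_psfunctor Sym Sym_iso"
  by (rule Sym_pseudonatural[OF assms])

end
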